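(* Let $k:R^a\to\mathbb{C}$ be a $W^a$-invariant multiplicity function. The propagation transformation $T^k=(T^{k,M})_M$, with $M$ running over complex left $W^a$-modules, defines a natural transformation $T^k: F_{ir}^k\rightarrow F_{dr}^k$ of functors $\mathrm{Mod}_{\mathbb{C}[W^a]}\to\mathrm{Mod}_{A(k)}$.
   Context: Root data. $V$ is a finite-dimensional real Euclidean vector space, $V^*$ its dual with the induced scalar product, $V_{\mathbb{C}},V_{\mathbb{C}}^*$ the complexifications. $R\subset V^*$ is a reduced crystallographic root system, irreducible in its span (it need not span $V^*$). For $0\ne\xi\in V^*$, $\xi^\vee\in V$ is defined by $\eta(\xi^\vee)=2\langle\eta,\xi\rangle/\langle\xi,\xi\rangle$ for all $\eta\in V^*$. $W\subset O(V)$ is the Weyl group generated by $s_\alpha(v)=v-\alpha(v)\alpha^\vee$ ($\alpha\in R$). $X\subset V^*$ is a full lattice containing the root lattice $Q=\mathbb{Z}R$ and such that its dual lattice $Y=\{y\in V\mid \xi(y)\in\mathbb{Z}\ \forall \xi\in X\}$ contains the co-root lattice $Q^\vee=\mathbb{Z}R^\vee$. $t_y(v)=v+y$; $W^a=W\ltimes Y=\{wt_y\}$ is the extended affine Weyl group, acting on $V$ by isometries; $D:W^a\to W$, $D(wt_y)=w$. $R^a=\{\alpha+m1\mid\alpha\in R,m\in\mathbb{Z}\}$ is the affine root system, $a=\alpha+m1$ being the function $a(v)=\alpha(v)+m$ on $V$; $Da:=\alpha$, $Da^\vee:=\alpha^\vee$. $W^a$ acts on $R^a$ by $(wa)(v)=a(w^{-1}v)$.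 $V_a=a^{-1}(0)$ and $s_a(v)=v-a(v)Da^\vee$, an element of $W^a$. Fix a basis $F$ of $R$ with positive/negative roots $R^\pm$ and highest root $\theta$; $a_0=-\theta+1$, $F^a=F\cup\{a_0\}$, $R^{a,+}=(R+\mathbb{Z}_{>0}1)\cup R^+$, $R^{a,-}=-R^{a,+}$; $l(w)=\#(R^{a,+}\cap w^{-1}R^{a,-})$ and $\Omega=\{w\in W^a\mid l(w)=0\}$. A multiplicity function is a $W^a$-invariant function $k:R^a\to\mathbb{C}$, $a\mapsto k_a$. Algebra $A(k)$: the unital associative $\mathbb{C}$-algebra containing $S(V_{\mathbb{C}})$ and $\mathbb{C}[W^a]$ as subalgebras, such that multiplication $S(V_{\mathbb{C}})\otimes_{\mathbb{C}}\mathbb{C}[W^a]\to A(k)$ is a linear isomorphism, with relations $s_a\cdot v-s_{Da}(v)\cdot s_a=-k_a\,Da(v)$ ($a\in F^a$, $v\in V_{\mathbb{C}}$) and $\omega\cdot v=(D\omega)(v)\cdot\omega$ ($\omega\in\Omega$, $v\in V_{\mathbb{C}}$). $\mathrm{Mod}_A$ denotes the category of complex left $A$-modules. Function spaces. $C_+=\{v\in V\mid a(v)>0\ \forall a\in F^a\}$; $V_{reg}=V\setminus\bigcup_{a\in R^{a,+}}V_a$; $\mathcal{C}$ is the set of connected components (chambers) of $V_{reg}$, which are the $w(C_+)$, $w\in W^a$. $C^\omega(V)$ is the space of complex-valued real analytic functions on $V$, with $W^a$-action $(wg)(v)=g(w^{-1}v)$. $B^\omega(V;M)$ is the space of functions $f:V_{reg}\to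 M$ such that for every $C\in\mathcal{C}$, $f|_C=f_C|_C$ for some (unique) $f_C\in C^\omega(V)\otimes_{\mathbb{C}}M$. $W^a$ acts on it by $(w\cdot f)(v)=w(f(w^{-1}v))$. Functor $F_{dr}^k$: $F_{dr}^k(M)=B^\omega(V;M)$, where $w\in W^a$ acts by $w\cdot$ and $v\in V$ acts by $$\mathcal{D}_v^{k,M}f=\partial_vf-\sum_{a\in R^{a,+}}k_a(Da)(v)\,\mathcal{I}_a(\cdot)\,(s_a\cdot f),$$ with $\mathcal{I}_a(x)=1$ if $a(x)<0$ and $0$ if $a(x)>0$ ($x\in V_{reg}$); on a morphism $\phi:M\to M'$ it is $f\mapsto\phi\circ f$. (It is known that this is an $A(k)$-module.) Functor $F_{ir}^k$: $F_{ir}^k(M)=C^\omega(V)\otimes_{\mathbb{C}}M$ with $A(k)$-action $Q_{k,M}$ determined by $v\mapsto\partial_v\otimes\mathrm{Id}_M$ ($v\in V$), $s_a\mapsto s_a\otimes s_a-k_aI(a)\otimes\mathrm{Id}_M$ ($a\in F^a$), $\omega\mapsto\omega\otimes\omega$ ($\omega\in\Omega$), where $(I(a)f)(v)=\int_0^{a(v)}f(v-tDa^\vee)dt$; on a morphism $\phi$ it is $\mathrm{Id}\otimes\phi$. (It is known that this is an $A(k)$-module.) Propagation transformation: $T^{k,M}:C^\omega(V)\otimes_{\mathbb{C}}M\to B^\omega(V;M)$ is the unique linear map with $(T^{k,M}f)_{C_+}=f$ and $T^{k,M}(Q_{k,M}(w)f)=w\cdot(T^{k,M}f)$ for all $w\in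 W^a$; equivalently $(T^{k,M}f)_{w^{-1}C_+}=(w^{-1}\otimes w^{-1})(Q_{k,M}(w)f)$ for all $w\in W^a$. *)

theory Defs
  imports
    "HOL-Analysis.Analysis"
    "HOL-Library.Poly_Mapping"
    "HOL-Library.Function_Algebras"
begin

section \<open>Root data\<close>

text \<open>
  The Euclidean space is a type \<open>'v\<close> of class \<open>euclidean_space\<close>, its dual is the type of bounded
  linear functionals on \<open>'v\<close>.
\<close>

type_synonym 'v dual = "('v, real) blinfun"

definition dual_inner :: "'v::euclidean_space dual \<Rightarrow> 'v dual \<Rightarrow> real" where
  "dual_inner \<xi> \<eta> = (\<Sum>b\<in>Basis. blinfun_apply \<xi> b * blinfun_apply \<eta> b)"

definition coroot :: "'v::euclidean_space dual \<Rightarrow> 'v" where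
  "coroot \<xi> = (THE v. \<forall>\<eta>. blinfun_apply \<eta> v = 2 * dual_inner \<eta> \<xi> / dual_inner \<xi> \<xi>)"

definition refl :: "'v::euclidean_space dual \<Rightarrow> 'v \<Rightarrow> 'v" where
  "refl \<alpha> v = v - blinfun_apply \<alpha> v *\<^sub>R coroot \<alpha>"

definition dual_refl :: "'v::euclidean_space dual \<Rightarrow> 'v dual \<Rightarrow> 'v dual" where
  "dual_refl \<alpha> \<beta> = \<beta> - blinfun_apply \<beta> (coroot \<alpha>) *\<^sub>R \<alpha>"

text \<open>The following two notions are only used for finite sets \<open>S\<close>.\<close>

definition int_span :: "'x::real_vector set \<Rightarrow> 'x set" where
  "int_span S = {\<Sum>x\<in>S. real_of_int (c x) *\<^sub>R x | c. True}"

definition nat_span :: "'x::real_vector set \<Rightarrow> 'x set" where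
  "nat_span S = {\<Sum>x\<in>S. real (c x) *\<^sub>R x | c. True}"

definition full_lattice :: "'x::real_vector set \<Rightarrow> bool" where
  "full_lattice L \<longleftrightarrow> (\<exists>B. finite B \<and> independent B \<and> span B = UNIV \<and> L = int_span B)"

text \<open>Reduced and crystallographic; the roots need not span the dual space.\<close>

definition root_system :: "'v::euclidean_space dual set \<Rightarrow> bool" where
  "root_system R \<longleftrightarrow>
     finite R \<and> 0 \<notin> R \<and>
     (\<forall>\<alpha>\<in>R. \<forall>\<beta>\<in>R. dual_refl \<alpha> \<beta> \<in> R) \<and>
     (\<forall>\<alpha>\<in>R. \<forall>\<beta>\<in>R. blinfun_apply \<beta> (coroot \<alpha>) \<in> \<int>) \<and>
     (\<forall>\<alpha>\<in>R. \<forall>c. c *\<^sub>R \<alpha> \<in> R \<longrightarrow> c = 1 \<or> c = -1)"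

definition irreducible_roots :: "'v::euclidean_space dual set \<Rightarrow> bool" where
  "irreducible_roots R \<longleftrightarrow>
     R \<noteq> {} \<and>
     \<not> (\<exists>R1 R2. R1 \<noteq> {} \<and> R2 \<noteq> {} \<and> R1 \<union> R2 = R \<and> R1 \<inter> R2 = {} \<and>
          (\<forall>\<alpha>\<in>R1. \<forall>\<beta>\<in>R2. dual_inner \<alpha> \<beta> = 0))"

definition root_basis :: "'v::euclidean_space dual set \<Rightarrow> 'v dual set \<Rightarrow> bool" where
  "root_basis R F \<longleftrightarrow> F \<subseteq> R \<and> independent F \<and> (\<forall>\<alpha>\<in>R. \<alpha> \<in> nat_span F \<or> - \<alpha> \<in> nat_span F)"

definition is_highest_root :: "'v::euclidean_space dual set \<Rightarrow> 'v dual set \<Rightarrow> 'v dual \<Rightarrow> bool" where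
  "is_highest_root R F \<theta> \<longleftrightarrow> \<theta> \<in> R \<and> (\<forall>\<alpha>\<in>R. \<theta> - \<alpha> \<in> nat_span F)"

definition dual_lattice :: "'v::euclidean_space dual set \<Rightarrow> 'v set" where
  "dual_lattice X = {y. \<forall>\<xi>\<in>X. blinfun_apply \<xi> y \<in> \<int>}"

record (overloaded) ('v::euclidean_space) root_data =
  roots :: "'v dual set"
  lattice :: "'v dual set"
  simple_roots :: "'v dual set"
  highest_root :: "'v dual"

definition root_datum :: "'v::euclidean_space root_data \<Rightarrow> bool" where
  "root_datum \<Delta> \<longleftrightarrow>
     root_system (roots \<Delta>) \<and> irreducible_roots (roots \<Delta>) \<and>
     full_lattice (lattice \<Delta>) \<and>
     int_span (roots \<Delta>) \<subseteq> lattice \<Delta> \<and>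
     int_span (coroot ` roots \<Delta>) \<subseteq> dual_lattice (lattice \<Delta>) \<and>
     root_basis (roots \<Delta>) (simple_roots \<Delta>) \<and>
     is_highest_root (roots \<Delta>) (simple_roots \<Delta>) (highest_root \<Delta>)"

text \<open>Products of reflections suffice for the group generated, as reflections are involutions.\<close>

inductive_set weyl_group :: "'v::euclidean_space root_data \<Rightarrow> ('v \<Rightarrow> 'v) set"
  for \<Delta> where
  one: "id \<in> weyl_group \<Delta>"
| step: "\<alpha> \<in> roots \<Delta> \<Longrightarrow> w \<in> weyl_group \<Delta> \<Longrightarrow> refl \<alpha> \<circ> w \<in> weyl_group \<Delta>"

definition translation :: "'v::euclidean_space \<Rightarrow> 'v \<Rightarrow> 'v" where
  "translation y v = v + y"

definition affine_weyl_group :: "'v::euclidean_space root_data \<Rightarrow> ('v \<Rightarrow> 'v) set" where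
  "affine_weyl_group \<Delta> =
     {w \<circ> translation y | w y. w \<in> weyl_group \<Delta> \<and> y \<in> dual_lattice (lattice \<Delta>)}"

definition weyl_part :: "'v::euclidean_space root_data \<Rightarrow> ('v \<Rightarrow> 'v) \<Rightarrow> 'v \<Rightarrow> 'v" where
  "weyl_part \<Delta> w =
     (THE u. u \<in> weyl_group \<Delta> \<and> (\<exists>y\<in>dual_lattice (lattice \<Delta>). w = u \<circ> translation y))"


section \<open>Affine roots\<close>

text \<open>An affine root is the affine function on \<open>'v\<close> itself.\<close>

definition affine_fun :: "'v::euclidean_space dual \<Rightarrow> real \<Rightarrow> 'v \<Rightarrow> real" where
  "affine_fun \<alpha> c v = blinfun_apply \<alpha> v + c"

definition grad :: "('v::euclidean_space \<Rightarrow> real) \<Rightarrow> 'v dual" where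
  "grad a = (THE \<alpha>. \<exists>c. a = affine_fun \<alpha> c)"

definition affine_refl :: "('v::euclidean_space \<Rightarrow> real) \<Rightarrow> 'v \<Rightarrow> 'v" where
  "affine_refl a v = v - a v *\<^sub>R coroot (grad a)"

definition affine_roots :: "'v::euclidean_space root_data \<Rightarrow> ('v \<Rightarrow> real) set" where
  "affine_roots \<Delta> = {affine_fun \<alpha> (real_of_int m) | \<alpha> m. \<alpha> \<in> roots \<Delta>}"

definition positive_roots :: "'v::euclidean_space root_data \<Rightarrow> 'v dual set" where
  "positive_roots \<Delta> = roots \<Delta> \<inter> nat_span (simple_roots \<Delta>)"

definition pos_affine_roots :: "'v::euclidean_space root_data \<Rightarrow> ('v \<Rightarrow> real) set" where
  "pos_affine_roots \<Delta> =
     {affine_fun \<alpha> (real_of_int m) | \<alpha> m. \<alpha> \<in> roots \<Delta> \<and> m > 0} \<union>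
     {affine_fun \<alpha> 0 | \<alpha>. \<alpha> \<in> positive_roots \<Delta>}"

definition neg_affine_roots :: "'v::euclidean_space root_data \<Rightarrow> ('v \<Rightarrow> real) set" where
  "neg_affine_roots \<Delta> = {(\<lambda>v. - a v) | a. a \<in> pos_affine_roots \<Delta>}"

definition simple_affine_roots :: "'v::euclidean_space root_data \<Rightarrow> ('v \<Rightarrow> real) set" where
  "simple_affine_roots \<Delta> =
     {affine_fun \<beta> 0 | \<beta>. \<beta> \<in> simple_roots \<Delta>} \<union> {affine_fun (- highest_root \<Delta>) 1}"

text \<open>The natural action of isometries of \<open>'v\<close> on functions on \<open>'v\<close> with values in any type; it is
  used both for affine roots and for analytic functions.\<close>

definition fun_act :: "('v \<Rightarrow> 'v) \<Rightarrow> ('v \<Rightarrow> 'x) \<Rightarrow> 'v \<Rightarrow> 'x" where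
  "fun_act w g v = g (inv w v)"

definition weyl_length :: "'v::euclidean_space root_data \<Rightarrow> ('v \<Rightarrow> 'v) \<Rightarrow> nat" where
  "weyl_length \<Delta> w = card (pos_affine_roots \<Delta> \<inter> fun_act (inv w) ` neg_affine_roots \<Delta>)"

definition length_zero :: "'v::euclidean_space root_data \<Rightarrow> ('v \<Rightarrow> 'v) set" where
  "length_zero \<Delta> = {w \<in> affine_weyl_group \<Delta>. weyl_length \<Delta> w = 0}"

definition multiplicity_function ::
    "'v::euclidean_space root_data \<Rightarrow> (('v \<Rightarrow> real) \<Rightarrow> complex) \<Rightarrow> bool" where
  "multiplicity_function \<Delta> k \<longleftrightarrow>
     (\<forall>w\<in>affine_weyl_group \<Delta>. \<forall>a\<in>affine_roots \<Delta>. k (fun_act w a) = k a)"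


section \<open>The algebra\<close>

text \<open>
  The complexification of \<open>'v\<close> is \<open>'v \<times> 'v\<close>, where \<open>(x, y)\<close> stands for \<open>x + i y\<close>.
  The symmetric algebra of the complexification is realized as the polynomial ring over the complex
  numbers in the indeterminates indexed by the orthonormal basis \<open>Basis\<close>.
\<close>

type_synonym 'v sym = "('v \<Rightarrow>\<^sub>0 nat) \<Rightarrow>\<^sub>0 complex"

definition sym_alg :: "'v::euclidean_space sym set" where
  "sym_alg = {p. \<forall>n\<in>Poly_Mapping.keys p. Poly_Mapping.keys n \<subseteq> Basis}"

definition sym_vec :: "'v::euclidean_space \<times> 'v \<Rightarrow> 'v sym" where
  "sym_vec v =
     (\<Sum>b\<in>Basis. Poly_Mapping.single (Poly_Mapping.single b 1) (Complex (fst v \<bullet> b) (snd v \<bullet> b)))"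

definition cplx_fun :: "'v::euclidean_space dual \<Rightarrow> 'v \<times> 'v \<Rightarrow> complex" where
  "cplx_fun \<xi> v = Complex (blinfun_apply \<xi> (fst v)) (blinfun_apply \<xi> (snd v))"

definition cplx_map :: "('v \<Rightarrow> 'v) \<Rightarrow> 'v \<times> 'v \<Rightarrow> 'v \<times> 'v" where
  "cplx_map L v = (L (fst v), L (snd v))"

text \<open>The group algebra: finitely supported functions with convolution.\<close>

type_synonym 'v grp = "('v \<Rightarrow> 'v) \<Rightarrow>\<^sub>0 complex"

definition group_alg :: "'v::euclidean_space root_data \<Rightarrow> 'v grp set" where
  "group_alg \<Delta> = {p. Poly_Mapping.keys p \<subseteq> affine_weyl_group \<Delta>}"

definition group_elem :: "('v \<Rightarrow> 'v) \<Rightarrow> 'v grp" where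
  "group_elem w = Poly_Mapping.single w 1"

definition conv :: "'v grp \<Rightarrow> 'v grp \<Rightarrow> 'v grp" where
  "conv p q =
     (\<Sum>u\<in>Poly_Mapping.keys p. \<Sum>w\<in>Poly_Mapping.keys q.
        Poly_Mapping.single (u \<circ> w) (Poly_Mapping.lookup p u * Poly_Mapping.lookup q w))"

text \<open>
  A complex algebra on the type \<open>'a\<close> (addition is that of the type), together with maps from the
  symmetric algebra and from the group algebra into it.
\<close>

record ('v, 'a) alg_data =
  scale :: "complex \<Rightarrow> 'a \<Rightarrow> 'a"
  mult :: "'a \<Rightarrow> 'a \<Rightarrow> 'a"
  one :: 'a
  of_sym :: "'v sym \<Rightarrow> 'a"
  of_grp :: "'v grp \<Rightarrow> 'a"

definition unital_algebra :: "('v, 'a::ab_group_add) alg_data \<Rightarrow> bool" where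
  "unital_algebra A \<longleftrightarrow>
     vector_space (scale A) \<and>
     (\<forall>x y z. mult A (mult A x y) z = mult A x (mult A y z)) \<and>
     (\<forall>x. mult A (one A) x = x \<and> mult A x (one A) = x) \<and>
     (\<forall>x y z. mult A (x + y) z = mult A x z + mult A y z) \<and>
     (\<forall>x y z. mult A x (y + z) = mult A x y + mult A x z) \<and>
     (\<forall>c x y. mult A (scale A c x) y = scale A c (mult A x y)) \<and>
     (\<forall>c x y. mult A x (scale A c y) = scale A c (mult A x y))"

definition sym_subalgebra :: "('v::euclidean_space, 'a::ab_group_add) alg_data \<Rightarrow> bool" where
  "sym_subalgebra A \<longleftrightarrow>
     inj_on (of_sym A) sym_alg \<and>
     of_sym A 1 = one A \<and>
     (\<forall>p\<in>sym_alg. \<forall>q\<in>sym_alg.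
        of_sym A (p + q) = of_sym A p + of_sym A q \<and>
        of_sym A (p * q) = mult A (of_sym A p) (of_sym A q)) \<and>
     (\<forall>c. \<forall>p\<in>sym_alg. of_sym A (Poly_Mapping.single 0 c * p) = scale A c (of_sym A p))"

definition grp_subalgebra ::
    "'v::euclidean_space root_data \<Rightarrow> ('v, 'a::ab_group_add) alg_data \<Rightarrow> bool" where
  "grp_subalgebra \<Delta> A \<longleftrightarrow>
     inj_on (of_grp A) (group_alg \<Delta>) \<and>
     of_grp A (group_elem id) = one A \<and>
     (\<forall>p\<in>group_alg \<Delta>. \<forall>q\<in>group_alg \<Delta>.
        of_grp A (p + q) = of_grp A p + of_grp A q \<and>
        of_grp A (conv p q) = mult A (of_grp A p) (of_grp A q)) \<and>
     (\<forall>c. \<forall>p\<in>group_alg \<Delta>. of_grp A (Poly_Mapping.map ((*) c) p) = scale A c (of_grp A p))"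

text \<open>
  Since the group elements form a basis of the group algebra, the tensor product of the symmetric
  algebra and the group algebra consists of the finitely supported families of elements of the
  symmetric algebra indexed by the group: the family \<open>p\<close> stands for \<open>\<Sum>w. p w \<otimes> w\<close>.
\<close>

definition sym_tensor_grp :: "'v::euclidean_space root_data \<Rightarrow> (('v \<Rightarrow> 'v) \<Rightarrow>\<^sub>0 'v sym) set" where
  "sym_tensor_grp \<Delta> =
     {p. Poly_Mapping.keys p \<subseteq> affine_weyl_group \<Delta> \<and> (\<forall>w. Poly_Mapping.lookup p w \<in> sym_alg)}"

definition mult_map ::
    "('v::euclidean_space, 'a::ab_group_add) alg_data \<Rightarrow> (('v \<Rightarrow> 'v) \<Rightarrow>\<^sub>0 'v sym) \<Rightarrow> 'a" where
  "mult_map A p =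
     (\<Sum>w\<in>Poly_Mapping.keys p.
        mult A (of_sym A (Poly_Mapping.lookup p w)) (of_grp A (group_elem w)))"

text \<open>\<open>A\<close> is the algebra of the root datum \<open>\<Delta>\<close> and the multiplicity function \<open>k\<close>.\<close>

definition hecke_algebra ::
    "'v::euclidean_space root_data \<Rightarrow> (('v \<Rightarrow> real) \<Rightarrow> complex) \<Rightarrow>
     ('v, 'a::ab_group_add) alg_data \<Rightarrow> bool" where
  "hecke_algebra \<Delta> k A \<longleftrightarrow>
     unital_algebra A \<and> sym_subalgebra A \<and> grp_subalgebra \<Delta> A \<and>
     bij_betw (mult_map A) (sym_tensor_grp \<Delta>) UNIV \<and>
     (\<forall>a\<in>simple_affine_roots \<Delta>. \<forall>v.
        mult A (of_grp A (group_elem (affine_refl a))) (of_sym A (sym_vec v)) -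
        mult A (of_sym A (sym_vec (cplx_map (refl (grad a)) v)))
               (of_grp A (group_elem (affine_refl a))) =
        scale A (- (k a * cplx_fun (grad a) v)) (one A)) \<and>
     (\<forall>\<omega>\<in>length_zero \<Delta>. \<forall>v.
        mult A (of_grp A (group_elem \<omega>)) (of_sym A (sym_vec v)) =
        mult A (of_sym A (sym_vec (cplx_map (weyl_part \<Delta> \<omega>) v))) (of_grp A (group_elem \<omega>)))"

text \<open>
  A left module over \<open>A\<close>: a complex subspace \<open>E\<close> of the space \<open>'e\<close> with scalar multiplication \<open>s\<close>,
  and an action \<open>\<rho>\<close>, which only matters on \<open>E\<close>.
\<close>

definition alg_module ::
    "('v, 'a::ab_group_add) alg_data \<Rightarrow> (complex \<Rightarrow> 'e \<Rightarrow> 'e) \<Rightarrow> 'e::ab_group_add set \<Rightarrow>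
     ('a \<Rightarrow> 'e \<Rightarrow> 'e) \<Rightarrow> bool" where
  "alg_module A s E \<rho> \<longleftrightarrow>
     vector_space s \<and> module.subspace s E \<and>
     (\<forall>x. \<forall>e\<in>E. \<rho> x e \<in> E) \<and>
     (\<forall>x. \<forall>e\<in>E. \<forall>e'\<in>E. \<rho> x (e + e') = \<rho> x e + \<rho> x e') \<and>
     (\<forall>x c. \<forall>e\<in>E. \<rho> x (s c e) = s c (\<rho> x e)) \<and>
     (\<forall>x y. \<forall>e\<in>E. \<rho> (x + y) e = \<rho> x e + \<rho> y e) \<and>
     (\<forall>c x. \<forall>e\<in>E. \<rho> (scale A c x) e = s c (\<rho> x e)) \<and>
     (\<forall>x y. \<forall>e\<in>E. \<rho> (mult A x y) e = \<rho> x (\<rho> y e)) \<and>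
     (\<forall>e\<in>E. \<rho> (one A) e = e)"

definition linear_between ::
    "(complex \<Rightarrow> 'e \<Rightarrow> 'e) \<Rightarrow> 'e::ab_group_add set \<Rightarrow> (complex \<Rightarrow> 'f \<Rightarrow> 'f) \<Rightarrow>
     'f::ab_group_add set \<Rightarrow> ('e \<Rightarrow> 'f) \<Rightarrow> bool" where
  "linear_between s E s' E' T \<longleftrightarrow>
     (\<forall>e\<in>E. T e \<in> E') \<and>
     (\<forall>e\<in>E. \<forall>e'\<in>E. T (e + e') = T e + T e') \<and>
     (\<forall>c. \<forall>e\<in>E. T (s c e) = s' c (T e))"

definition alg_module_hom ::
    "(complex \<Rightarrow> 'e \<Rightarrow> 'e) \<Rightarrow> 'e::ab_group_add set \<Rightarrow> ('a \<Rightarrow> 'e \<Rightarrow> 'e) \<Rightarrow>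
     (complex \<Rightarrow> 'f \<Rightarrow> 'f) \<Rightarrow> 'f::ab_group_add set \<Rightarrow> ('a \<Rightarrow> 'f \<Rightarrow> 'f) \<Rightarrow>
     ('e \<Rightarrow> 'f) \<Rightarrow> bool" where
  "alg_module_hom s E \<rho> s' E' \<rho>' T \<longleftrightarrow>
     linear_between s E s' E' T \<and> (\<forall>x. \<forall>e\<in>E. T (\<rho> x e) = \<rho>' x (T e))"


section \<open>Modules over the group algebra of the affine Weyl group\<close>

record ('v, 'm) weyl_rep =
  mscale :: "complex \<Rightarrow> 'm \<Rightarrow> 'm"
  mact :: "('v \<Rightarrow> 'v) \<Rightarrow> 'm \<Rightarrow> 'm"

definition weyl_module ::
    "'v::euclidean_space root_data \<Rightarrow> ('v, 'm::ab_group_add) weyl_rep \<Rightarrow> bool" where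
  "weyl_module \<Delta> M \<longleftrightarrow>
     vector_space (mscale M) \<and>
     (\<forall>w\<in>affine_weyl_group \<Delta>. Vector_Spaces.linear (mscale M) (mscale M) (mact M w)) \<and>
     (\<forall>m. mact M id m = m) \<and>
     (\<forall>u\<in>affine_weyl_group \<Delta>. \<forall>w\<in>affine_weyl_group \<Delta>. \<forall>m.
        mact M (u \<circ> w) m = mact M u (mact M w m))"

definition weyl_module_hom ::
    "'v::euclidean_space root_data \<Rightarrow> ('v, 'm::ab_group_add) weyl_rep \<Rightarrow>
     ('v, 'n::ab_group_add) weyl_rep \<Rightarrow> ('m \<Rightarrow> 'n) \<Rightarrow> bool" where
  "weyl_module_hom \<Delta> M N \<phi> \<longleftrightarrow>
     Vector_Spaces.linear (mscale M) (mscale N) \<phi> \<and>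
     (\<forall>w\<in>affine_weyl_group \<Delta>. \<forall>m. \<phi> (mact M w m) = mact N w (\<phi> m))"


section \<open>Function spaces\<close>

text \<open>
  Local expansion into a power series in the coordinates with respect to \<open>Basis\<close>; the multi-indices
  are the functions \<open>n\<close> to the naturals supported on \<open>Basis\<close>.
\<close>

definition real_analytic :: "('v::euclidean_space \<Rightarrow> complex) \<Rightarrow> bool" where
  "real_analytic g \<longleftrightarrow>
     (\<forall>x. \<exists>c r. 0 < r \<and>
        (\<forall>y\<in>ball x r.
           ((\<lambda>n. c n * complex_of_real (\<Prod>b\<in>Basis. ((y - x) \<bullet> b) ^ n b)) has_sum g y)
             {n :: 'v \<Rightarrow> nat. \<forall>b. b \<notin> Basis \<longrightarrow> n b = 0}))"

text \<open>
  The element \<open>\<Sum>i. g i \<otimes> m i\<close> of the algebraic tensor product of the analytic functions with \<open>M\<close> is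
  identified with the function \<open>x \<mapsto> \<Sum>i. g i x \<cdot> m i\<close>.
\<close>

definition tensor_sum ::
    "('v, 'm::ab_group_add) weyl_rep \<Rightarrow> nat \<Rightarrow> (nat \<Rightarrow> 'v \<Rightarrow> complex) \<Rightarrow> (nat \<Rightarrow> 'm) \<Rightarrow> 'v \<Rightarrow> 'm" where
  "tensor_sum M N g m x = (\<Sum>i<N. mscale M (g i x) (m i))"

definition analytic_tensor ::
    "('v::euclidean_space, 'm::ab_group_add) weyl_rep \<Rightarrow> ('v \<Rightarrow> 'm) set" where
  "analytic_tensor M = {tensor_sum M N g m | N g m. \<forall>i<N. real_analytic (g i)}"

text \<open>\<open>L \<otimes> \<phi>\<close> for linear \<open>L\<close> on analytic functions and linear \<open>\<phi>\<close> from \<open>M\<close> to \<open>M'\<close>.\<close>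

definition tensor_map ::
    "('v::euclidean_space, 'm::ab_group_add) weyl_rep \<Rightarrow> ('v, 'n::ab_group_add) weyl_rep \<Rightarrow>
     (('v \<Rightarrow> complex) \<Rightarrow> 'v \<Rightarrow> complex) \<Rightarrow> ('m \<Rightarrow> 'n) \<Rightarrow> ('v \<Rightarrow> 'm) \<Rightarrow> 'v \<Rightarrow> 'n" where
  "tensor_map M M' L \<phi> f =
     (THE h. \<exists>N g m. (\<forall>i<N. real_analytic (g i)) \<and> f = tensor_sum M N g m \<and>
        h = tensor_sum M' N (\<lambda>i. L (g i)) (\<lambda>i. \<phi> (m i)))"

definition fscale :: "('v, 'm) weyl_rep \<Rightarrow> complex \<Rightarrow> ('v \<Rightarrow> 'm) \<Rightarrow> 'v \<Rightarrow> 'm" where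
  "fscale M c f x = mscale M c (f x)"

definition fundamental_chamber :: "'v::euclidean_space root_data \<Rightarrow> 'v set" where
  "fundamental_chamber \<Delta> = {v. \<forall>a\<in>simple_affine_roots \<Delta>. a v > 0}"

definition regular_set :: "'v::euclidean_space root_data \<Rightarrow> 'v set" where
  "regular_set \<Delta> = UNIV - (\<Union>a\<in>pos_affine_roots \<Delta>. {v. a v = 0})"

text \<open>A function on the regular set is represented by its extension by \<open>0\<close>.\<close>

definition chamberwise_analytic ::
    "'v::euclidean_space root_data \<Rightarrow> ('v, 'm::ab_group_add) weyl_rep \<Rightarrow> ('v \<Rightarrow> 'm) set" where
  "chamberwise_analytic \<Delta> M =
     {f. (\<forall>x. x \<notin> regular_set \<Delta> \<longrightarrow> f x = 0) \<and>
         (\<forall>C\<in>components (regular_set \<Delta>). \<exists>h\<in>analytic_tensor M. \<forall>x\<in>C. f x = h x)}"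

text \<open>The function \<open>f\<^sub>C\<close>.\<close>

definition chamber_ext ::
    "('v::euclidean_space, 'm::ab_group_add) weyl_rep \<Rightarrow> 'v set \<Rightarrow> ('v \<Rightarrow> 'm) \<Rightarrow> 'v \<Rightarrow> 'm" where
  "chamber_ext M C f = (THE h. h \<in> analytic_tensor M \<and> (\<forall>x\<in>C. f x = h x))"

definition dot_act :: "('v, 'm) weyl_rep \<Rightarrow> ('v \<Rightarrow> 'v) \<Rightarrow> ('v \<Rightarrow> 'm) \<Rightarrow> 'v \<Rightarrow> 'm" where
  "dot_act M w f v = mact M w (f (inv w v))"

definition dir_deriv :: "'v::euclidean_space \<Rightarrow> ('v \<Rightarrow> complex) \<Rightarrow> 'v \<Rightarrow> complex" where
  "dir_deriv v g x = vector_derivative (\<lambda>t::real. g (x + t *\<^sub>R v)) (at 0)"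


section \<open>The two functors\<close>

definition neg_indicator :: "('v \<Rightarrow> real) \<Rightarrow> 'v \<Rightarrow> complex" where
  "neg_indicator a x = (if a x < 0 then 1 else 0)"

text \<open>
  At a given point only finitely many positive affine roots are negative; the sum is restricted to
  these, since the sum over an infinite index set is \<open>0\<close> by convention.
\<close>

definition dunkl_op ::
    "'v::euclidean_space root_data \<Rightarrow> (('v \<Rightarrow> real) \<Rightarrow> complex) \<Rightarrow>
     ('v, 'm::ab_group_add) weyl_rep \<Rightarrow> 'v \<Rightarrow> ('v \<Rightarrow> 'm) \<Rightarrow> 'v \<Rightarrow> 'm" where
  "dunkl_op \<Delta> k M v f x =
     (if x \<in> regular_set \<Delta> then
        tensor_map M M (dir_deriv v) id
          (chamber_ext M (connected_component_set (regular_set \<Delta>) x) f) x -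
        (\<Sum>a\<in>{a \<in> pos_affine_roots \<Delta>. neg_indicator a x \<noteq> 0}.
           mscale M (k a * complex_of_real (blinfun_apply (grad a) v) * neg_indicator a x)
             (dot_act M (affine_refl a) f x))
      else 0)"

text \<open>\<open>\<rho>\<close> is the action of \<open>A\<close> on the space of chamberwise analytic functions that is determined
  by the Dunkl type operators and the dot action.\<close>

definition dr_module ::
    "'v::euclidean_space root_data \<Rightarrow> (('v \<Rightarrow> real) \<Rightarrow> complex) \<Rightarrow>
     ('v, 'a::ab_group_add) alg_data \<Rightarrow> ('v, 'm::ab_group_add) weyl_rep \<Rightarrow>
     ('a \<Rightarrow> ('v \<Rightarrow> 'm) \<Rightarrow> 'v \<Rightarrow> 'm) \<Rightarrow> bool" where
  "dr_module \<Delta> k A M \<rho> \<longleftrightarrow>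
     alg_module A (fscale M) (chamberwise_analytic \<Delta> M) \<rho> \<and>
     (\<forall>f\<in>chamberwise_analytic \<Delta> M.
        (\<forall>w\<in>affine_weyl_group \<Delta>. \<rho> (of_grp A (group_elem w)) f = dot_act M w f) \<and>
        (\<forall>v. \<rho> (of_sym A (sym_vec (v, 0))) f = dunkl_op \<Delta> k M v f))"

definition dr_map :: "('m \<Rightarrow> 'n) \<Rightarrow> ('v \<Rightarrow> 'm) \<Rightarrow> 'v \<Rightarrow> 'n" where
  "dr_map \<phi> f = \<phi> \<circ> f"

text \<open>The interval integral is oriented: \<open>a v\<close> may be negative.\<close>

definition integral_op ::
    "('v::euclidean_space \<Rightarrow> real) \<Rightarrow> ('v \<Rightarrow> complex) \<Rightarrow> 'v \<Rightarrow> complex" where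
  "integral_op a g v =
     interval_lebesgue_integral lborel (ereal 0) (ereal (a v))
       (\<lambda>t. g (v - t *\<^sub>R coroot (grad a)))"

text \<open>\<open>\<rho>\<close> is the action of \<open>A\<close> on the tensor product of the analytic functions with \<open>M\<close> that is
  determined by the directional derivatives and the integral-reflection operators.\<close>

definition ir_module ::
    "'v::euclidean_space root_data \<Rightarrow> (('v \<Rightarrow> real) \<Rightarrow> complex) \<Rightarrow>
     ('v, 'a::ab_group_add) alg_data \<Rightarrow> ('v, 'm::ab_group_add) weyl_rep \<Rightarrow>
     ('a \<Rightarrow> ('v \<Rightarrow> 'm) \<Rightarrow> 'v \<Rightarrow> 'm) \<Rightarrow> bool" where
  "ir_module \<Delta> k A M \<rho> \<longleftrightarrow>
     alg_module A (fscale M) (analytic_tensor M) \<rho> \<and>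
     (\<forall>f\<in>analytic_tensor M.
        (\<forall>v. \<rho> (of_sym A (sym_vec (v, 0))) f = tensor_map M M (dir_deriv v) id f) \<and>
        (\<forall>a\<in>simple_affine_roots \<Delta>.
           \<rho> (of_grp A (group_elem (affine_refl a))) f =
           tensor_map M M (fun_act (affine_refl a)) (mact M (affine_refl a)) f -
           fscale M (k a) (tensor_map M M (integral_op a) id f)) \<and>
        (\<forall>\<omega>\<in>length_zero \<Delta>.
           \<rho> (of_grp A (group_elem \<omega>)) f = tensor_map M M (fun_act \<omega>) (mact M \<omega>) f))"

definition ir_map ::
    "('v::euclidean_space, 'm::ab_group_add) weyl_rep \<Rightarrow> ('v, 'n::ab_group_add) weyl_rep \<Rightarrow>
     ('m \<Rightarrow> 'n) \<Rightarrow> ('v \<Rightarrow> 'm) \<Rightarrow> 'v \<Rightarrow> 'n" where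
  "ir_map M M' \<phi> = tensor_map M M' id \<phi>"


section \<open>The propagation transformation\<close>

text \<open>
  \<open>\<rho>\<close> is the action on the domain. The last clause only normalizes the value outside the domain,
  which makes the map unique as a function on the whole type.
\<close>

definition is_propagation ::
    "'v::euclidean_space root_data \<Rightarrow> ('v, 'a::ab_group_add) alg_data \<Rightarrow>
     ('v, 'm::ab_group_add) weyl_rep \<Rightarrow> ('a \<Rightarrow> ('v \<Rightarrow> 'm) \<Rightarrow> 'v \<Rightarrow> 'm) \<Rightarrow>
     (('v \<Rightarrow> 'm) \<Rightarrow> 'v \<Rightarrow> 'm) \<Rightarrow> bool" where
  "is_propagation \<Delta> A M \<rho> T \<longleftrightarrow>
     linear_between (fscale M) (analytic_tensor M) (fscale M) (chamberwise_analytic \<Delta> M) T \<and>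
     (\<forall>f\<in>analytic_tensor M. chamber_ext M (fundamental_chamber \<Delta>) (T f) = f) \<and>
     (\<forall>f\<in>analytic_tensor M. \<forall>w\<in>affine_weyl_group \<Delta>.
        T (\<rho> (of_grp A (group_elem w)) f) = dot_act M w (T f)) \<and>
     (\<forall>f. f \<notin> analytic_tensor M \<longrightarrow> T f = 0)"

definition propagation ::
    "'v::euclidean_space root_data \<Rightarrow> ('v, 'a::ab_group_add) alg_data \<Rightarrow>
     ('v, 'm::ab_group_add) weyl_rep \<Rightarrow> ('a \<Rightarrow> ('v \<Rightarrow> 'm) \<Rightarrow> 'v \<Rightarrow> 'm) \<Rightarrow>
     ('v \<Rightarrow> 'm) \<Rightarrow> 'v \<Rightarrow> 'm" where
  "propagation \<Delta> A M \<rho> = (THE T. is_propagation \<Delta> A M \<rho> T)"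

end

theory Submission
  imports Defs "HOL-Complex_Analysis.Cauchy_Integral_Formula"
begin

text \<open>
  The propagation map is forced by its values on the fundamental chamber: at \<open>x\<close> in \<open>w\<inverse>C\<^sub>+\<close> the
  propagated function is \<open>w\<inverse>(Q(w)f)(w x)\<close>, which is well defined because elements preserving \<open>C\<^sub>+\<close>
  have length zero and act diagonally.  To see that the map intertwines a vector \<open>v\<close>, let \<open>E\<^sub>v f\<close> be
  the difference of the two sides.  No positive affine root is negative on \<open>C\<^sub>+\<close>, so the Dunkl
  operators are plain derivatives there and \<open>E\<^sub>v f\<close> vanishes on \<open>C\<^sub>+\<close>.  For simple \<open>a\<close> put
  \<open>u = s\<^sub>a(v)\<close>, with \<open>s\<^sub>a\<close> replaced by its linear part; the cross relation of the algebra gives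
  \<open>s\<^sub>a \<cdot> E\<^sub>v f = E\<^sub>u (Q(s\<^sub>a) f)\<close>, because its remaining term is a scalar, and every regular point
  reaches \<open>C\<^sub>+\<close> by simple reflections.
\<close>


section \<open>Real analytic functions\<close>

text \<open>The operators \<open>tensor_map\<close>, the extensions \<open>chamber_ext\<close> and
  the map \<open>propagation\<close> are definite descriptions, so nothing can be computed before
  uniqueness is known. For \<open>tensor_map\<close> it comes from expanding the module vectors in a
  finite independent set, for \<open>chamber_ext\<close> from the identity theorem applied to the
  resulting scalar coefficients. That the integral operators keep functions analytic is read off
  from the hypothesis that \<open>Q\<close> is an action, not derived from the integrals. The
  descent to \<open>C_+\<close> is measured by the number of positive affine roots negative at the
  point. A simple reflection in a root negative there lowers it, because the reflection permutes the
  other positive affine roots; this is seen at a point of the wall where all the others are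
  positive. The same descent shows that simple reflections and length-zero elements generate the
  group. Hence the values of \<open>Q\<close> on these elements, the only group elements where it is
  given explicitly, suffice for comparing two modules.\<close>

lemma finite_multi_indices_degree:
  "finite {n :: 'v::euclidean_space \<Rightarrow> nat. (\<forall>b. b \<notin> Basis \<longrightarrow> n b = 0) \<and> (\<Sum>b\<in>Basis. n b) = j}"
proof (rule finite_subset)
  show "{n :: 'v \<Rightarrow> nat. (\<forall>b. b \<notin> Basis \<longrightarrow> n b = 0) \<and> (\<Sum>b\<in>Basis. n b) = j}
      \<subseteq> {n. (\<forall>b\<in>Basis. n b \<in> {..j}) \<and> (\<forall>b. b \<notin> Basis \<longrightarrow> n b = 0)}"
    by (auto intro!: member_le_sum)
  show "finite {n :: 'v \<Rightarrow> nat. (\<forall>b\<in>Basis. n b \<in> {..j}) \<and> (\<forall>b. b \<notin> Basis \<longrightarrow> n b = 0)}"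
    using finite_set_of_finite_funs[of "Basis :: 'v set" "{..j}" 0]
    by (rule rev_finite_subset) auto
qed

text \<open>The coefficient of \<open>s ^ j\<close> collects the multi-indices of total degree \<open>j\<close>.\<close>

lemma real_analytic_on_line:
  assumes "real_analytic g"
  shows "\<exists>r>0. \<exists>e. \<forall>s. \<bar>s\<bar> < r \<longrightarrow> (\<lambda>j. e j * complex_of_real s ^ j) sums g (x + s *\<^sub>R d)"
proof -
  obtain c r where r: "0 < r" and g: "\<forall>y\<in>ball x r.
      ((\<lambda>n. c n * complex_of_real (\<Prod>b\<in>Basis. ((y - x) \<bullet> b) ^ n b)) has_sum g y)
        {n. \<forall>b. b \<notin> Basis \<longrightarrow> n b = 0}"
    using assms[unfolded real_analytic_def, rule_format, of x] by auto
  define deg where "deg n = (\<Sum>b\<in>Basis. n b)" for n :: "'a \<Rightarrow> nat"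
  define fib where "fib j = {n :: 'a \<Rightarrow> nat. (\<forall>b. b \<notin> Basis \<longrightarrow> n b = 0) \<and> deg n = j}" for j
  define e where "e j = (\<Sum>n\<in>fib j. c n * complex_of_real (\<Prod>b\<in>Basis. (d \<bullet> b) ^ n b))" for j
  have fin: "finite (fib j)" for j
    unfolding fib_def deg_def by (rule finite_multi_indices_degree)
  \<comment> \<open>The summand 1 in the radius keeps it positive and meaningful when
    \<open>d = 0\<close>.\<close>
  have "(\<lambda>j. e j * complex_of_real s ^ j) sums g (x + s *\<^sub>R d)"
    if s: "\<bar>s\<bar> < r / (norm d + 1)" for s :: real
  proof -
    have "\<bar>s\<bar> * norm d \<le> \<bar>s\<bar> * (norm d + 1)"
      by (simp add: mult_left_mono)
    also have "\<dots> < r"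
      using s by (simp add: pos_less_divide_eq add_nonneg_pos)
    finally have "x + s *\<^sub>R d \<in> ball x r"
      by (simp add: dist_norm)
    from g[rule_format, OF this] have *: "((\<lambda>n. c n * complex_of_real (\<Prod>b\<in>Basis. (s * (d \<bullet> b)) ^ n b))
        has_sum g (x + s *\<^sub>R d)) {n. \<forall>b. b \<notin> Basis \<longrightarrow> n b = 0}"
      by simp
    have pow: "(\<Prod>b\<in>Basis. (s * (d \<bullet> b)) ^ n b) = s ^ deg n * (\<Prod>b\<in>Basis. (d \<bullet> b) ^ n b)" for n
      by (simp add: power_mult_distrib prod.distrib deg_def power_sum)
    \<comment> \<open>The multi-indices are the disjoint union of the finite degree fibres.
      Reindexing by pairs (degree, multi-index) turns the unordered sum into an iterated one, with
      finite inner sums.\<close>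
    have inj: "inj_on snd (Sigma UNIV fib)"
      by (auto simp: inj_on_def fib_def)
    have im: "snd ` Sigma UNIV fib = {n. \<forall>b. b \<notin> Basis \<longrightarrow> n b = 0}"
      by (force simp: fib_def)
    have "((\<lambda>p. c (snd p) * complex_of_real (\<Prod>b\<in>Basis. (s * (d \<bullet> b)) ^ snd p b))
        has_sum g (x + s *\<^sub>R d)) (Sigma UNIV fib)"
      using * unfolding im[symmetric] has_sum_reindex[OF inj] by (simp add: o_def)
    moreover have "((\<lambda>n. c (snd (j, n)) * complex_of_real (\<Prod>b\<in>Basis. (s * (d \<bullet> b)) ^ snd (j, n) b))
        has_sum (e j * complex_of_real s ^ j)) (fib j)" for j
      by (rule has_sum_finiteI[OF fin])
        (auto simp: e_def sum_distrib_right pow fib_def intro!: sum.cong)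
    ultimately have "((\<lambda>j. e j * complex_of_real s ^ j) has_sum g (x + s *\<^sub>R d)) UNIV"
      by (rule has_sum_Sigma')
    then show ?thesis
      by (rule has_sum_imp_sums)
  qed
  moreover have "0 < r / (norm d + 1)"
    using r by (simp add: add_nonneg_pos)
  ultimately show ?thesis
    by blast
qed

text \<open>The series on the line has complex coefficients. Letting its variable be complex as well
  gives an honest power series function \<open>F\<close>, to which termwise differentiation and the
  isolation of zeros apply.\<close>

lemma real_analytic_line_extension:
  assumes "real_analytic g"
  shows "\<exists>r>0. \<exists>e F. (\<forall>z::complex. norm z < r \<longrightarrow> (\<lambda>j. e j * z ^ j) sums F z) \<and>
    (\<forall>s. \<bar>s\<bar> < r \<longrightarrow> F (complex_of_real s) = g (x + s *\<^sub>R d))"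
proof -
  obtain r e where r: "0 < r"
    and e: "\<And>s::real. \<bar>s\<bar> < r \<Longrightarrow> (\<lambda>j. e j * complex_of_real s ^ j) sums g (x + s *\<^sub>R d)"
    using real_analytic_on_line[OF assms, of x d] by auto
  define F where "F z = (suminf (\<lambda>j. e j * z ^ j))" for z :: complex
  have "(\<lambda>j. e j * z ^ j) sums F z" if "norm z < r" for z
  proof -
    \<comment> \<open>Convergence is known at real points only; a real point of larger modulus gives
      convergence at \<open>z\<close>.\<close>
    obtain s where s: "norm z < s" "s < r"
      using \<open>norm z < r\<close> dense by blast
    then have "summable (\<lambda>j. e j * complex_of_real s ^ j)"
      using e[of s] norm_ge_zero[of z] by (intro sums_summable) auto
    then have "summable (\<lambda>j. e j * z ^ j)"
      by (rule powser_inside) (use s norm_ge_zero[of z] in auto)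
    then show ?thesis
      by (simp add: F_def summable_sums)
  qed
  moreover have "F (complex_of_real s) = g (x + s *\<^sub>R d)" if "\<bar>s\<bar> < r" for s
    using sums_unique[OF e[OF that]] by (simp add: F_def)
  ultimately show ?thesis
    using r by (intro exI[of _ r] exI[of _ e] exI[of _ F]) auto
qed

text \<open>The expansion is recentred at the parameter \<open>t\<close>, so that only the
  derivative of a power series at its centre is needed.\<close>

lemma real_analytic_differentiable_line:
  assumes "real_analytic g"
  shows "(\<lambda>t::real. g (x + t *\<^sub>R d)) differentiable (at t)"
proof -
  obtain r e F where r: "0 < r" and F: "\<And>z::complex. norm z < r \<Longrightarrow> (\<lambda>j. e j * z ^ j) sums F z"
    and Fg: "\<And>s::real. \<bar>s\<bar> < r \<Longrightarrow> F (complex_of_real s) = g ((x + t *\<^sub>R d) + s *\<^sub>R d)"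
    using real_analytic_line_extension[OF assms, of "x + t *\<^sub>R d" d] by auto
  have "((\<lambda>z. suminf (\<lambda>j. e j * z ^ j)) has_field_derivative (suminf (\<lambda>j. diffs e j * 0 ^ j))) (at 0)"
    by (rule termdiffs_strong'[of r]) (use F r in \<open>auto simp: sums_iff\<close>)
  moreover have ev: "\<forall>\<^sub>F z in nhds (0::complex). F z = (suminf (\<lambda>j. e j * z ^ j))"
    unfolding eventually_nhds_metric using F r by (auto simp: dist_norm sums_iff intro!: exI[of _ r])
  ultimately have "(F has_field_derivative suminf (\<lambda>j. diffs e j * 0 ^ j)) (at 0)"
    by (simp add: DERIV_cong_ev[OF refl ev refl])
  then obtain D where "(F has_field_derivative D) (at 0)" ..
  then have D: "(F has_field_derivative D) (at (complex_of_real ((\<lambda>u. u - t) t)))"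
    by simp
  have "((\<lambda>u. F (complex_of_real (u - t))) has_vector_derivative D) (at t)"
  proof -
    have "((\<lambda>u. complex_of_real (u - t)) has_vector_derivative of_real 1) (at t)"
      by (rule has_vector_derivative_of_real) (auto intro!: derivative_eq_intros)
    from field_vector_diff_chain_at[OF this, of F D] D
    show ?thesis by (simp add: o_def)
  qed
  then have "((\<lambda>u. g (x + u *\<^sub>R d)) has_vector_derivative D) (at t)"
  proof (rule has_vector_derivative_transform_within_open[where S = "ball t r"])
    fix u assume "u \<in> ball t r"
    then show "F (complex_of_real (u - t)) = g (x + u *\<^sub>R d)"
      using Fg[of "u - t"] by (simp add: dist_real_def abs_minus_commute algebra_simps)
  qed (use r in auto)
  then show ?thesis
    by (rule differentiableI_vector)
qed

lemma real_analytic_isCont_line: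
  "real_analytic g \<Longrightarrow> isCont (\<lambda>t::real. g (x + t *\<^sub>R d)) t"
  using real_analytic_differentiable_line differentiable_imp_continuous_within by blast

lemma real_analytic_add:
  assumes "real_analytic f" "real_analytic g"
  shows "real_analytic (\<lambda>x. f x + g x)"
  unfolding real_analytic_def
proof
  fix x
  obtain c r where cr: "0 < r" "\<forall>y\<in>ball x r.
      ((\<lambda>n. c n * complex_of_real (\<Prod>b\<in>Basis. ((y - x) \<bullet> b) ^ n b)) has_sum f y)
        {n. \<forall>b. b \<notin> Basis \<longrightarrow> n b = 0}"
    using assms(1)[unfolded real_analytic_def, rule_format, of x] by auto
  obtain c' r' where cr': "0 < r'" "\<forall>y\<in>ball x r'.
      ((\<lambda>n. c' n * complex_of_real (\<Prod>b\<in>Basis. ((y - x) \<bullet> b) ^ n b)) has_sum g y)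
        {n. \<forall>b. b \<notin> Basis \<longrightarrow> n b = 0}"
    using assms(2)[unfolded real_analytic_def, rule_format, of x] by auto
  show "\<exists>c r. 0 < r \<and> (\<forall>y\<in>ball x r.
      ((\<lambda>n. c n * complex_of_real (\<Prod>b\<in>Basis. ((y - x) \<bullet> b) ^ n b)) has_sum f y + g y)
        {n. \<forall>b. b \<notin> Basis \<longrightarrow> n b = 0})"
    using cr cr' by (intro exI[of _ "\<lambda>n. c n + c' n"] exI[of _ "min r r'"])
      (auto simp: distrib_right intro!: has_sum_add)
qed

lemma real_analytic_cmult:
  assumes "real_analytic f"
  shows "real_analytic (\<lambda>x. a * f x)"
  unfolding real_analytic_def
proof
  fix x
  obtain c r where cr: "0 < r" "\<forall>y\<in>ball x r.
      ((\<lambda>n. c n * complex_of_real (\<Prod>b\<in>Basis. ((y - x) \<bullet> b) ^ n b)) has_sum f y)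
        {n. \<forall>b. b \<notin> Basis \<longrightarrow> n b = 0}"
    using assms(1)[unfolded real_analytic_def, rule_format, of x] by auto
  show "\<exists>c r. 0 < r \<and> (\<forall>y\<in>ball x r.
      ((\<lambda>n. c n * complex_of_real (\<Prod>b\<in>Basis. ((y - x) \<bullet> b) ^ n b)) has_sum a * f y)
        {n. \<forall>b. b \<notin> Basis \<longrightarrow> n b = 0})"
    using cr by (intro exI[of _ "\<lambda>n. a * c n"] exI[of _ "r"])
      (auto simp: mult.assoc intro!: has_sum_cmult_right)
qed

lemma real_analytic_zero: "real_analytic (\<lambda>x. 0)"
  unfolding real_analytic_def by (intro allI exI[of _ "\<lambda>_. 0"] exI[of _ 1]) simp

lemma real_analytic_sum:
  "(\<And>i. i \<in> I \<Longrightarrow> real_analytic (g i)) \<Longrightarrow> real_analytic (\<lambda>x. \<Sum>i\<in>I. c i * g i x)"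
proof (induction I rule: infinite_finite_induct)
  case (insert i I)
  then have "real_analytic (\<lambda>x. c i * g i x + (\<Sum>i\<in>I. c i * g i x))"
    by (intro real_analytic_add real_analytic_cmult) auto
  with insert.hyps show ?case
    by simp
qed (simp_all add: real_analytic_zero)

text \<open>The identity theorem is reduced to dimension one: on a line through a point of \<open>U\<close>, the set of
  parameters near which the function vanishes is open and closed.\<close>

lemma real_analytic_eq_zero:
  assumes g: "real_analytic g" and U: "open U" "x \<in> U" and zero: "\<And>y. y \<in> U \<Longrightarrow> g y = 0"
  shows "g y = 0"
proof -
  define d where "d = y - x"
  define Z where "Z = {t::real. \<forall>\<^sub>F s in nhds t. g (x + s *\<^sub>R d) = 0}"
  have "open Z"
    unfolding open_dist
  proof
    fix t assume "t \<in> Z"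
    then obtain r where r: "r > 0" "\<And>s. dist s t < r \<Longrightarrow> g (x + s *\<^sub>R d) = 0"
      by (auto simp: Z_def eventually_nhds_metric)
    have "u \<in> Z" if "dist u t < r" for u
    proof -
      have "\<forall>\<^sub>F s in nhds u. s \<in> ball t r"
        using that by (intro eventually_nhds_in_open) (auto simp: dist_commute)
      then show ?thesis
        unfolding Z_def mem_Collect_eq by eventually_elim (use r in \<open>auto simp: dist_commute\<close>)
    qed
    then show "\<exists>e>0. \<forall>u. dist u t < e \<longrightarrow> u \<in> Z"
      using r by blast
  qed
  moreover have "closed Z"
    unfolding closed_limpt
  proof (intro allI impI)
    fix t assume t: "t islimpt Z"
    obtain r e F where r: "0 < r" and F: "\<And>z::complex. norm z < r \<Longrightarrow> (\<lambda>j. e j * z ^ j) sums F z"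
      and Fg: "\<And>s::real. \<bar>s\<bar> < r \<Longrightarrow> F (complex_of_real s) = g ((x + t *\<^sub>R d) + s *\<^sub>R d)"
      using real_analytic_line_extension[OF g, of "x + t *\<^sub>R d" d] by auto
    \<comment> \<open>A limit point of \<open>Z\<close> has zeros of the function arbitrarily near
      it and different from it; these become nonzero real zeros of \<open>F\<close> accumulating at
      0.\<close>
    have close: "\<exists>s. s \<noteq> 0 \<and> \<bar>s\<bar> < q \<and> F (complex_of_real s) = 0" if q: "0 < q" for q
    proof -
      obtain u where u: "u \<in> Z" "u \<noteq> t" "dist u t < min q r"
        using t q r unfolding islimpt_approachable by (meson min_less_iff_conj)
      then have "g (x + u *\<^sub>R d) = 0"
        by (auto simp: Z_def dest: eventually_nhds_x_imp_x)
      then show ?thesis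
        using u Fg[of "u - t"] by (intro exI[of _ "u - t"]) (auto simp: dist_real_def algebra_simps)
    qed
    have F0: "F 0 = 0"
    proof -
      have 1: "g (x + t *\<^sub>R d) = F 0"
        using Fg[of 0] r by simp
      have "closed ((\<lambda>s. g (x + s *\<^sub>R d)) -` {0})"
        by (intro continuous_closed_vimage) (auto intro: real_analytic_isCont_line[OF g])
      moreover have "Z \<subseteq> (\<lambda>s. g (x + s *\<^sub>R d)) -` {0}"
        by (auto simp: Z_def dest: eventually_nhds_x_imp_x)
      ultimately have "g (x + t *\<^sub>R d) = 0"
        using islimpt_subset[OF t] closed_limpt by (metis vimage_singleton_eq)
      then show ?thesis
        using 1 by simp
    qed
    have "e m = 0" for m
    proof (rule ccontr)
      assume em: "e m \<noteq> 0"
      \<comment> \<open>The isolation of zeros asks for a nonzero coefficient of positive index, so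
        the constant term is excluded beforehand.\<close>
      have "e 0 = 0"
        using F[of 0] r F0 by simp
      with em have m: "m > 0"
        by (metis gr0I)
      obtain s where s: "0 < s" "\<And>z. z \<in> cball 0 s - {0} \<Longrightarrow> F z \<noteq> 0"
        using powser_0_nonzero[OF r, of 0 e F m] F F0 m em by auto
      obtain u where "u \<noteq> 0" "\<bar>u\<bar> < s" "F (complex_of_real u) = 0"
        using close[OF s(1)] by blast
      then show False
        using s(2)[of "complex_of_real u"] by auto
    qed
    then have F_zero: "F z = 0" if "norm z < r" for z
      using F[OF that] by (simp add: sums_iff)
    have "g (x + s *\<^sub>R d) = 0" if "dist s t < r" for s
      using Fg[of "s - t"] F_zero[of "complex_of_real (s - t)"] that
      by (simp add: dist_real_def algebra_simps del: of_real_diff)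
    then show "t \<in> Z"
      using r by (auto simp: Z_def eventually_nhds_metric)
  qed
  moreover have "0 \<in> Z"
  proof -
    have "open ((\<lambda>s. x + s *\<^sub>R d) -` U)"
      by (intro continuous_open_vimage U) (auto intro!: continuous_intros)
    then have "\<forall>\<^sub>F s in nhds 0. s \<in> (\<lambda>s. x + s *\<^sub>R d) -` U"
      by (rule eventually_nhds_in_open) (use U in simp)
    then show ?thesis
      unfolding Z_def mem_Collect_eq by eventually_elim (use zero in auto)
  qed
  ultimately have "Z = UNIV"
    using clopen by blast
  then have "1 \<in> Z" by simp
  then have "g (x + 1 *\<^sub>R d) = 0"
    unfolding Z_def by (auto dest: eventually_nhds_x_imp_x)
  then show ?thesis
    by (simp add: d_def)
qed

text \<open>Linearity is asked only on analytic functions, where derivatives and integrals exist.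
  The values of \<open>L\<close> need not be analytic: comparing two tensor representations uses
  their pointwise values alone.\<close>

definition analytic_linear :: "(('v::euclidean_space \<Rightarrow> complex) \<Rightarrow> 'v \<Rightarrow> complex) \<Rightarrow> bool" where
  "analytic_linear L \<longleftrightarrow>
     (\<forall>g h. real_analytic g \<longrightarrow> real_analytic h \<longrightarrow> L (\<lambda>x. g x + h x) = (\<lambda>x. L g x + L h x)) \<and>
     (\<forall>c g. real_analytic g \<longrightarrow> L (\<lambda>x. c * g x) = (\<lambda>x. c * L g x))"

lemma analytic_linear_sum:
  assumes L: "analytic_linear L" and g: "\<And>i. i \<in> I \<Longrightarrow> real_analytic (g i)"
  shows "L (\<lambda>x. \<Sum>i\<in>I. c i * g i x) = (\<lambda>x. \<Sum>i\<in>I. c i * L (g i) x)"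
  using g
proof (induction I rule: infinite_finite_induct)
  case (insert i I)
  have "L (\<lambda>x. c i * g i x + (\<Sum>j\<in>I. c j * g j x))
      = (\<lambda>x. L (\<lambda>x. c i * g i x) x + L (\<lambda>x. \<Sum>j\<in>I. c j * g j x) x)"
    using L insert.prems unfolding analytic_linear_def
    by (blast intro: real_analytic_cmult real_analytic_sum)
  moreover have "L (\<lambda>x. c i * g i x) = (\<lambda>x. c i * L (g i) x)"
    using L insert.prems unfolding analytic_linear_def by blast
  ultimately show ?case
    using insert by simp
next
  case (infinite I)
  \<comment> \<open>An infinite index set makes the sum 0, and \<open>L\<close> kills the zero
    function by homogeneity with scalar 0.\<close>
  have "L (\<lambda>x. 0 * 0) = (\<lambda>x. 0 * L (\<lambda>x. 0) x)"
    using L real_analytic_zero unfolding analytic_linear_def by blast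
  then show ?case
    using infinite by simp
next
  case empty
  have "L (\<lambda>x. 0 * 0) = (\<lambda>x. 0 * L (\<lambda>x. 0) x)"
    using L real_analytic_zero unfolding analytic_linear_def by blast
  then show ?case
    by simp
qed

section \<open>The operators on analytic functions that occur in the two functors\<close>

lemma analytic_linear_id: "analytic_linear id"
  by (simp add: analytic_linear_def)

lemma analytic_linear_fun_act: "analytic_linear (fun_act w)"
  by (simp add: analytic_linear_def fun_act_def fun_eq_iff)

lemma analytic_linear_dir_deriv: "analytic_linear (dir_deriv (v :: 'v::euclidean_space))"
proof -
  have *: "((\<lambda>t. g (x + t *\<^sub>R v)) has_vector_derivative dir_deriv v g x) (at 0)"
    if "real_analytic g" for g :: "'v \<Rightarrow> complex" and x
    using real_analytic_differentiable_line[OF that] vector_derivative_works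
    unfolding dir_deriv_def by blast
  show ?thesis
    unfolding analytic_linear_def fun_eq_iff
  proof (intro conjI allI impI)
    fix g h :: "'v \<Rightarrow> complex" and x assume "real_analytic g" "real_analytic h"
    then show "dir_deriv v (\<lambda>x. g x + h x) x = dir_deriv v g x + dir_deriv v h x"
      unfolding dir_deriv_def[of v "\<lambda>x. g x + h x"]
      by (intro vector_derivative_at has_vector_derivative_add *)
  next
    fix g :: "'v \<Rightarrow> complex" and c x assume "real_analytic g"
    then show "dir_deriv v (\<lambda>x. c * g x) x = c * dir_deriv v g x"
      unfolding dir_deriv_def[of v "\<lambda>x. c * g x"]
      by (intro vector_derivative_at has_vector_derivative_mult_right *)
  qed
qed

lemma analytic_linear_integral_op: "analytic_linear (integral_op (a :: 'v::euclidean_space \<Rightarrow> real))"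
proof -
  have *: "interval_lebesgue_integrable lborel (ereal 0) (ereal (a x))
      (\<lambda>t. g (x - t *\<^sub>R coroot (grad a)))" if "real_analytic g" for g :: "'v \<Rightarrow> complex" and x
  proof (rule interval_integrable_isCont)
    show "isCont (\<lambda>t. g (x - t *\<^sub>R coroot (grad a))) t" for t
      using real_analytic_isCont_line[OF that, where x = x and d = "- coroot (grad a)" and t = t] by simp
  qed
  show ?thesis
    unfolding analytic_linear_def fun_eq_iff
  proof (intro conjI allI impI)
    fix g h :: "'v \<Rightarrow> complex" and x assume "real_analytic g" "real_analytic h"
    then show "integral_op a (\<lambda>x. g x + h x) x = integral_op a g x + integral_op a h x"
      unfolding integral_op_def by (intro interval_lebesgue_integral_add * )
  next
    fix g :: "'v \<Rightarrow> complex" and c x assume "real_analytic g"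
    then show "integral_op a (\<lambda>x. c * g x) x = c * integral_op a g x"
      by (simp add: integral_op_def)
  qed
qed


section \<open>The tensor product of analytic functions with a module\<close>

context
  fixes M :: "('v::euclidean_space, 'm::ab_group_add) weyl_rep"
  assumes vs: "vector_space (mscale M)"
begin

interpretation vector_space "mscale M"
  by (rule vs)

text \<open>Moves all linear relations among the vectors of a tensor sum into scalar coefficients,
  after which a vanishing tensor sum means that each coefficient function vanishes.\<close>

lemma independent_coefficients:
  assumes "finite I"
  obtains B c where "finite B" "independent B" "\<And>i. i \<in> I \<Longrightarrow> m i = (\<Sum>b\<in>B. mscale M (c i b) b)"
proof -
  obtain B where B: "B \<subseteq> m ` I" "independent B" "m ` I \<subseteq> span B"
    using maximal_independent_subset by blast
  have fin: "finite B"
    using B(1) assms finite_surj by blast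
  have "\<exists>c. m i = (\<Sum>b\<in>B. mscale M (c b) b)" if "i \<in> I" for i
    using B(3) that by (auto simp: span_finite[OF fin] image_iff)
  then obtain c where "\<And>i. i \<in> I \<Longrightarrow> m i = (\<Sum>b\<in>B. mscale M (c i b) b)"
    by metis
  with fin B(2) show ?thesis
    using that by blast
qed

lemma sum_mscale_coefficients:
  assumes "\<And>i. i \<in> I \<Longrightarrow> m i = (\<Sum>b\<in>B. mscale M (c i b) b)"
  shows "(\<Sum>i\<in>I. mscale M (a i) (m i)) = (\<Sum>b\<in>B. mscale M (\<Sum>i\<in>I. c i b * a i) b)"
proof -
  have "(\<Sum>i\<in>I. mscale M (a i) (m i)) = (\<Sum>i\<in>I. \<Sum>b\<in>B. mscale M (c i b * a i) b)"
    by (intro sum.cong refl) (simp add: assms scale_sum_right mult.commute)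
  also have "\<dots> = (\<Sum>b\<in>B. \<Sum>i\<in>I. mscale M (c i b * a i) b)"
    by (rule sum.swap)
  finally show ?thesis
    by (simp add: scale_sum_left)
qed

lemma independent_sum_zero:
  assumes "finite B" "independent B" "(\<Sum>b\<in>B. mscale M (u b) b) = 0" "b \<in> B"
  shows "u b = 0"
  using assms independent_explicit_module by blast

text \<open>Two representations of one element of the tensor product are compared by expanding all
  vectors in a common independent set.\<close>

lemma tensor_sum_zero_transfer:
  assumes L: "analytic_linear L" and phi: "Vector_Spaces.linear (mscale M) (mscale M') \<phi>"
    and g: "\<And>i. i < N \<Longrightarrow> real_analytic (g i)"
    and zero: "\<And>x. tensor_sum M N g m x = 0"
  shows "tensor_sum M' N (\<lambda>i. L (g i)) (\<lambda>i. \<phi> (m i)) x = 0"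
proof -
  obtain B c where B: "finite B" "independent B"
    and c: "\<And>i. i \<in> {..<N} \<Longrightarrow> m i = (\<Sum>b\<in>B. mscale M (c i b) b)"
    using independent_coefficients[of "{..<N}" m] by blast
  interpret phi: Vector_Spaces.linear "mscale M" "mscale M'" \<phi>
    by (rule phi)
  have coeff: "(\<lambda>x. \<Sum>i<N. c i b * g i x) = (\<lambda>x. 0)" if "b \<in> B" for b
  proof
    fix x
    have "(\<Sum>b\<in>B. mscale M (\<Sum>i<N. c i b * g i x) b) = 0"
      using zero[of x] sum_mscale_coefficients[of "{..<N}" m c B "\<lambda>i. g i x", OF c] by (simp add: tensor_sum_def)
    from independent_sum_zero[OF B this that] show "(\<Sum>i<N. c i b * g i x) = 0" .
  qed
  have L0: "L (\<lambda>x. 0) = (\<lambda>x. 0)"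
    using analytic_linear_sum[OF L, of "{}" g "\<lambda>_. 0"] by simp
  have "(\<Sum>i<N. c i b * L (g i) x) = 0" if "b \<in> B" for b
    using analytic_linear_sum[OF L, of "{..<N}" g "\<lambda>i. c i b"] g coeff[OF that] L0
    by (simp add: fun_eq_iff)
  \<comment> \<open>The relation is transported inside \<open>M\<close>, where \<open>B\<close> is
    independent, and \<open>\<phi>\<close> is applied only afterwards; thus \<open>\<phi>\<close>
    may have a kernel.\<close>
  then have "\<phi> (\<Sum>i<N. mscale M (L (g i) x) (m i)) = 0"
    using sum_mscale_coefficients[of "{..<N}" m c B "\<lambda>i. L (g i) x", OF c] by simp
  then show ?thesis
    by (simp add: tensor_sum_def phi.sum phi.scale)
qed

text \<open>The two families are concatenated, with the sign placed on the vectors, so that equality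
  of two representations becomes the vanishing of a single one.\<close>

lemma tensor_sum_diff:
  "tensor_sum M N g m x - tensor_sum M K h n x =
    tensor_sum M (N + K) (\<lambda>i. if i < N then g i else h (i - N))
      (\<lambda>i. if i < N then m i else - n (i - N)) x"
proof -
  have split: "(\<Sum>i<N + K. F i) = (\<Sum>i<N. F i) + (\<Sum>j<K. F (N + j))" for F :: "nat \<Rightarrow> 'm"
    by (induction K) (simp_all add: add.assoc)
  show ?thesis
    by (simp add: tensor_sum_def split sum_negf)
qed

lemma tensor_sum_transfer:
  assumes "analytic_linear L" "Vector_Spaces.linear (mscale M) (mscale M') \<phi>"
    and "\<And>i. i < N \<Longrightarrow> real_analytic (g i)" "\<And>j. j < K \<Longrightarrow> real_analytic (h j)"
    and "tensor_sum M N g m = tensor_sum M K h n"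
  shows "tensor_sum M' N (\<lambda>i. L (g i)) (\<lambda>i. \<phi> (m i)) =
    tensor_sum M' K (\<lambda>i. L (h i)) (\<lambda>i. \<phi> (n i))"
proof
  fix x
  interpret phi: Vector_Spaces.linear "mscale M" "mscale M'" \<phi>
    by (rule assms)
  have split: "(\<Sum>i<N + K. F i) = (\<Sum>i<N. F i) + (\<Sum>j<K. F (N + j))" for F :: "nat \<Rightarrow> 'a"
    by (induction K) (simp_all add: add.assoc)
  have "tensor_sum M' (N + K) (\<lambda>i. L (if i < N then g i else h (i - N)))
      (\<lambda>i. \<phi> (if i < N then m i else - n (i - N))) x = 0"
  proof (rule tensor_sum_zero_transfer[OF assms(1,2)])
    show "tensor_sum M (N + K) (\<lambda>i. if i < N then g i else h (i - N))
      (\<lambda>i. if i < N then m i else - n (i - N)) y = 0" for y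
      using assms(5) by (simp flip: tensor_sum_diff)
  qed (use assms(3,4) in auto)
  then show "tensor_sum M' N (\<lambda>i. L (g i)) (\<lambda>i. \<phi> (m i)) x =
      tensor_sum M' K (\<lambda>i. L (h i)) (\<lambda>i. \<phi> (n i)) x"
    by (simp add: tensor_sum_def split phi.neg sum_negf)
qed

text \<open>\<open>tensor_map\<close> is a description ranging over all representations of its
  argument; \<open>tensor_sum_transfer\<close> makes the result independent of the representation,
  so any one of them computes it.\<close>

lemma tensor_map_tensor_sum:
  assumes "analytic_linear L" "Vector_Spaces.linear (mscale M) (mscale M') \<phi>"
    and "\<And>i. i < N \<Longrightarrow> real_analytic (g i)"
  shows "tensor_map M M' L \<phi> (tensor_sum M N g m) =
    tensor_sum M' N (\<lambda>i. L (g i)) (\<lambda>i. \<phi> (m i))"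
  unfolding tensor_map_def
proof (rule the_equality)
  show "\<exists>N' g' m'. (\<forall>i<N'. real_analytic (g' i)) \<and> tensor_sum M N g m = tensor_sum M N' g' m' \<and>
      tensor_sum M' N (\<lambda>i. L (g i)) (\<lambda>i. \<phi> (m i)) = tensor_sum M' N' (\<lambda>i. L (g' i)) (\<lambda>i. \<phi> (m' i))"
    using assms(3) by blast
next
  fix h
  assume "\<exists>N' g' m'. (\<forall>i<N'. real_analytic (g' i)) \<and> tensor_sum M N g m = tensor_sum M N' g' m' \<and>
      h = tensor_sum M' N' (\<lambda>i. L (g' i)) (\<lambda>i. \<phi> (m' i))"
  then obtain N' g' m' where "\<forall>i<N'. real_analytic (g' i)" "tensor_sum M N g m = tensor_sum M N' g' m'"
      "h = tensor_sum M' N' (\<lambda>i. L (g' i)) (\<lambda>i. \<phi> (m' i))"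
    by blast
  then show "h = tensor_sum M' N (\<lambda>i. L (g i)) (\<lambda>i. \<phi> (m i))"
    using tensor_sum_transfer[OF assms, where K = N' and h = g' and m = m and n = m'] by simp
qed

lemma tensor_sum_hom:
  assumes "Vector_Spaces.linear (mscale M) (mscale M') \<phi>"
  shows "\<phi> (tensor_sum M N g m x) = tensor_sum M' N g (\<lambda>i. \<phi> (m i)) x"
proof -
  interpret phi: Vector_Spaces.linear "mscale M" "mscale M'" \<phi>
    by (rule assms)
  show ?thesis
    by (simp add: tensor_sum_def phi.sum phi.scale)
qed

lemma analytic_tensorE:
  assumes "f \<in> analytic_tensor M"
  obtains N g m where "f = tensor_sum M N g m" "\<forall>i<N. real_analytic (g i)"
  using assms unfolding analytic_tensor_def by blast

lemma tensor_map_id_eq_comp: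
  assumes "Vector_Spaces.linear (mscale M) (mscale M') \<phi>" "f \<in> analytic_tensor M"
  shows "tensor_map M M' id \<phi> f = \<phi> \<circ> f"
proof -
  obtain N g m where f: "f = tensor_sum M N g m" "\<forall>i<N. real_analytic (g i)"
    by (rule analytic_tensorE[OF assms(2)])
  show ?thesis
    using tensor_map_tensor_sum[OF analytic_linear_id assms(1) f(2)[rule_format]]
    by (simp add: f(1) fun_eq_iff tensor_sum_hom[OF assms(1)])
qed

lemma tensor_map_fun_act_eq:
  assumes "Vector_Spaces.linear (mscale M) (mscale M') \<phi>" "f \<in> analytic_tensor M"
  shows "tensor_map M M' (fun_act w) \<phi> f = (\<lambda>x. \<phi> (f (inv w x)))"
proof -
  obtain N g m where f: "f = tensor_sum M N g m" "\<forall>i<N. real_analytic (g i)"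
    by (rule analytic_tensorE[OF assms(2)])
  show ?thesis
    using tensor_map_tensor_sum[OF analytic_linear_fun_act assms(1) f(2)[rule_format]]
    by (simp add: f(1) tensor_sum_hom[OF assms(1)] fun_eq_iff) (simp add: tensor_sum_def fun_act_def)
qed

lemma comp_mem_analytic_tensor:
  assumes "Vector_Spaces.linear (mscale M) (mscale M') \<phi>" "f \<in> analytic_tensor M"
  shows "\<phi> \<circ> f \<in> analytic_tensor M'"
proof -
  obtain N g m where f: "f = tensor_sum M N g m" "\<forall>i<N. real_analytic (g i)"
    by (rule analytic_tensorE[OF assms(2)])
  have "\<phi> \<circ> f = tensor_sum M' N g (\<lambda>i. \<phi> (m i))"
    by (simp add: f(1) fun_eq_iff tensor_sum_hom[OF assms(1)])
  then show ?thesis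
    using f(2) unfolding analytic_tensor_def by blast
qed

text \<open>The difference is expanded in an independent set, and the scalar identity theorem
  applies to each coefficient. This gives the uniqueness behind \<open>chamber_ext\<close>.\<close>

lemma analytic_tensor_eqI:
  assumes f: "f \<in> analytic_tensor M" and h: "h \<in> analytic_tensor M"
    and U: "open U" "U \<noteq> {}" and eq: "\<And>x. x \<in> U \<Longrightarrow> f x = h x"
  shows "f = h"
proof
  fix y
  obtain N g m where g: "f = tensor_sum M N g m" "\<forall>i<N. real_analytic (g i)"
    by (rule analytic_tensorE[OF f])
  obtain K g' m' where g': "h = tensor_sum M K g' m'" "\<forall>i<K. real_analytic (g' i)"
    by (rule analytic_tensorE[OF h])
  define G where "G i = (if i < N then g i else g' (i - N))" for i
  define m0 where "m0 i = (if i < N then m i else - m' (i - N))" for i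
  have diff: "f x - h x = tensor_sum M (N + K) G m0 x" for x
    unfolding g(1) g'(1) tensor_sum_diff G_def m0_def ..
  have G: "real_analytic (G i)" if "i < N + K" for i
    using that g(2) g'(2) by (simp add: G_def)
  obtain B c where B: "finite B" "independent B"
    and c: "\<And>i. i \<in> {..<N + K} \<Longrightarrow> m0 i = (\<Sum>b\<in>B. mscale M (c i b) b)"
    using independent_coefficients[of "{..<N + K}" m0] by blast
  obtain u where u: "u \<in> U"
    using U by blast
  have "(\<Sum>i<N + K. c i b * G i y) = 0" if "b \<in> B" for b
  proof (rule real_analytic_eq_zero[where g = "\<lambda>x. \<Sum>i<N + K. c i b * G i x", OF _ U(1) u])
    show "real_analytic (\<lambda>x. \<Sum>i<N + K. c i b * G i x)"
      by (intro real_analytic_sum G) simp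
    fix x assume "x \<in> U"
    then have "tensor_sum M (N + K) G m0 x = 0"
      using eq diff[of x] by simp
    then have "(\<Sum>b\<in>B. mscale M (\<Sum>i<N + K. c i b * G i x) b) = 0"
      using sum_mscale_coefficients[of "{..<N + K}" m0 c B "\<lambda>i. G i x", OF c]
      by (simp add: tensor_sum_def)
    from independent_sum_zero[OF B this that] show "(\<Sum>i<N + K. c i b * G i x) = 0" .
  qed
  then have "tensor_sum M (N + K) G m0 y = 0"
    using sum_mscale_coefficients[of "{..<N + K}" m0 c B "\<lambda>i. G i y", OF c]
    by (simp add: tensor_sum_def)
  then show "f y = h y"
    using diff[of y] by simp
qed

lemma chamber_ext_eqI:
  assumes "h \<in> analytic_tensor M" "open C" "C \<noteq> {}" "\<And>x. x \<in> C \<Longrightarrow> f x = h x"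
  shows "chamber_ext M C f = h"
  unfolding chamber_ext_def
proof (rule the_equality)
  show "h \<in> analytic_tensor M \<and> (\<forall>x\<in>C. f x = h x)"
    using assms by blast
  fix h' assume "h' \<in> analytic_tensor M \<and> (\<forall>x\<in>C. f x = h' x)"
  then show "h' = h"
    using assms by (intro analytic_tensor_eqI[where U = C]) auto
qed

end

text \<open>\<open>L\<close> touches only the coefficients and \<open>\<phi>\<close> only the
  vectors, so the two commute. It serves for directional derivatives and for the integral
  operators.\<close>

lemma tensor_map_hom_comp:
  assumes "analytic_linear L" and phi: "Vector_Spaces.linear (mscale M) (mscale M') \<phi>"
    and "f \<in> analytic_tensor M"
  shows "tensor_map M' M' L id (\<phi> \<circ> f) = \<phi> \<circ> tensor_map M M L id f"
proof -
  interpret phi: Vector_Spaces.linear "mscale M" "mscale M'" \<phi>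
    by (rule phi)
  obtain N g m where g: "f = tensor_sum M N g m" "\<forall>i<N. real_analytic (g i)"
    by (rule analytic_tensorE[OF phi.vs1.vector_space_axioms assms(3)])
  have 1: "\<phi> \<circ> f = tensor_sum M' N g (\<lambda>i. \<phi> (m i))"
    by (simp add: g(1) fun_eq_iff tensor_sum_hom[OF phi.vs1.vector_space_axioms phi])
  have 2: "tensor_map M M L id f = tensor_sum M N (\<lambda>i. L (g i)) m"
    using tensor_map_tensor_sum[OF phi.vs1.vector_space_axioms assms(1) phi.vs1.linear_id g(2)[rule_format]]
    by (simp add: g(1))
  have 3: "tensor_map M' M' L id (\<phi> \<circ> f) = tensor_sum M' N (\<lambda>i. L (g i)) (\<lambda>i. \<phi> (m i))"
    using tensor_map_tensor_sum[OF phi.vs2.vector_space_axioms assms(1) phi.vs2.linear_id g(2)[rule_format]]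
    by (simp add: 1)
  show ?thesis
    unfolding 2 3 by (simp add: fun_eq_iff tensor_sum_hom[OF phi.vs1.vector_space_axioms phi])
qed


section \<open>The affine Weyl group and its chambers\<close>

text \<open>Testing the defining property against the functionals "inner product with a basis
  vector" determines every coordinate of the vector.\<close>

lemma coroot_eq:
  "coroot \<xi> = (2 / dual_inner \<xi> \<xi>) *\<^sub>R (\<Sum>b\<in>Basis. blinfun_apply \<xi> b *\<^sub>R b)"
  unfolding coroot_def
proof (rule the_equality)
  show "\<forall>\<eta>. blinfun_apply \<eta> ((2 / dual_inner \<xi> \<xi>) *\<^sub>R (\<Sum>b\<in>Basis. blinfun_apply \<xi> b *\<^sub>R b)) =
      2 * dual_inner \<eta> \<xi> / dual_inner \<xi> \<xi>"
    by (simp add: blinfun.scaleR_right blinfun.sum_right dual_inner_def mult.commute)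
next
  fix v assume v: "\<forall>\<eta>. blinfun_apply \<eta> v = 2 * dual_inner \<eta> \<xi> / dual_inner \<xi> \<xi>"
  show "v = (2 / dual_inner \<xi> \<xi>) *\<^sub>R (\<Sum>b\<in>Basis. blinfun_apply \<xi> b *\<^sub>R b)"
  proof (rule euclidean_eqI)
    fix c :: 'a assume c: "c \<in> Basis"
    have "blinfun_apply \<xi> (\<Sum>b\<in>Basis. (c \<bullet> b) *\<^sub>R b) = dual_inner (blinfun_inner_right c) \<xi>"
      by (simp add: dual_inner_def blinfun.sum_right blinfun.scaleR_right)
    then have "dual_inner (blinfun_inner_right c) \<xi> = blinfun_apply \<xi> c"
      by (simp add: euclidean_representation)
    moreover have "v \<bullet> c = blinfun_apply (blinfun_inner_right c) v"
      by (simp add: inner_commute)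
    ultimately show "v \<bullet> c = (2 / dual_inner \<xi> \<xi>) *\<^sub>R (\<Sum>b\<in>Basis. blinfun_apply \<xi> b *\<^sub>R b) \<bullet> c"
      using c v[rule_format, of "blinfun_inner_right c"] by (simp add: inner_sum_left_Basis)
  qed
qed

lemma dual_inner_self_nonzero: "\<xi> \<noteq> 0 \<Longrightarrow> dual_inner \<xi> \<xi> \<noteq> 0"
  by (auto simp: dual_inner_def sum_nonneg_eq_0_iff intro: blinfun_euclidean_eqI)

lemma apply_coroot_self: "\<xi> \<noteq> 0 \<Longrightarrow> blinfun_apply \<xi> (coroot \<xi>) = 2"
  using dual_inner_self_nonzero[of \<xi>]
  by (simp add: coroot_eq blinfun.scaleR_right blinfun.sum_right dual_inner_def)

lemma linear_refl: "linear (refl \<alpha>)"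
  by (rule linearI) (simp_all add: refl_def blinfun.add_right blinfun.scaleR_right algebra_simps)

lemma refl_refl: "\<alpha> \<noteq> 0 \<Longrightarrow> refl \<alpha> (refl \<alpha> v) = v"
  by (simp add: refl_def blinfun.diff_right blinfun.scaleR_right apply_coroot_self)

lemma apply_refl: "blinfun_apply \<beta> (refl \<alpha> v) = blinfun_apply (dual_refl \<alpha> \<beta>) v"
  by (simp add: refl_def dual_refl_def blinfun.diff_right blinfun.diff_left blinfun.scaleR_right
      blinfun.scaleR_left)

lemma grad_affine_fun [simp]: "grad (affine_fun \<alpha> c) = \<alpha>"
  unfolding grad_def
proof (rule the_equality)
  fix \<beta> assume "\<exists>d. affine_fun \<alpha> c = affine_fun \<beta> d"
  then obtain d where d: "\<And>v. blinfun_apply \<alpha> v + c = blinfun_apply \<beta> v + d"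
    by (auto simp: affine_fun_def fun_eq_iff)
  from d[of 0] have "c = d" by simp
  with d show "\<beta> = \<alpha>"
    by (intro blinfun_eqI) simp
qed blast

lemma int_span_superset:
  assumes "finite S" shows "S \<subseteq> int_span S"
proof
  fix x assume "x \<in> S"
  then have "x = (\<Sum>y\<in>S. real_of_int (if y = x then 1 else 0) *\<^sub>R y)"
    using assms by (simp add: if_distrib[of "\<lambda>c. real_of_int c *\<^sub>R _"] cong: if_cong)
  then show "x \<in> int_span S"
    unfolding int_span_def by (intro CollectI exI conjI TrueI)
qed

lemma nat_span_superset:
  assumes "finite S" shows "S \<subseteq> nat_span S"
proof
  fix x assume "x \<in> S"
  then have "x = (\<Sum>y\<in>S. real (if y = x then 1 else 0) *\<^sub>R y)"
    using assms by (simp add: if_distrib[of "\<lambda>c. real c *\<^sub>R _"] cong: if_cong)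
  then show "x \<in> nat_span S"
    unfolding nat_span_def by (intro CollectI exI conjI TrueI)
qed

lemma nat_span_apply_nonneg:
  fixes \<alpha> :: "'v::euclidean_space dual"
  assumes "\<alpha> \<in> nat_span F" "\<And>\<beta>. \<beta> \<in> F \<Longrightarrow> 0 \<le> blinfun_apply \<beta> v"
  shows "0 \<le> blinfun_apply \<alpha> v"
proof -
  obtain c where "\<alpha> = (\<Sum>x\<in>F. real (c x) *\<^sub>R x)"
    using assms(1) by (auto simp: nat_span_def)
  then show ?thesis
    using assms(2) by (simp add: blinfun.sum_left blinfun.scaleR_left sum_nonneg)
qed

lemma nat_span_apply_pos:
  fixes \<alpha> :: "'v::euclidean_space dual"
  assumes "\<alpha> \<in> nat_span F" "\<alpha> \<noteq> 0" "finite F" "\<And>\<beta>. \<beta> \<in> F \<Longrightarrow> 0 < blinfun_apply \<beta> v"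
  shows "0 < blinfun_apply \<alpha> v"
proof -
  obtain c where c: "\<alpha> = (\<Sum>x\<in>F. real (c x) *\<^sub>R x)"
    using assms(1) by (auto simp: nat_span_def)
  have "\<exists>x\<in>F. c x \<noteq> 0"
  proof (rule ccontr)
    assume "\<not> ?thesis"
    then have "\<alpha> = 0"
      unfolding c by simp
    with assms(2) show False ..
  qed
  then obtain x where x: "x \<in> F" "c x \<noteq> 0"
    by blast
  have "0 < real (c x) * blinfun_apply x v"
    using x assms(4) by simp
  also have "\<dots> \<le> (\<Sum>x\<in>F. real (c x) * blinfun_apply x v)"
    by (rule member_le_sum) (use x assms in \<open>auto simp: less_imp_le\<close>)
  finally show ?thesis
    by (simp add: c blinfun.sum_left blinfun.scaleR_left)
qed

text \<open>Every linear functional on the dual space is the evaluation at a vector.\<close>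

lemma independent_dual_values:
  fixes F :: "'v::euclidean_space dual set"
  assumes "independent F"
  shows "\<exists>v. \<forall>\<beta>\<in>F. blinfun_apply \<beta> v = h \<beta>"
proof -
  obtain f :: "'v dual \<Rightarrow> real" where f: "linear f" "\<And>\<beta>. \<beta> \<in> F \<Longrightarrow> f \<beta> = h \<beta>"
    using linear_independent_extend[OF assms] by blast
  define v where "v = (\<Sum>b\<in>Basis. f (blinfun_inner_right b) *\<^sub>R b)"
  have "blinfun_apply \<beta> v = f \<beta>" for \<beta>
  proof -
    have "\<beta> = (\<Sum>b\<in>Basis. blinfun_apply \<beta> b *\<^sub>R blinfun_inner_right b)"
      by (rule blinfun_euclidean_eqI)
        (simp add: blinfun.sum_left blinfun.scaleR_left inner_Basis if_distrib cong: if_cong)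
    then have "f \<beta> = f (\<Sum>b\<in>Basis. blinfun_apply \<beta> b *\<^sub>R blinfun_inner_right b)"
      by simp
    then show ?thesis
      by (simp add: v_def linear_sum[OF f(1)] linear_scale[OF f(1)] blinfun.sum_right
          blinfun.scaleR_right mult.commute)
  qed
  with f(2) show ?thesis
    by (intro exI[of _ v]) simp
qed

section \<open>The Weyl group and the extended affine Weyl group\<close>

locale affine_weyl =
  fixes \<Delta> :: "'v::euclidean_space root_data"
  assumes root_datum: "root_datum \<Delta>"
begin

lemma root_system_roots: "root_system (roots \<Delta>)"
  using root_datum by (simp add: root_datum_def)

lemma finite_roots: "finite (roots \<Delta>)"
  and root_nonzero: "\<alpha> \<in> roots \<Delta> \<Longrightarrow> \<alpha> \<noteq> 0"
  and dual_refl_roots: "\<alpha> \<in> roots \<Delta> \<Longrightarrow> \<beta> \<in> roots \<Delta> \<Longrightarrow> dual_refl \<alpha> \<beta> \<in> roots \<Delta>"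
  and roots_reduced: "\<alpha> \<in> roots \<Delta> \<Longrightarrow> c *\<^sub>R \<alpha> \<in> roots \<Delta> \<Longrightarrow> c = 1 \<or> c = -1"
  using root_system_roots by (auto simp: root_system_def)

text \<open>The reflection in a root sends that root to its negative.\<close>

lemma uminus_roots: "\<alpha> \<in> roots \<Delta> \<Longrightarrow> - \<alpha> \<in> roots \<Delta>"
  using dual_refl_roots[of \<alpha> \<alpha>]
  by (simp add: dual_refl_def apply_coroot_self root_nonzero scaleR_2)

lemma root_mem_lattice: "\<alpha> \<in> roots \<Delta> \<Longrightarrow> \<alpha> \<in> lattice \<Delta>"
  using root_datum int_span_superset[OF finite_roots] by (auto simp: root_datum_def)

lemma coroot_mem_dual_lattice: "\<alpha> \<in> roots \<Delta> \<Longrightarrow> coroot \<alpha> \<in> dual_lattice (lattice \<Delta>)"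
  using root_datum int_span_superset[OF finite_imageI[OF finite_roots, of coroot]]
  by (auto simp: root_datum_def)

lemma simple_roots_subset: "simple_roots \<Delta> \<subseteq> roots \<Delta>"
  and independent_simple_roots: "independent (simple_roots \<Delta>)"
  and root_nat_span_cases: "\<alpha> \<in> roots \<Delta> \<Longrightarrow>
    \<alpha> \<in> nat_span (simple_roots \<Delta>) \<or> - \<alpha> \<in> nat_span (simple_roots \<Delta>)"
  and highest_root_mem: "highest_root \<Delta> \<in> roots \<Delta>"
  and highest_root_diff: "\<alpha> \<in> roots \<Delta> \<Longrightarrow> highest_root \<Delta> - \<alpha> \<in> nat_span (simple_roots \<Delta>)"
  using root_datum by (auto simp: root_datum_def root_basis_def is_highest_root_def)

lemma finite_simple_roots: "finite (simple_roots \<Delta>)"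
  using finite_roots simple_roots_subset by (rule rev_finite_subset)

text \<open>Applied to negatives, maximality of the highest root bounds every root below by minus
  the highest root wherever the simple roots are nonnegative.\<close>

lemma highest_root_add: "\<alpha> \<in> roots \<Delta> \<Longrightarrow> highest_root \<Delta> + \<alpha> \<in> nat_span (simple_roots \<Delta>)"
  using highest_root_diff[OF uminus_roots] by simp

lemma dual_lattice_add:
  "y \<in> dual_lattice X \<Longrightarrow> z \<in> dual_lattice X \<Longrightarrow> y + z \<in> dual_lattice X"
  by (simp add: dual_lattice_def blinfun.add_right)

lemma dual_lattice_scale:
  "y \<in> dual_lattice X \<Longrightarrow> c \<in> \<int> \<Longrightarrow> c *\<^sub>R y \<in> dual_lattice X"
  by (simp add: dual_lattice_def blinfun.scaleR_right)

lemma root_apply_dual_lattice: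
  "\<alpha> \<in> roots \<Delta> \<Longrightarrow> y \<in> dual_lattice (lattice \<Delta>) \<Longrightarrow> blinfun_apply \<alpha> y \<in> \<int>"
  using root_mem_lattice by (auto simp: dual_lattice_def)

lemma refl_dual_lattice:
  assumes "\<alpha> \<in> roots \<Delta>" "y \<in> dual_lattice (lattice \<Delta>)"
  shows "refl \<alpha> y \<in> dual_lattice (lattice \<Delta>)"
proof -
  have "y + (- blinfun_apply \<alpha> y) *\<^sub>R coroot \<alpha> \<in> dual_lattice (lattice \<Delta>)"
    using assms coroot_mem_dual_lattice root_apply_dual_lattice
    by (intro dual_lattice_add dual_lattice_scale) auto
  then show ?thesis
    by (simp add: refl_def)
qed

lemma weyl_group_linear: "w \<in> weyl_group \<Delta> \<Longrightarrow> linear w"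
proof (induction rule: weyl_group.induct)
  case (step \<alpha> w)
  show ?case
    by (rule linear_compose[OF step.IH linear_refl])
qed (rule linear_id)

lemma weyl_group_comp: "u \<in> weyl_group \<Delta> \<Longrightarrow> w \<in> weyl_group \<Delta> \<Longrightarrow> u \<circ> w \<in> weyl_group \<Delta>"
  by (induction rule: weyl_group.induct) (auto simp: comp_assoc intro: weyl_group.step)

lemma weyl_group_inverse:
  "w \<in> weyl_group \<Delta> \<Longrightarrow> \<exists>w'\<in>weyl_group \<Delta>. (\<forall>v. w' (w v) = v) \<and> (\<forall>v. w (w' v) = v)"
proof (induction rule: weyl_group.induct)
  case one
  then show ?case
    by (intro bexI[of _ id]) (simp_all add: weyl_group.one)
next
  case (step \<alpha> w)
  then obtain w' where w': "w' \<in> weyl_group \<Delta>" "\<And>v. w' (w v) = v" "\<And>v. w (w' v) = v"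
    by blast
  have "refl \<alpha> \<in> weyl_group \<Delta>"
    using weyl_group.step[OF step.hyps(1) weyl_group.one] by simp
  then have "w' \<circ> refl \<alpha> \<in> weyl_group \<Delta>"
    using w' weyl_group_comp by blast
  then show ?case
    using w' by (intro bexI[of _ "w' \<circ> refl \<alpha>"]) (auto simp: refl_refl root_nonzero[OF step.hyps(1)])
qed

lemma weyl_group_dual_lattice:
  "w \<in> weyl_group \<Delta> \<Longrightarrow> y \<in> dual_lattice (lattice \<Delta>) \<Longrightarrow> w y \<in> dual_lattice (lattice \<Delta>)"
  by (induction rule: weyl_group.induct) (auto intro: refl_dual_lattice)

lemma weyl_group_root:
  "w \<in> weyl_group \<Delta> \<Longrightarrow> \<alpha> \<in> roots \<Delta> \<Longrightarrow> \<exists>\<beta>\<in>roots \<Delta>. \<forall>v. blinfun_apply \<alpha> (w v) = blinfun_apply \<beta> v"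
proof (induction arbitrary: \<alpha> rule: weyl_group.induct)
  case (step \<gamma> w)
  then show ?case
    using dual_refl_roots by (simp add: apply_refl)
qed auto

lemma affine_weyl_group_iff:
  "w \<in> affine_weyl_group \<Delta> \<longleftrightarrow>
    (\<exists>u\<in>weyl_group \<Delta>. \<exists>y\<in>dual_lattice (lattice \<Delta>). \<forall>v. w v = u (v + y))"
  by (auto simp: affine_weyl_group_def translation_def fun_eq_iff)

lemma id_affine_weyl_group: "id \<in> affine_weyl_group \<Delta>"
  unfolding affine_weyl_group_iff
  by (intro bexI[of _ id] bexI[of _ 0]) (auto simp: weyl_group.one dual_lattice_def)

lemma affine_weyl_group_comp:
  assumes "u \<in> affine_weyl_group \<Delta>" "w \<in> affine_weyl_group \<Delta>"
  shows "u \<circ> w \<in> affine_weyl_group \<Delta>"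
proof -
  obtain u0 y where u: "u0 \<in> weyl_group \<Delta>" "y \<in> dual_lattice (lattice \<Delta>)" "\<And>v. u v = u0 (v + y)"
    using assms(1) by (auto simp: affine_weyl_group_iff)
  obtain w0 z where w: "w0 \<in> weyl_group \<Delta>" "z \<in> dual_lattice (lattice \<Delta>)" "\<And>v. w v = w0 (v + z)"
    using assms(2) by (auto simp: affine_weyl_group_iff)
  obtain w' where w': "w' \<in> weyl_group \<Delta>" "\<And>v. w0 (w' v) = v"
    using weyl_group_inverse[OF w(1)] by blast
  \<comment> \<open>Moving the translation by \<open>y\<close> to the right past \<open>w0\<close>
    changes it into the translation by the preimage of \<open>y\<close> under
    \<open>w0\<close>.\<close>
  have "(u \<circ> w) v = (u0 \<circ> w0) (v + (z + w' y))" for v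
  proof -
    have "w0 (v + (z + w' y)) = w0 (v + z) + y"
      using linear_add[OF weyl_group_linear[OF w(1)], of "v + z" "w' y"] by (simp only: w'(2) add.assoc)
    then show ?thesis
      by (simp only: comp_apply u(3) w(3))
  qed
  moreover have "z + w' y \<in> dual_lattice (lattice \<Delta>)"
    by (rule dual_lattice_add[OF w(2) weyl_group_dual_lattice[OF w'(1) u(2)]])
  ultimately show ?thesis
    unfolding affine_weyl_group_iff using weyl_group_comp[OF u(1) w(1)]
    by (intro bexI[of _ "u0 \<circ> w0"] bexI[of _ "z + w' y"] allI)
qed

lemma affine_weyl_group_inverse:
  assumes "w \<in> affine_weyl_group \<Delta>"
  shows "\<exists>w'\<in>affine_weyl_group \<Delta>. (\<forall>v. w' (w v) = v) \<and> (\<forall>v. w (w' v) = v)"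
proof -
  obtain u y where w: "u \<in> weyl_group \<Delta>" "y \<in> dual_lattice (lattice \<Delta>)" "\<And>v. w v = u (v + y)"
    using assms by (auto simp: affine_weyl_group_iff)
  obtain u' where u': "u' \<in> weyl_group \<Delta>" "\<And>v. u' (u v) = v" "\<And>v. u (u' v) = v"
    using weyl_group_inverse[OF w(1)] by blast
  \<comment> \<open>The inverse of "translate by \<open>y\<close>, then apply \<open>u\<close>" is
    "translate by \<open>- u y\<close>, then apply the inverse of \<open>u\<close>". The factor
    \<open>-1\<close> is written as a scalar so that \<open>dual_lattice_scale\<close>
    applies.\<close>
  define w' where "w' v = u' (v + (-1) *\<^sub>R u y)" for v
  have "w' \<in> affine_weyl_group \<Delta>"
    unfolding affine_weyl_group_iff w'_def
    using u'(1) dual_lattice_scale[OF weyl_group_dual_lattice[OF w(1,2)], of "-1"]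
    by (intro bexI[of _ u'] bexI[of _ "(-1) *\<^sub>R u y"] allI refl) auto
  moreover have w'_eq: "w' v = u' v - y" for v
    using linear_diff[OF weyl_group_linear[OF u'(1)]] u'(2) by (simp add: w'_def)
  ultimately show ?thesis
    using u' by (intro bexI[of _ w']) (auto simp: w(3) w'_eq)
qed

lemma affine_weyl_group_bij:
  assumes "w \<in> affine_weyl_group \<Delta>"
  shows "bij w"
proof -
  obtain w' where "\<And>v. w' (w v) = v" "\<And>v. w (w' v) = v"
    using affine_weyl_group_inverse[OF assms] by blast
  then show ?thesis
    by (intro o_bij[of w']) (simp_all add: fun_eq_iff)
qed

lemma inv_affine_weyl_group:
  assumes "w \<in> affine_weyl_group \<Delta>"
  shows "inv w \<in> affine_weyl_group \<Delta>"
proof -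
  obtain w' where "w' \<in> affine_weyl_group \<Delta>" "\<And>v. w' (w v) = v" "\<And>v. w (w' v) = v"
    using affine_weyl_group_inverse[OF assms] by blast
  then show ?thesis
    using inv_equality[of w' w] by simp
qed

lemma inv_apply: "w \<in> affine_weyl_group \<Delta> \<Longrightarrow> inv w (w v) = v"
  and apply_inv: "w \<in> affine_weyl_group \<Delta> \<Longrightarrow> w (inv w v) = v"
  by (simp_all add: affine_weyl_group_bij bij_is_inj bij_is_surj surj_f_inv_f)

section \<open>Affine roots and affine reflections\<close>

lemma affine_rootE:
  assumes "a \<in> affine_roots \<Delta>"
  obtains \<alpha> m where "\<alpha> \<in> roots \<Delta>" "a = affine_fun \<alpha> (real_of_int m)"
  using assms by (auto simp: affine_roots_def)

lemma affine_root_comp: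
  assumes "w \<in> affine_weyl_group \<Delta>" "a \<in> affine_roots \<Delta>"
  shows "a \<circ> w \<in> affine_roots \<Delta>"
proof -
  obtain \<alpha> m where a: "\<alpha> \<in> roots \<Delta>" "a = affine_fun \<alpha> (real_of_int m)"
    by (rule affine_rootE[OF assms(2)])
  obtain u y where w: "u \<in> weyl_group \<Delta>" "y \<in> dual_lattice (lattice \<Delta>)" "\<And>v. w v = u (v + y)"
    using assms by (auto simp: affine_weyl_group_iff)
  obtain \<beta> where \<beta>: "\<beta> \<in> roots \<Delta>" "\<And>v. blinfun_apply \<alpha> (u v) = blinfun_apply \<beta> v"
    using weyl_group_root[OF w(1) a(1)] by blast
  obtain n where "blinfun_apply \<beta> y = real_of_int n"
    using root_apply_dual_lattice[OF \<beta>(1) w(2)] by (auto elim: Ints_cases)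
  then have "a \<circ> w = affine_fun \<beta> (real_of_int (n + m))"
    by (simp add: fun_eq_iff a(2) affine_fun_def w(3) \<beta>(2) blinfun.add_right)
  with \<beta>(1) show ?thesis
    unfolding affine_roots_def by blast
qed

lemma affine_refl_mem:
  assumes "a \<in> affine_roots \<Delta>"
  shows "affine_refl a \<in> affine_weyl_group \<Delta>"
proof -
  obtain \<alpha> m where a: "\<alpha> \<in> roots \<Delta>" "a = affine_fun \<alpha> (real_of_int m)"
    by (rule affine_rootE[OF assms])
  \<comment> \<open>The translation by \<open>m\<close> times the coroot adds that vector once, and
    the reflection subtracts it twice because \<open>\<alpha>\<close> takes the value 2 on its
    coroot; the net shift is the required one.\<close>
  have "affine_refl a v = refl \<alpha> (v + real_of_int m *\<^sub>R coroot \<alpha>)" for v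
  proof -
    have "(real_of_int m * 2) *\<^sub>R coroot \<alpha> = real_of_int m *\<^sub>R coroot \<alpha> + real_of_int m *\<^sub>R coroot \<alpha>"
      by (simp only: mult_2_right scaleR_add_left)
    then show ?thesis
      using apply_coroot_self[OF root_nonzero[OF a(1)]]
      by (simp add: affine_refl_def a(2) affine_fun_def refl_def blinfun.add_right blinfun.scaleR_right
          algebra_simps)
  qed
  moreover have "refl \<alpha> \<in> weyl_group \<Delta>"
    using weyl_group.step[OF a(1) weyl_group.one] by simp
  moreover have "real_of_int m *\<^sub>R coroot \<alpha> \<in> dual_lattice (lattice \<Delta>)"
    by (intro dual_lattice_scale coroot_mem_dual_lattice a) simp
  ultimately show ?thesis
    unfolding affine_weyl_group_iff
    by (intro bexI[of _ "refl \<alpha>"] bexI[of _ "real_of_int m *\<^sub>R coroot \<alpha>"] allI)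
qed

lemma affine_root_affine_refl:
  assumes "a \<in> affine_roots \<Delta>"
  shows "a (affine_refl a v) = - a v"
proof -
  obtain \<alpha> m where a: "\<alpha> \<in> roots \<Delta>" "a = affine_fun \<alpha> (real_of_int m)"
    by (rule affine_rootE[OF assms])
  show ?thesis
    using apply_coroot_self[OF root_nonzero[OF a(1)]]
    by (simp add: a(2) affine_refl_def affine_fun_def blinfun.diff_right blinfun.scaleR_right)
qed

lemma affine_refl_affine_refl:
  assumes "a \<in> affine_roots \<Delta>"
  shows "affine_refl a (affine_refl a v) = v"
proof -
  have "affine_refl a (affine_refl a v) = affine_refl a v + a v *\<^sub>R coroot (grad a)"
    using affine_root_affine_refl[OF assms, of v] by (simp add: affine_refl_def[of a "affine_refl a v"])
  then show ?thesis
    by (simp add: affine_refl_def)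
qed

section \<open>Positive affine roots and simple reflections\<close>

lemma pos_affine_rootE:
  assumes "b \<in> pos_affine_roots \<Delta>"
  obtains (shifted) \<alpha> m where "\<alpha> \<in> roots \<Delta>" "m > 0" "b = affine_fun \<alpha> (real_of_int m)"
  | (linear) \<alpha> where "\<alpha> \<in> roots \<Delta>" "\<alpha> \<in> nat_span (simple_roots \<Delta>)" "b = affine_fun \<alpha> 0"
  using assms by (auto simp: pos_affine_roots_def positive_roots_def)

lemma pos_affine_roots_subset: "pos_affine_roots \<Delta> \<subseteq> affine_roots \<Delta>"
  by (force simp: pos_affine_roots_def affine_roots_def positive_roots_def intro: exI[of _ "0::int"])

lemma affine_root_sign_cases:
  assumes "a \<in> affine_roots \<Delta>"
  shows "a \<in> pos_affine_roots \<Delta> \<or> (\<lambda>v. - a v) \<in> pos_affine_roots \<Delta>"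
proof -
  obtain \<alpha> m where a: "\<alpha> \<in> roots \<Delta>" "a = affine_fun \<alpha> (real_of_int m)"
    by (rule affine_rootE[OF assms])
  have neg: "(\<lambda>v. - a v) = affine_fun (- \<alpha>) (real_of_int (- m))"
    by (simp add: a fun_eq_iff affine_fun_def blinfun.minus_left)
  consider "m > 0" | "m = 0" | "- m > 0"
    by linarith
  then show ?thesis
  proof cases
    case 1
    then show ?thesis using a by (auto simp: pos_affine_roots_def)
  next
    case 2
    then show ?thesis
      unfolding neg using root_nat_span_cases[OF a(1)] a uminus_roots[OF a(1)]
      by (auto simp: pos_affine_roots_def positive_roots_def)
  next
    case 3
    then show ?thesis
      unfolding neg using uminus_roots[OF a(1)] unfolding pos_affine_roots_def by blast
  qed
qed

lemma simple_affine_roots_subset: "simple_affine_roots \<Delta> \<subseteq> pos_affine_roots \<Delta>"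
  using simple_roots_subset nat_span_superset[OF finite_simple_roots] uminus_roots[OF highest_root_mem]
  by (force simp: simple_affine_roots_def pos_affine_roots_def positive_roots_def
      intro: exI[of _ "1::int"])

lemma simple_affine_root_mem: "a \<in> simple_affine_roots \<Delta> \<Longrightarrow> a \<in> affine_roots \<Delta>"
  using simple_affine_roots_subset pos_affine_roots_subset by blast

lemma fundamental_chamber_iff:
  "v \<in> fundamental_chamber \<Delta> \<longleftrightarrow>
    (\<forall>\<beta>\<in>simple_roots \<Delta>. 0 < blinfun_apply \<beta> v) \<and> blinfun_apply (highest_root \<Delta>) v < 1"
  by (auto simp: fundamental_chamber_def simple_affine_roots_def affine_fun_def blinfun.minus_left)

text \<open>On the chamber the highest root is below 1, hence every root is above -1, and adding an
  integer \<open>m \<ge> 1\<close> makes it positive. For \<open>m = 0\<close> the root is a nonzero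
  natural combination of positive values.\<close>

lemma pos_affine_root_pos:
  assumes x: "x \<in> fundamental_chamber \<Delta>" and b: "b \<in> pos_affine_roots \<Delta>"
  shows "0 < b x"
  using b
proof (cases rule: pos_affine_rootE)
  case (shifted \<alpha> m)
  have "0 \<le> blinfun_apply (highest_root \<Delta> + \<alpha>) x"
    using x by (intro nat_span_apply_nonneg[OF highest_root_add])
      (auto simp: shifted fundamental_chamber_iff less_imp_le)
  then show ?thesis
    using x shifted by (auto simp: fundamental_chamber_iff affine_fun_def blinfun.add_left)
next
  case (linear \<alpha>)
  then show ?thesis
    using x nat_span_apply_pos[OF linear(2) root_nonzero[OF linear(1)] finite_simple_roots]
    by (auto simp: fundamental_chamber_iff affine_fun_def)
qed

lemma fundamental_chamber_nonempty: "fundamental_chamber \<Delta> \<noteq> {}"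
proof -
  obtain v where v: "\<And>\<beta>. \<beta> \<in> simple_roots \<Delta> \<Longrightarrow> blinfun_apply \<beta> v = 1"
    using independent_dual_values[OF independent_simple_roots, of "\<lambda>_. 1"] by blast
  \<comment> \<open>A scaling small enough to push the highest root below 1, while the simple roots
    keep the positive value \<open>e\<close>.\<close>
  define e where "e = 1 / (1 + \<bar>blinfun_apply (highest_root \<Delta>) v\<bar>)"
  have "e > 0" "e * blinfun_apply (highest_root \<Delta>) v < 1"
    by (auto simp: e_def divide_less_eq add_pos_nonneg)
  then have "e *\<^sub>R v \<in> fundamental_chamber \<Delta>"
    by (simp add: fundamental_chamber_iff v blinfun.scaleR_right)
  then show ?thesis by blast
qed

text \<open>The point lies in the relative interior of the facet of \<open>C_+\<close> on the wall
  of \<open>a\<close>. It lets signs of affine roots be read off at one point when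
  \<open>C_+\<close> is reflected in that wall.\<close>

lemma wall_point:
  assumes "a \<in> simple_affine_roots \<Delta>"
  shows "\<exists>p. a p = 0 \<and> (\<forall>b\<in>pos_affine_roots \<Delta>. b \<noteq> a \<longrightarrow> 0 < b p)"
proof -
  consider (linear) \<beta> where "\<beta> \<in> simple_roots \<Delta>" "a = affine_fun \<beta> 0"
    | (highest) "a = affine_fun (- highest_root \<Delta>) 1"
    using assms by (auto simp: simple_affine_roots_def)
  then show ?thesis
  proof cases
    case linear
    obtain v where v: "\<And>\<gamma>. \<gamma> \<in> simple_roots \<Delta> \<Longrightarrow> blinfun_apply \<gamma> v = (if \<gamma> = \<beta> then 0 else 1)"
      using independent_dual_values[OF independent_simple_roots, of "\<lambda>\<gamma>. if \<gamma> = \<beta> then 0 else 1"]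
      by blast
    define e where "e = 1 / (1 + \<bar>blinfun_apply (highest_root \<Delta>) v\<bar>)"
    define p where "p = e *\<^sub>R v"
    have e: "e > 0" "e * blinfun_apply (highest_root \<Delta>) v < 1"
      by (auto simp: e_def divide_less_eq add_pos_nonneg)
    have p: "blinfun_apply \<gamma> p = (if \<gamma> = \<beta> then 0 else e)" if "\<gamma> \<in> simple_roots \<Delta>" for \<gamma>
      using v[OF that] by (simp add: p_def blinfun.scaleR_right)
    have "0 < b p" if b: "b \<in> pos_affine_roots \<Delta>" "b \<noteq> a" for b
      using b(1)
    proof (cases rule: pos_affine_rootE)
      case (shifted \<alpha> m)
      have "0 \<le> blinfun_apply (highest_root \<Delta> + \<alpha>) p"
        using e by (intro nat_span_apply_nonneg[OF highest_root_add[OF shifted(1)]]) (auto simp: p)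
      moreover have "blinfun_apply (highest_root \<Delta>) p < 1"
        using e by (simp add: p_def blinfun.scaleR_right)
      ultimately show ?thesis
        using shifted by (simp add: affine_fun_def blinfun.add_left)
    next
      case (linear \<alpha>)
      obtain c where c: "\<alpha> = (\<Sum>\<gamma>\<in>simple_roots \<Delta>. real (c \<gamma>) *\<^sub>R \<gamma>)"
        using linear(2) by (auto simp: nat_span_def)
      \<comment> \<open>Otherwise the root would be a multiple of \<open>\<beta>\<close>, and in a
        reduced system the only nonnegative such multiple is \<open>\<beta>\<close> itself.\<close>
      have "\<exists>\<gamma>\<in>simple_roots \<Delta> - {\<beta>}. c \<gamma> \<noteq> 0"
      proof (rule ccontr)
        assume "\<not> ?thesis"
        then have "\<alpha> = (\<Sum>\<gamma>\<in>{\<beta>}. real (c \<gamma>) *\<^sub>R \<gamma>)"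
          unfolding c using \<open>\<beta> \<in> simple_roots \<Delta>\<close> finite_simple_roots
          by (intro sum.mono_neutral_right) auto
        then have "\<alpha> = real (c \<beta>) *\<^sub>R \<beta>"
          by simp
        moreover from this have "real (c \<beta>) = 1 \<or> real (c \<beta>) = -1"
          using roots_reduced linear(1) \<open>\<beta> \<in> simple_roots \<Delta>\<close> simple_roots_subset by blast
        ultimately have "\<alpha> = \<beta>"
          by auto
        with linear(3) b(2) \<open>a = affine_fun \<beta> 0\<close> show False
          by simp
      qed
      then obtain \<gamma> where \<gamma>: "\<gamma> \<in> simple_roots \<Delta>" "\<gamma> \<noteq> \<beta>" "c \<gamma> \<noteq> 0"
        by blast
      have "0 < real (c \<gamma>) * blinfun_apply \<gamma> p"
        using \<gamma> e by (simp add: p)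
      also have "\<dots> \<le> (\<Sum>\<gamma>\<in>simple_roots \<Delta>. real (c \<gamma>) * blinfun_apply \<gamma> p)"
        by (rule member_le_sum) (use \<gamma> e finite_simple_roots in \<open>auto simp: p\<close>)
      finally show ?thesis
        by (simp add: linear(3) affine_fun_def c blinfun.sum_left blinfun.scaleR_left)
    qed
    moreover have "a p = 0"
      using linear p by (simp add: affine_fun_def)
    ultimately show ?thesis by blast
  next
    case highest
    obtain v where v: "\<And>\<gamma>. \<gamma> \<in> simple_roots \<Delta> \<Longrightarrow> blinfun_apply \<gamma> v = 1"
      using independent_dual_values[OF independent_simple_roots, of "\<lambda>\<gamma>. 1"] by blast
    \<comment> \<open>Maximality, compared with the negative of the highest root, puts twice the
      highest root into \<open>nat_span\<close>; its positivity at \<open>v\<close> allows scaling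
      to the wall where the highest root equals 1.\<close>
    have "0 < blinfun_apply (highest_root \<Delta> + highest_root \<Delta>) v"
    proof (rule nat_span_apply_pos[where F = "simple_roots \<Delta>"])
      show "highest_root \<Delta> + highest_root \<Delta> \<noteq> 0"
        using root_nonzero[OF highest_root_mem] by (simp flip: scaleR_2)
    qed (auto simp: v highest_root_add highest_root_mem finite_simple_roots)
    then have th: "0 < blinfun_apply (highest_root \<Delta>) v"
      by (simp add: blinfun.add_left)
    define p where "p = (1 / blinfun_apply (highest_root \<Delta>) v) *\<^sub>R v"
    have p: "0 < blinfun_apply \<gamma> p" if "\<gamma> \<in> simple_roots \<Delta>" for \<gamma>
      using v[OF that] th by (simp add: p_def blinfun.scaleR_right)
    have thp: "blinfun_apply (highest_root \<Delta>) p = 1"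
      using th by (simp add: p_def blinfun.scaleR_right)
    have "0 < b p" if b: "b \<in> pos_affine_roots \<Delta>" "b \<noteq> a" for b
      using b(1)
    proof (cases rule: pos_affine_rootE)
      case (shifted \<alpha> m)
      \<comment> \<open>At \<open>p\<close> every root is at least -1. Equality together with
        \<open>m = 1\<close> would give the value 0, and by \<open>thp\<close> and positivity on the
        simple roots this happens only for \<open>a\<close>.\<close>
      have "\<alpha> \<noteq> - highest_root \<Delta> \<or> m > 1"
        using b(2) shifted highest by (cases "m = 1") auto
      then show ?thesis
      proof
        assume "m > 1"
        moreover have "0 \<le> blinfun_apply (highest_root \<Delta> + \<alpha>) p"
          by (intro nat_span_apply_nonneg[OF highest_root_add[OF shifted(1)]]) (auto simp: p less_imp_le)
        ultimately show ?thesis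
          using shifted thp by (simp add: affine_fun_def blinfun.add_left)
      next
        assume "\<alpha> \<noteq> - highest_root \<Delta>"
        then have "0 < blinfun_apply (highest_root \<Delta> + \<alpha>) p"
          by (intro nat_span_apply_pos[OF highest_root_add[OF shifted(1)] _ finite_simple_roots])
            (auto simp: p eq_neg_iff_add_eq_0 add.commute)
        then show ?thesis
          using shifted thp by (simp add: affine_fun_def blinfun.add_left)
      qed
    next
      case (linear \<alpha>)
      then show ?thesis
        using nat_span_apply_pos[OF linear(2) root_nonzero[OF linear(1)] finite_simple_roots, of p] p
        by (simp add: affine_fun_def)
    qed
    moreover have "a p = 0"
      using highest thp by (simp add: affine_fun_def blinfun.minus_left)
    ultimately show ?thesis by blast
  qed
qed

text \<open>The reflection fixes the wall point, so the reflected root keeps the positive value of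
  \<open>b\<close> there. A negative affine root is nonpositive at that point and \<open>a\<close>
  vanishes there, so both are excluded.\<close>

lemma simple_affine_refl_permutes:
  assumes a: "a \<in> simple_affine_roots \<Delta>" and b: "b \<in> pos_affine_roots \<Delta>" "b \<noteq> a"
  shows "b \<circ> affine_refl a \<in> pos_affine_roots \<Delta> - {a}"
proof -
  obtain p where p: "a p = 0" "\<And>b. b \<in> pos_affine_roots \<Delta> \<Longrightarrow> b \<noteq> a \<Longrightarrow> 0 < b p"
    using wall_point[OF a] by blast
  have refl_p: "affine_refl a p = p"
    by (simp add: affine_refl_def p)
  have bp: "0 < b p"
    using p b by blast
  have "(\<lambda>v. - (b \<circ> affine_refl a) v) \<notin> pos_affine_roots \<Delta>"
  proof
    assume "(\<lambda>v. - (b \<circ> affine_refl a) v) \<in> pos_affine_roots \<Delta>"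
    then have "0 \<le> - (b \<circ> affine_refl a) p"
      using p by (metis less_imp_le order_refl)
    then show False
      using bp refl_p by simp
  qed
  moreover have "b \<circ> affine_refl a \<in> affine_roots \<Delta>"
    using affine_root_comp affine_refl_mem simple_affine_root_mem[OF a] b pos_affine_roots_subset
    by blast
  moreover have "b \<circ> affine_refl a \<noteq> a"
    using bp refl_p p(1) by (metis comp_apply order_less_irrefl)
  ultimately show ?thesis
    using affine_root_sign_cases by blast
qed

text \<open>There are finitely many gradients, and for each of them negativity at \<open>x\<close>
  bounds the integer constant, which is nonnegative for a positive affine root.\<close>

lemma finite_negative_roots: "finite {b \<in> pos_affine_roots \<Delta>. b x < 0}"
proof (rule finite_subset)
  show "finite (\<Union>\<alpha>\<in>roots \<Delta>. (\<lambda>m. affine_fun \<alpha> (real_of_int m)) ` {0..\<lceil>- blinfun_apply \<alpha> x\<rceil>})"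
    using finite_roots by simp
  show "{b \<in> pos_affine_roots \<Delta>. b x < 0} \<subseteq>
      (\<Union>\<alpha>\<in>roots \<Delta>. (\<lambda>m. affine_fun \<alpha> (real_of_int m)) ` {0..\<lceil>- blinfun_apply \<alpha> x\<rceil>})"
  proof clarify
    fix b assume b: "b \<in> pos_affine_roots \<Delta>" "b x < 0"
    then obtain \<alpha> m where *: "\<alpha> \<in> roots \<Delta>" "0 \<le> m" "b = affine_fun \<alpha> (real_of_int m)"
      by (metis less_imp_le of_int_0 order_refl pos_affine_rootE)
    then have "m \<le> \<lceil>- blinfun_apply \<alpha> x\<rceil>"
      using b(2) by (simp add: affine_fun_def) linarith
    with * show "b \<in> (\<Union>\<alpha>\<in>roots \<Delta>. (\<lambda>m. affine_fun \<alpha> (real_of_int m)) ` {0..\<lceil>- blinfun_apply \<alpha> x\<rceil>})"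
      by (intro UN_I[of \<alpha>] image_eqI[of _ _ m]) auto
  qed
qed

text \<open>Precomposition with the reflection injects the roots negative at the reflected point
  into those negative at \<open>x\<close>, and its image misses \<open>a\<close>, which is negative
  at \<open>x\<close>.\<close>

lemma card_negative_roots_affine_refl:
  assumes a: "a \<in> simple_affine_roots \<Delta>" "a x < 0"
  shows "card {b \<in> pos_affine_roots \<Delta>. b (affine_refl a x) < 0} < card {b \<in> pos_affine_roots \<Delta>. b x < 0}"
proof -
  have a': "a \<in> affine_roots \<Delta>" "a \<in> pos_affine_roots \<Delta>"
    using a simple_affine_root_mem simple_affine_roots_subset by auto
  have "card {b \<in> pos_affine_roots \<Delta>. b (affine_refl a x) < 0} \<le> card ({b \<in> pos_affine_roots \<Delta>. b x < 0} - {a})"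
  proof (rule card_inj_on_le)
    show "inj_on (\<lambda>b. b \<circ> affine_refl a) {b \<in> pos_affine_roots \<Delta>. b (affine_refl a x) < 0}"
    proof (rule inj_on_inverseI)
      show "(b \<circ> affine_refl a) \<circ> affine_refl a = b" for b :: "'v \<Rightarrow> real"
        using affine_refl_affine_refl[OF a'(1)] by (simp add: fun_eq_iff)
    qed
    show "(\<lambda>b. b \<circ> affine_refl a) ` {b \<in> pos_affine_roots \<Delta>. b (affine_refl a x) < 0}
        \<subseteq> {b \<in> pos_affine_roots \<Delta>. b x < 0} - {a}"
    proof clarify
      fix b assume b: "b \<in> pos_affine_roots \<Delta>" "b (affine_refl a x) < 0"
      have "b \<noteq> a"
        using b(2) a(2) affine_root_affine_refl[OF a'(1), of x] by auto
      then show "b \<circ> affine_refl a \<in> {b \<in> pos_affine_roots \<Delta>. b x < 0} - {a}"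
        using simple_affine_refl_permutes[OF a(1) b(1)] b(2) by simp
    qed
    show "finite ({b \<in> pos_affine_roots \<Delta>. b x < 0} - {a})"
      using finite_negative_roots by simp
  qed
  also have "\<dots> < card {b \<in> pos_affine_roots \<Delta>. b x < 0}"
    by (rule card_Diff1_less[OF finite_negative_roots]) (use a a' in simp)
  finally show ?thesis .
qed

section \<open>The regular set and descent to the fundamental chamber\<close>

lemma regular_affine_root_nonzero:
  "x \<in> regular_set \<Delta> \<Longrightarrow> a \<in> affine_roots \<Delta> \<Longrightarrow> a x \<noteq> 0"
  using affine_root_sign_cases[of a] unfolding regular_set_def by force

lemma regular_setI: "(\<And>a. a \<in> affine_roots \<Delta> \<Longrightarrow> a x \<noteq> 0) \<Longrightarrow> x \<in> regular_set \<Delta>"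
  using pos_affine_roots_subset by (auto simp: regular_set_def)

lemma regular_set_image:
  "w \<in> affine_weyl_group \<Delta> \<Longrightarrow> x \<in> regular_set \<Delta> \<Longrightarrow> w x \<in> regular_set \<Delta>"
  by (rule regular_setI) (metis regular_affine_root_nonzero affine_root_comp comp_apply)

lemma fundamental_chamber_subset: "fundamental_chamber \<Delta> \<subseteq> regular_set \<Delta>"
  using pos_affine_root_pos by (force simp: regular_set_def)

text \<open>Induction on the number of positive affine roots negative at the point. It yields
  conjugacy into the chamber, generation of the group and the intertwining property of
  vectors.\<close>

lemma regular_set_induct [consumes 1, case_names chamber refl]:
  assumes "x \<in> regular_set \<Delta>"
    and "\<And>x. x \<in> fundamental_chamber \<Delta> \<Longrightarrow> P x"
    and "\<And>x a. x \<in> regular_set \<Delta> \<Longrightarrow> a \<in> simple_affine_roots \<Delta> \<Longrightarrow> P (affine_refl a x) \<Longrightarrow> P x"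
  shows "P x"
  using assms(1)
proof (induction "card {b \<in> pos_affine_roots \<Delta>. b x < 0}" arbitrary: x rule: less_induct)
  case less
  show ?case
  proof (cases "x \<in> fundamental_chamber \<Delta>")
    case False
    then obtain a where a: "a \<in> simple_affine_roots \<Delta>" "a x \<le> 0"
      by (auto simp: fundamental_chamber_def not_less)
    then have "a x < 0"
      using regular_affine_root_nonzero[OF less.prems simple_affine_root_mem[OF a(1)]] by simp
    moreover have "affine_refl a x \<in> regular_set \<Delta>"
      by (rule regular_set_image[OF affine_refl_mem[OF simple_affine_root_mem[OF a(1)]] less.prems])
    ultimately have "P (affine_refl a x)"
      by (intro less.hyps card_negative_roots_affine_refl[OF a(1)])
    then show ?thesis
      by (rule assms(3)[OF less.prems a(1)])
  qed (rule assms(2))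
qed

lemma regular_set_conjugate:
  assumes "x \<in> regular_set \<Delta>"
  shows "\<exists>w\<in>affine_weyl_group \<Delta>. w x \<in> fundamental_chamber \<Delta>"
  using assms
proof (induction rule: regular_set_induct)
  case (chamber x)
  then show ?case
    using id_affine_weyl_group by (intro bexI[of _ id]) simp_all
next
  case (refl x a)
  then obtain w where "w \<in> affine_weyl_group \<Delta>" "w (affine_refl a x) \<in> fundamental_chamber \<Delta>"
    by blast
  then show ?case
    using affine_weyl_group_comp affine_refl_mem[OF simple_affine_root_mem[OF refl(2)]]
    by (intro bexI[of _ "w \<circ> affine_refl a"]) auto
qed

text \<open>A root counted by the length would be positive at \<open>x\<close>, while the negative
  root it comes from would be negative at \<open>w x\<close>, and these two values coincide. One
  point of the chamber suffices.\<close>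

lemma length_zeroI:
  assumes "w \<in> affine_weyl_group \<Delta>" "x \<in> fundamental_chamber \<Delta>" "w x \<in> fundamental_chamber \<Delta>"
  shows "w \<in> length_zero \<Delta>"
proof -
  have "fun_act (inv w) c \<notin> pos_affine_roots \<Delta>" if c: "c \<in> neg_affine_roots \<Delta>" for c
  proof
    assume "fun_act (inv w) c \<in> pos_affine_roots \<Delta>"
    then have "0 < c (w x)"
      using pos_affine_root_pos[OF assms(2)] affine_weyl_group_bij[OF assms(1)]
      by (force simp: fun_act_def inv_inv_eq)
    moreover obtain b where "b \<in> pos_affine_roots \<Delta>" "c = (\<lambda>v. - b v)"
      using c unfolding neg_affine_roots_def by blast
    ultimately show False
      using pos_affine_root_pos[OF assms(3)] by force
  qed
  then have "pos_affine_roots \<Delta> \<inter> fun_act (inv w) ` neg_affine_roots \<Delta> = {}"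
    by blast
  then show ?thesis
    using assms(1) by (simp add: length_zero_def weyl_length_def)
qed

text \<open>The descent is applied to the image \<open>w x0\<close> of a base point: once it lies in
  the chamber, \<open>w\<close> has length zero.\<close>

lemma affine_weyl_group_induct [consumes 1, case_names length_zero refl]:
  assumes "w \<in> affine_weyl_group \<Delta>"
    and "\<And>w. w \<in> length_zero \<Delta> \<Longrightarrow> P w"
    and "\<And>a w. a \<in> simple_affine_roots \<Delta> \<Longrightarrow> w \<in> affine_weyl_group \<Delta> \<Longrightarrow> P w \<Longrightarrow> P (affine_refl a \<circ> w)"
  shows "P w"
proof -
  obtain x0 where x0: "x0 \<in> fundamental_chamber \<Delta>"
    using fundamental_chamber_nonempty by blast
  have "\<forall>w\<in>affine_weyl_group \<Delta>. w x0 = x \<longrightarrow> P w" if "x \<in> regular_set \<Delta>" for x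
    using that
  proof (induction rule: regular_set_induct)
    case (chamber x)
    then show ?case
      using length_zeroI[OF _ x0] assms(2) by blast
  next
    case (refl x a)
    have a: "a \<in> affine_roots \<Delta>"
      by (rule simple_affine_root_mem[OF refl(2)])
    show ?case
    proof (intro ballI impI)
      fix w assume w: "w \<in> affine_weyl_group \<Delta>" "w x0 = x"
      have mem: "affine_refl a \<circ> w \<in> affine_weyl_group \<Delta>"
        by (intro affine_weyl_group_comp affine_refl_mem a w)
      then have "P (affine_refl a \<circ> w)"
        using refl(3) w by simp
      \<comment> \<open>The same reflection applied twice gives back \<open>w\<close>.\<close>
      then have "P (affine_refl a \<circ> (affine_refl a \<circ> w))"
        by (rule assms(3)[OF refl(2) mem])
      then show "P w"
        by (simp add: comp_def affine_refl_affine_refl[OF a])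
    qed
  qed
  then show ?thesis
    using regular_set_image[OF assms(1)] fundamental_chamber_subset x0 assms(1) by blast
qed

section \<open>Topology of the chambers\<close>

lemma continuous_on_affine_root: "a \<in> affine_roots \<Delta> \<Longrightarrow> continuous_on S a"
  by (erule affine_rootE) (auto simp: affine_fun_def[abs_def] intro!: continuous_intros)

lemma open_fundamental_chamber: "open (fundamental_chamber \<Delta>)"
proof -
  have "finite (simple_affine_roots \<Delta>)"
    using finite_simple_roots by (simp add: simple_affine_roots_def)
  then have "open (\<Inter>a\<in>simple_affine_roots \<Delta>. {x. 0 < a x})"
    using continuous_on_affine_root[OF simple_affine_root_mem]
    by (intro open_INT ballI open_Collect_less) (auto intro!: continuous_intros)
  moreover have "fundamental_chamber \<Delta> = (\<Inter>a\<in>simple_affine_roots \<Delta>. {x. 0 < a x})"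
    by (auto simp: fundamental_chamber_def)
  ultimately show ?thesis by simp
qed

lemma convex_fundamental_chamber: "convex (fundamental_chamber \<Delta>)"
proof -
  have "fundamental_chamber \<Delta> = (\<Inter>\<beta>\<in>simple_roots \<Delta>. {v. 0 < blinfun_apply \<beta> v}) \<inter>
      {v. blinfun_apply (highest_root \<Delta>) v < 1}"
    by (auto simp: fundamental_chamber_iff)
  moreover have "convex {v. 0 < blinfun_apply \<beta> v}" for \<beta> :: "'v dual"
    using convex_linear_vimage[OF _ convex_real_interval(3)[of 0], of "blinfun_apply \<beta>"]
    by (simp add: vimage_def blinfun.bounded_linear_right bounded_linear.linear)
  moreover have "convex {v. blinfun_apply \<beta> v < 1}" for \<beta> :: "'v dual"
    using convex_linear_vimage[OF _ convex_real_interval(4)[of 1], of "blinfun_apply \<beta>"]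
    by (simp add: vimage_def blinfun.bounded_linear_right bounded_linear.linear)
  ultimately show ?thesis
    by (auto intro!: convex_Int convex_INT)
qed

text \<open>Infinitely many hyperplanes are removed. Grouping them by gradient leaves finitely many
  conditions "the root is not an integer at the point", each of them open.\<close>

lemma open_regular_set: "open (regular_set \<Delta>)"
proof -
  have "regular_set \<Delta> = (\<Inter>\<alpha>\<in>roots \<Delta>. blinfun_apply \<alpha> -` (- \<int>))"
  proof (intro equalityI subsetI)
    fix x assume x: "x \<in> regular_set \<Delta>"
    show "x \<in> (\<Inter>\<alpha>\<in>roots \<Delta>. blinfun_apply \<alpha> -` (- \<int>))"
    proof clarsimp
      fix \<alpha> assume \<alpha>: "\<alpha> \<in> roots \<Delta>" "blinfun_apply \<alpha> x \<in> \<int>"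
      then obtain n where n: "blinfun_apply \<alpha> x = real_of_int n"
        by (auto elim: Ints_cases)
      have "affine_fun \<alpha> (real_of_int (- n)) \<in> affine_roots \<Delta>"
        using \<alpha> unfolding affine_roots_def by blast
      from regular_affine_root_nonzero[OF x this] n show False
        by (simp add: affine_fun_def)
    qed
  next
    fix x assume x: "x \<in> (\<Inter>\<alpha>\<in>roots \<Delta>. blinfun_apply \<alpha> -` (- \<int>))"
    show "x \<in> regular_set \<Delta>"
    proof (rule regular_setI)
      fix a assume "a \<in> affine_roots \<Delta>"
      then obtain \<alpha> m where a: "\<alpha> \<in> roots \<Delta>" "a = affine_fun \<alpha> (real_of_int m)"
        by (rule affine_rootE)
      show "a x \<noteq> 0"
      proof
        assume "a x = 0"
        then have "blinfun_apply \<alpha> x = real_of_int (- m)"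
          by (simp add: a affine_fun_def)
        then have "blinfun_apply \<alpha> x \<in> \<int>"
          by (metis Ints_of_int)
        with x a show False by auto
      qed
    qed
  qed
  moreover have "open (\<Inter>\<alpha>\<in>roots \<Delta>. blinfun_apply \<alpha> -` (- \<int>))"
    using finite_roots
    by (intro open_INT ballI open_vimage) (auto intro!: continuous_intros simp: open_Compl)
  ultimately show ?thesis by simp
qed

lemma open_component: "C \<in> components (regular_set \<Delta>) \<Longrightarrow> open C"
  using open_components open_regular_set by blast

lemma affine_root_sign_component:
  assumes C: "C \<in> components (regular_set \<Delta>)" and "x \<in> C" "y \<in> C"
    and a: "a \<in> affine_roots \<Delta>" "0 < a x"
  shows "0 < a y"
proof (rule ccontr)
  assume "\<not> 0 < a y"
  then have y: "a y \<le> 0" by simp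
  have "connected (a ` C)"
    by (intro connected_continuous_image continuous_on_affine_root a in_components_connected[OF C])
  then have "0 \<in> a ` C"
    using connectedD_interval[of "a ` C" "a y" "a x" 0] y a assms(2,3) by auto
  then show False
    using regular_affine_root_nonzero a in_components_subset[OF C] by fastforce
qed

text \<open>An affine root composed with \<open>w\<close> is again an affine root, so its sign is
  constant on a component. With \<open>w = id\<close>, a component meeting the fundamental chamber
  is contained in it.\<close>

lemma component_conjugate:
  assumes C: "C \<in> components (regular_set \<Delta>)" and "x \<in> C" "y \<in> C"
    and w: "w \<in> affine_weyl_group \<Delta>" "w x \<in> fundamental_chamber \<Delta>"
  shows "w y \<in> fundamental_chamber \<Delta>"
  unfolding fundamental_chamber_def
proof clarify
  fix a assume a: "a \<in> simple_affine_roots \<Delta>"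
  then have "0 < (a \<circ> w) x"
    using w by (simp add: fundamental_chamber_def)
  then have "0 < (a \<circ> w) y"
    using affine_root_sign_component[OF C assms(2,3)] affine_root_comp[OF w(1)]
      simple_affine_root_mem[OF a] by blast
  then show "0 < a (w y)" by simp
qed

lemma fundamental_chamber_component:
  obtains C where "C \<in> components (regular_set \<Delta>)" "fundamental_chamber \<Delta> \<subseteq> C"
proof -
  obtain x where x: "x \<in> fundamental_chamber \<Delta>"
    using fundamental_chamber_nonempty by blast
  have "fundamental_chamber \<Delta> \<subseteq> connected_component_set (regular_set \<Delta>) x"
    by (intro connected_component_maximal x convex_connected convex_fundamental_chamber
        fundamental_chamber_subset)
  moreover have "connected_component_set (regular_set \<Delta>) x \<in> components (regular_set \<Delta>)"
    using x fundamental_chamber_subset by (auto intro: componentsI)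
  ultimately show ?thesis
    using that by blast
qed

end


section \<open>Generators of the algebra\<close>

lemma conv_group_elem: "conv (group_elem u) (group_elem w) = group_elem (u \<circ> w)"
  by (simp add: conv_def group_elem_def)

lemma sym_vec_Basis:
  assumes "b \<in> Basis"
  shows "sym_vec (b, 0) = Poly_Mapping.single (Poly_Mapping.single b 1) 1"
proof -
  have "sym_vec (b, 0) = (\<Sum>c\<in>Basis. if c = b then Poly_Mapping.single (Poly_Mapping.single b 1) 1 else 0)"
    unfolding sym_vec_def using assms
    by (intro sum.cong refl) (auto simp: inner_Basis one_complex.code zero_complex.code[symmetric])
  then show ?thesis
    using assms by simp
qed

lemma poly_mapping_eq_sum_single:
  "p = (\<Sum>x\<in>Poly_Mapping.keys p. Poly_Mapping.single x (Poly_Mapping.lookup p x))"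
proof (rule poly_mapping_eqI)
  fix y
  show "Poly_Mapping.lookup p y =
      Poly_Mapping.lookup (\<Sum>x\<in>Poly_Mapping.keys p. Poly_Mapping.single x (Poly_Mapping.lookup p x)) y"
    by (simp add: lookup_sum lookup_single when_def in_keys_iff)
qed

text \<open>Monomials are products of basis variables, and polynomials are linear combinations of
  monomials.\<close>

lemma sym_alg_generated:
  fixes A :: "('v::euclidean_space, 'a::ab_group_add) alg_data"
  assumes A: "unital_algebra A" "sym_subalgebra A"
    and one: "P (one A)" and add: "\<And>x y. P x \<Longrightarrow> P y \<Longrightarrow> P (x + y)"
    and scale: "\<And>c x. P x \<Longrightarrow> P (scale A c x)" and mult: "\<And>x y. P x \<Longrightarrow> P y \<Longrightarrow> P (mult A x y)"
    and gen: "\<And>b. b \<in> Basis \<Longrightarrow> P (of_sym A (sym_vec (b, 0)))"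
    and p: "p \<in> sym_alg"
  shows "P (of_sym A p)"
proof -
  interpret vector_space "scale A"
    using A by (simp add: unital_algebra_def)
  have P0: "P 0"
    using scale[OF one, of 0] by simp
  have of_add: "of_sym A (p + q) = of_sym A p + of_sym A q"
    and of_mult: "of_sym A (p * q) = mult A (of_sym A p) (of_sym A q)"
    if "p \<in> sym_alg" "q \<in> sym_alg" for p q
    using A that by (auto simp: sym_subalgebra_def)
  have of_scale: "of_sym A (Poly_Mapping.single 0 c * p) = scale A c (of_sym A p)"
    if "p \<in> sym_alg" for p c
    using A that by (auto simp: sym_subalgebra_def)
  have of_one: "of_sym A 1 = one A"
    using A by (auto simp: sym_subalgebra_def)
  \<comment> \<open>The support condition is carried along because \<open>of_sym\<close> is known to
    respect products only on \<open>sym_alg\<close>.\<close>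
  define Mon where "Mon n \<longleftrightarrow> Poly_Mapping.keys n \<subseteq> Basis \<and> P (of_sym A (Poly_Mapping.single n 1))"
    for n :: "'v \<Rightarrow>\<^sub>0 nat"
  have single_mem: "Poly_Mapping.single n c \<in> sym_alg" if "Poly_Mapping.keys n \<subseteq> Basis"
    for n :: "'v \<Rightarrow>\<^sub>0 nat" and c
    using that by (simp add: sym_alg_def)
  have Mon_zero: "Mon 0"
    using one of_one by (simp add: Mon_def)
  have Mon_add: "Mon (m + n)" if "Mon m" "Mon n" for m n
  proof -
    have "Poly_Mapping.single (m + n) (1::complex) = Poly_Mapping.single m 1 * Poly_Mapping.single n 1"
      by (simp add: mult_single)
    then have "P (of_sym A (Poly_Mapping.single (m + n) 1))"
      using that by (simp add: Mon_def of_mult single_mem mult)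
    then show ?thesis
      using that keys_add[of m n] unfolding Mon_def by blast
  qed
  have Mon_single: "Mon (Poly_Mapping.single b j)" if "b \<in> Basis" for b j
  proof (induction j)
    case 0
    then show ?case using Mon_zero by simp
  next
    case (Suc j)
    have "Mon (Poly_Mapping.single b 1)"
      using gen[OF that] that by (simp add: Mon_def sym_vec_Basis)
    then show ?case
      using Mon_add[OF Suc, of "Poly_Mapping.single b 1"] by (simp del: single_add flip: single_add)
  qed
  have Mon_sum: "Mon (\<Sum>b\<in>S. Poly_Mapping.single b (f b))" if "S \<subseteq> Basis" for S f
    using that by (induction S rule: infinite_finite_induct) (auto intro: Mon_zero Mon_add Mon_single)
  have Mon: "Mon n" if "Poly_Mapping.keys n \<subseteq> Basis" for n
    using Mon_sum[OF that, of "Poly_Mapping.lookup n"] by (simp flip: poly_mapping_eq_sum_single)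
  have single: "P (of_sym A (Poly_Mapping.single n c))" if n: "Poly_Mapping.keys n \<subseteq> Basis" for n c
  proof -
    have "Poly_Mapping.single n c = Poly_Mapping.single 0 c * Poly_Mapping.single n 1"
      by (simp add: mult_single)
    then show ?thesis
      using Mon[OF n] of_scale[OF single_mem[OF n]] scale by (simp add: Mon_def)
  qed
  have zero_mem: "0 \<in> (sym_alg :: 'v sym set)"
    by (simp add: sym_alg_def)
  have of_zero: "of_sym A 0 = 0"
    using of_scale[OF zero_mem, of 0] by simp
  have "(\<Sum>n\<in>S. Poly_Mapping.single n (f n)) \<in> sym_alg \<and>
      P (of_sym A (\<Sum>n\<in>S. Poly_Mapping.single n (f n)))"
    if "finite S" "\<And>n. n \<in> S \<Longrightarrow> Poly_Mapping.keys n \<subseteq> Basis" for S f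
    using that
  proof (induction S rule: finite_induct)
    case empty
    then show ?case using P0 of_zero zero_mem by simp
  next
    case (insert n S)
    let ?s = "\<Sum>n\<in>S. Poly_Mapping.single n (f n)"
    have IH: "?s \<in> sym_alg" "P (of_sym A ?s)"
      using insert by auto
    have n: "Poly_Mapping.keys n \<subseteq> Basis"
      using insert.prems by simp
    have "Poly_Mapping.single n (f n) + ?s \<in> sym_alg"
      using IH(1) single_mem[OF n, of "f n"] keys_add[of "Poly_Mapping.single n (f n)" ?s]
      unfolding sym_alg_def by blast
    moreover have "P (of_sym A (Poly_Mapping.single n (f n) + ?s))"
      by (simp add: of_add[OF single_mem[OF n] IH(1)] add single[OF n] IH(2))
    ultimately show ?case
      using insert.hyps by simp
  qed
  from this[of "Poly_Mapping.keys p" "Poly_Mapping.lookup p"] show ?thesis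
    using p by (simp add: sym_alg_def flip: poly_mapping_eq_sum_single)
qed

text \<open>Surjectivity of \<open>mult_map\<close> writes every element as a finite sum of products
  of a polynomial and a group element.\<close>

lemma hecke_algebra_generated:
  fixes A :: "('v::euclidean_space, 'a::ab_group_add) alg_data"
  assumes A: "hecke_algebra \<Delta> k A"
    and one: "P (one A)" and add: "\<And>x y. P x \<Longrightarrow> P y \<Longrightarrow> P (x + y)"
    and scale: "\<And>c x. P x \<Longrightarrow> P (scale A c x)" and mult: "\<And>x y. P x \<Longrightarrow> P y \<Longrightarrow> P (mult A x y)"
    and sym: "\<And>b. b \<in> Basis \<Longrightarrow> P (of_sym A (sym_vec (b, 0)))"
    and grp: "\<And>w. w \<in> affine_weyl_group \<Delta> \<Longrightarrow> P (of_grp A (group_elem w))"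
  shows "P x"
proof -
  have alg: "unital_algebra A" "sym_subalgebra A" and bij: "bij_betw (mult_map A) (sym_tensor_grp \<Delta>) UNIV"
    using A by (auto simp: hecke_algebra_def)
  interpret vector_space "scale A"
    using alg by (simp add: unital_algebra_def)
  have P0: "P 0"
    using scale[OF one, of 0] by simp
  obtain p where p: "p \<in> sym_tensor_grp \<Delta>" "x = mult_map A p"
    using bij unfolding bij_betw_def by auto
  have "P (mult A (of_sym A (Poly_Mapping.lookup p w)) (of_grp A (group_elem w)))"
    if "w \<in> Poly_Mapping.keys p" for w
  proof (rule mult)
    show "P (of_sym A (Poly_Mapping.lookup p w))"
      by (rule sym_alg_generated[where P = P, OF alg one])
        (use p(1) add scale mult sym in \<open>auto simp: sym_tensor_grp_def\<close>)
    show "P (of_grp A (group_elem w))"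
      by (rule grp) (use p(1) that in \<open>auto simp: sym_tensor_grp_def\<close>)
  qed
  then have "P (\<Sum>w\<in>S. mult A (of_sym A (Poly_Mapping.lookup p w)) (of_grp A (group_elem w)))"
    if "S \<subseteq> Poly_Mapping.keys p" for S
    using that by (induction S rule: infinite_finite_induct) (auto intro: P0 add)
  then show ?thesis
    unfolding p(2) mult_map_def by blast
qed

lemma hecke_of_grp_comp:
  assumes "hecke_algebra \<Delta> k A" "u \<in> affine_weyl_group \<Delta>" "w \<in> affine_weyl_group \<Delta>"
  shows "of_grp A (group_elem (u \<circ> w)) = mult A (of_grp A (group_elem u)) (of_grp A (group_elem w))"
proof -
  have "group_elem u \<in> group_alg \<Delta>" "group_elem w \<in> group_alg \<Delta>"
    using assms by (simp_all add: group_alg_def group_elem_def)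
  then have "of_grp A (conv (group_elem u) (group_elem w)) =
      mult A (of_grp A (group_elem u)) (of_grp A (group_elem w))"
    using assms(1) by (simp add: hecke_algebra_def grp_subalgebra_def)
  then show ?thesis
    by (simp add: conv_group_elem)
qed

text \<open>The elements whose action commutes with \<open>T\<close> are closed under all algebra
  operations, so generators suffice. This serves for both functors on morphisms and for the
  propagation map.\<close>

lemma alg_module_homI:
  assumes A: "hecke_algebra \<Delta> k A"
    and E: "alg_module A s E \<rho>" and E': "alg_module A s' E' \<rho>'" and T: "linear_between s E s' E' T"
    and sym: "\<And>b e. b \<in> Basis \<Longrightarrow> e \<in> E \<Longrightarrow>
      T (\<rho> (of_sym A (sym_vec (b, 0))) e) = \<rho>' (of_sym A (sym_vec (b, 0))) (T e)"
    and grp: "\<And>w e. w \<in> affine_weyl_group \<Delta> \<Longrightarrow> e \<in> E \<Longrightarrow>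
      T (\<rho> (of_grp A (group_elem w)) e) = \<rho>' (of_grp A (group_elem w)) (T e)"
  shows "alg_module_hom s E \<rho> s' E' \<rho>' T"
proof -
  have E_closed: "\<rho> x e \<in> E"
    and E_add: "\<rho> (x + y) e = \<rho> x e + \<rho> y e" and E_scale: "\<rho> (scale A c x) e = s c (\<rho> x e)"
    and E_mult: "\<rho> (mult A x y) e = \<rho> x (\<rho> y e)" and E_one: "\<rho> (one A) e = e"
    if "e \<in> E" for x y c e
    using E that unfolding alg_module_def by blast+
  have E'_add: "\<rho>' (x + y) e = \<rho>' x e + \<rho>' y e" and E'_scale: "\<rho>' (scale A c x) e = s' c (\<rho>' x e)"
    and E'_mult: "\<rho>' (mult A x y) e = \<rho>' x (\<rho>' y e)" and E'_one: "\<rho>' (one A) e = e"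
    if "e \<in> E'" for x y c e
    using E' that unfolding alg_module_def by blast+
  have T_closed: "T e \<in> E'" and T_add: "e' \<in> E \<Longrightarrow> T (e + e') = T e + T e'"
    and T_scale: "T (s c e) = s' c (T e)" if "e \<in> E" for c e e'
    using T that unfolding linear_between_def by blast+
  have "\<forall>e\<in>E. T (\<rho> x e) = \<rho>' x (T e)" for x
  proof (rule hecke_algebra_generated[OF A, where P = "\<lambda>x. \<forall>e\<in>E. T (\<rho> x e) = \<rho>' x (T e)"];
      (intro ballI)?)
    fix x y e
    assume *: "\<forall>e\<in>E. T (\<rho> x e) = \<rho>' x (T e)" "\<forall>e\<in>E. T (\<rho> y e) = \<rho>' y (T e)" "e \<in> E"
    then show "T (\<rho> (x + y) e) = \<rho>' (x + y) (T e)"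
      by (simp only: E_add E'_add E_closed T_add T_closed)
    show "T (\<rho> (mult A x y) e) = \<rho>' (mult A x y) (T e)"
      using * by (simp only: E_mult E'_mult E_closed T_closed)
  next
    fix c x e assume "\<forall>e\<in>E. T (\<rho> x e) = \<rho>' x (T e)" "e \<in> E"
    then show "T (\<rho> (scale A c x) e) = \<rho>' (scale A c x) (T e)"
      by (simp only: E_scale E'_scale E_closed T_scale T_closed)
  qed (auto simp only: sym grp E_one E'_one T_closed)
  with T show ?thesis
    unfolding alg_module_hom_def by blast
qed

section \<open>Representations of the affine Weyl group\<close>

locale weyl_representation = affine_weyl \<Delta> for \<Delta> :: "'v::euclidean_space root_data" +
  fixes M :: "('v, 'm::ab_group_add) weyl_rep"
  assumes weyl_module: "weyl_module \<Delta> M"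
begin

lemma vector_space_mscale: "vector_space (mscale M)"
  using weyl_module by (simp add: weyl_module_def)

lemma mact_linear: "w \<in> affine_weyl_group \<Delta> \<Longrightarrow> Vector_Spaces.linear (mscale M) (mscale M) (mact M w)"
  using weyl_module by (simp add: weyl_module_def)

lemma mact_id: "mact M id m = m"
  using weyl_module by (simp add: weyl_module_def)

lemma mact_mact: "u \<in> affine_weyl_group \<Delta> \<Longrightarrow> w \<in> affine_weyl_group \<Delta> \<Longrightarrow>
    mact M u (mact M w m) = mact M (u \<circ> w) m"
  using weyl_module by (simp add: weyl_module_def)

lemma mact_inv: "w \<in> affine_weyl_group \<Delta> \<Longrightarrow> mact M (inv w) (mact M w m) = m"
  by (simp add: mact_mact inv_affine_weyl_group affine_weyl_group_bij bij_is_inj mact_id)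

lemma mact_zero: "w \<in> affine_weyl_group \<Delta> \<Longrightarrow> mact M w 0 = 0"
  and mact_add: "w \<in> affine_weyl_group \<Delta> \<Longrightarrow> mact M w (m + n) = mact M w m + mact M w n"
  and mact_scale: "w \<in> affine_weyl_group \<Delta> \<Longrightarrow> mact M w (mscale M c m) = mscale M c (mact M w m)"
proof -
  assume w: "w \<in> affine_weyl_group \<Delta>"
  interpret Vector_Spaces.linear "mscale M" "mscale M" "mact M w"
    by (rule mact_linear[OF w])
  show "mact M w 0 = 0" "mact M w (m + n) = mact M w m + mact M w n"
    "mact M w (mscale M c m) = mscale M c (mact M w m)"
    by (simp_all add: zero add scale)
qed

end


section \<open>The propagation map\<close>

text \<open>\<open>Q\<close> and \<open>D\<close> enter as given actions, which supplies closure of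
  the two function spaces under them.\<close>

locale hecke_modules = weyl_representation \<Delta> M
  for \<Delta> :: "'v::euclidean_space root_data" and M :: "('v, 'm::ab_group_add) weyl_rep" +
  fixes k :: "('v \<Rightarrow> real) \<Rightarrow> complex" and A :: "('v, 'a::ab_group_add) alg_data"
    and Q D :: "'a \<Rightarrow> ('v \<Rightarrow> 'm) \<Rightarrow> 'v \<Rightarrow> 'm"
  assumes hecke: "hecke_algebra \<Delta> k A"
    and ir: "ir_module \<Delta> k A M Q" and dr: "dr_module \<Delta> k A M D"
begin

abbreviation "grp w \<equiv> of_grp A (group_elem w)"
abbreviation "svec v \<equiv> of_sym A (sym_vec (v, 0))"

lemma Q_alg_module: "alg_module A (fscale M) (analytic_tensor M) Q"
  using ir by (simp add: ir_module_def)

lemma D_alg_module: "alg_module A (fscale M) (chamberwise_analytic \<Delta> M) D"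
  using dr by (simp add: dr_module_def)

lemma
  assumes "f \<in> analytic_tensor M"
  shows Q_closed: "Q x f \<in> analytic_tensor M"
    and Q_plus: "Q (x + y) f = Q x f + Q y f"
    and Q_scale: "Q (scale A c x) f = fscale M c (Q x f)"
    and Q_mult: "Q (mult A x y) f = Q x (Q y f)"
    and Q_one: "Q (one A) f = f"
    and Q_fscale: "Q x (fscale M c f) = fscale M c (Q x f)"
    and Q_add: "g \<in> analytic_tensor M \<Longrightarrow> Q x (f + g) = Q x f + Q x g"
  using Q_alg_module assms by (simp_all add: alg_module_def)

lemma
  assumes "f \<in> chamberwise_analytic \<Delta> M"
  shows D_closed: "D x f \<in> chamberwise_analytic \<Delta> M"
    and D_plus: "D (x + y) f = D x f + D y f"
    and D_scale: "D (scale A c x) f = fscale M c (D x f)"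
    and D_mult: "D (mult A x y) f = D x (D y f)"
    and D_one: "D (one A) f = f"
  using D_alg_module assms by (simp_all add: alg_module_def)

lemma fscale_vector_space: "vector_space (fscale M)"
  and analytic_subspace: "module.subspace (fscale M) (analytic_tensor M)"
  using Q_alg_module by (simp_all add: alg_module_def)

lemma zero_mem_analytic: "0 \<in> analytic_tensor M"
proof -
  interpret vector_space "fscale M" by (rule fscale_vector_space)
  show ?thesis by (rule subspace_0[OF analytic_subspace])
qed

lemma fscale_mem_analytic: "f \<in> analytic_tensor M \<Longrightarrow> fscale M c f \<in> analytic_tensor M"
  and add_mem_analytic: "f \<in> analytic_tensor M \<Longrightarrow> g \<in> analytic_tensor M \<Longrightarrow> f + g \<in> analytic_tensor M"
proof -
  interpret vector_space "fscale M" by (rule fscale_vector_space)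
  show "f \<in> analytic_tensor M \<Longrightarrow> fscale M c f \<in> analytic_tensor M"
    by (rule subspace_scale[OF analytic_subspace])
  show "f \<in> analytic_tensor M \<Longrightarrow> g \<in> analytic_tensor M \<Longrightarrow> f + g \<in> analytic_tensor M"
    by (rule subspace_add[OF analytic_subspace])
qed

lemma Q_vec: "f \<in> analytic_tensor M \<Longrightarrow> Q (svec v) f = tensor_map M M (dir_deriv v) id f"
  and Q_simple: "f \<in> analytic_tensor M \<Longrightarrow> a \<in> simple_affine_roots \<Delta> \<Longrightarrow> Q (grp (affine_refl a)) f =
     tensor_map M M (fun_act (affine_refl a)) (mact M (affine_refl a)) f -
     fscale M (k a) (tensor_map M M (integral_op a) id f)"
  and Q_length_zero_map: "f \<in> analytic_tensor M \<Longrightarrow> \<omega> \<in> length_zero \<Delta> \<Longrightarrow>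
     Q (grp \<omega>) f = tensor_map M M (fun_act \<omega>) (mact M \<omega>) f"
  using ir unfolding ir_module_def by blast+

lemma length_zero_mem: "\<omega> \<in> length_zero \<Delta> \<Longrightarrow> \<omega> \<in> affine_weyl_group \<Delta>"
  by (simp add: length_zero_def)

lemma Q_length_zero:
  assumes "f \<in> analytic_tensor M" "\<omega> \<in> length_zero \<Delta>"
  shows "Q (grp \<omega>) f = (\<lambda>x. mact M \<omega> (f (inv \<omega> x)))"
  using assms mact_linear[OF length_zero_mem[OF assms(2)]]
  by (simp add: Q_length_zero_map tensor_map_fun_act_eq[OF vector_space_mscale])

lemma Q_comp: "u \<in> affine_weyl_group \<Delta> \<Longrightarrow> w \<in> affine_weyl_group \<Delta> \<Longrightarrow> f \<in> analytic_tensor M \<Longrightarrow>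
    Q (grp (u \<circ> w)) f = Q (grp u) (Q (grp w) f)"
  by (simp add: hecke_of_grp_comp[OF hecke] Q_mult)

lemma Q_id: "f \<in> analytic_tensor M \<Longrightarrow> Q (grp id) f = f"
  using hecke by (simp add: hecke_algebra_def grp_subalgebra_def Q_one)

lemma D_grp: "f \<in> chamberwise_analytic \<Delta> M \<Longrightarrow> w \<in> affine_weyl_group \<Delta> \<Longrightarrow> D (grp w) f = dot_act M w f"
  and D_vec: "f \<in> chamberwise_analytic \<Delta> M \<Longrightarrow> D (svec v) f = dunkl_op \<Delta> k M v f"
  using dr unfolding dr_module_def by blast+

text \<open>The scalar stays unnamed: it contributes the same multiple of the propagated function on
  both sides of the comparison in \<open>propagate_vec\<close>.\<close>

lemma simple_refl_vec:
  assumes "a \<in> simple_affine_roots \<Delta>"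
  obtains c where "mult A (grp (affine_refl a)) (svec v) =
    mult A (svec (refl (grad a) v)) (grp (affine_refl a)) + scale A c (one A)"
proof -
  \<comment> \<open>The reflected vector is still real, since its imaginary part is the reflection
    of 0.\<close>
  have "refl (grad a) 0 = 0"
    by (simp add: refl_def)
  moreover have "mult A (grp (affine_refl a)) (svec v) -
        mult A (of_sym A (sym_vec (cplx_map (refl (grad a)) (v, 0)))) (grp (affine_refl a)) =
      scale A (- (k a * cplx_fun (grad a) (v, 0))) (one A)"
    using hecke assms unfolding hecke_algebra_def by blast
  ultimately have "mult A (grp (affine_refl a)) (svec v) =
    mult A (svec (refl (grad a) v)) (grp (affine_refl a)) +
      scale A (- (k a * cplx_fun (grad a) (v, 0))) (one A)"
    by (simp add: cplx_map_def diff_eq_eq add.commute)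
  then show ?thesis
    by (rule that)
qed

text \<open>The default 0 off the regular set follows the convention of
  \<open>chamberwise_analytic\<close>; the one for arguments that are not analytic tensors follows
  the normalization in \<open>is_propagation\<close>.\<close>

definition propagate :: "('v \<Rightarrow> 'm) \<Rightarrow> 'v \<Rightarrow> 'm" where
  "propagate f x =
     (if f \<in> analytic_tensor M \<and> x \<in> regular_set \<Delta>
      then let w = SOME w. w \<in> affine_weyl_group \<Delta> \<and> w x \<in> fundamental_chamber \<Delta>
           in mact M (inv w) (Q (grp w) f (w x))
      else 0)"

lemma propagate_outside: "x \<notin> regular_set \<Delta> \<Longrightarrow> propagate f x = 0"
  and propagate_not_analytic: "f \<notin> analytic_tensor M \<Longrightarrow> propagate f = 0"
  by (auto simp: propagate_def)

text \<open>Two elements carrying \<open>x\<close> into the fundamental chamber differ by an element of length zero,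
  on which \<open>Q\<close> is the diagonal action; hence the choice made in \<open>propagate\<close> is irrelevant.\<close>

lemma propagate_eq:
  assumes f: "f \<in> analytic_tensor M"
    and w: "w \<in> affine_weyl_group \<Delta>" "w x \<in> fundamental_chamber \<Delta>"
  shows "propagate f x = mact M (inv w) (Q (grp w) f (w x))"
proof -
  have "inv w (w x) \<in> regular_set \<Delta>"
    by (rule regular_set_image[OF inv_affine_weyl_group[OF w(1)]])
      (use w(2) fundamental_chamber_subset in blast)
  then have x: "x \<in> regular_set \<Delta>"
    using inv_apply[OF w(1)] by simp
  define u where "u = (SOME w. w \<in> affine_weyl_group \<Delta> \<and> w x \<in> fundamental_chamber \<Delta>)"
  have u: "u \<in> affine_weyl_group \<Delta>" "u x \<in> fundamental_chamber \<Delta>"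
    using someI[of "\<lambda>w. w \<in> affine_weyl_group \<Delta> \<and> w x \<in> fundamental_chamber \<Delta>" w] w
    by (auto simp: u_def)
  define \<omega> where "\<omega> = u \<circ> inv w"
  have \<omega>: "\<omega> \<in> affine_weyl_group \<Delta>"
    unfolding \<omega>_def by (intro affine_weyl_group_comp inv_affine_weyl_group u w)
  have \<omega>_w: "\<omega> \<circ> w = u"
    by (simp add: \<omega>_def fun_eq_iff inv_apply[OF w(1)])
  have \<omega>_wx: "\<omega> (w x) = u x"
    by (simp add: \<omega>_def inv_apply[OF w(1)])
  have len: "\<omega> \<in> length_zero \<Delta>"
    by (rule length_zeroI[OF \<omega> w(2)]) (simp add: \<omega>_wx u)
  have Qw: "Q (grp w) f \<in> analytic_tensor M"
    by (rule Q_closed[OF f])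
  have "inv \<omega> (u x) = w x"
    unfolding \<omega>_wx[symmetric] by (rule inv_apply[OF \<omega>])
  then have "Q (grp u) f (u x) = mact M \<omega> (Q (grp w) f (w x))"
    unfolding \<omega>_w[symmetric] Q_comp[OF \<omega> w(1) f] Q_length_zero[OF Qw len] by (simp add: \<omega>_wx)
  moreover have "inv u \<circ> \<omega> = inv w"
    by (simp add: \<omega>_def fun_eq_iff inv_apply[OF u(1)])
  ultimately have "mact M (inv u) (Q (grp u) f (u x)) = mact M (inv w) (Q (grp w) f (w x))"
    by (simp add: mact_mact inv_affine_weyl_group u(1) \<omega>)
  then show ?thesis
    using f x by (simp add: propagate_def u_def)
qed

lemma propagate_chamber:
  "f \<in> analytic_tensor M \<Longrightarrow> x \<in> fundamental_chamber \<Delta> \<Longrightarrow> propagate f x = f x"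
  using propagate_eq[of f id x] by (simp add: id_affine_weyl_group Q_id mact_id)

text \<open>That the function is analytic on each chamber follows from the closure of
  \<open>chamberwise_analytic\<close> under the dot action, applied to the extension by zero of \<open>Q w f\<close> from
  the fundamental chamber.\<close>

lemma propagate_mem:
  assumes f: "f \<in> analytic_tensor M"
  shows "propagate f \<in> chamberwise_analytic \<Delta> M"
  unfolding chamberwise_analytic_def mem_Collect_eq
proof (intro conjI ballI allI impI)
  fix C assume C: "C \<in> components (regular_set \<Delta>)"
  obtain x where x: "x \<in> C" "x \<in> regular_set \<Delta>"
    using C in_components_nonempty in_components_subset by fastforce
  obtain w where w: "w \<in> affine_weyl_group \<Delta>" "w x \<in> fundamental_chamber \<Delta>"
    using regular_set_conjugate[OF x(2)] by blast
  define g where "g = Q (grp w) f"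
  define h0 where "h0 y = (if y \<in> fundamental_chamber \<Delta> then g y else 0)" for y
  have g: "g \<in> analytic_tensor M"
    unfolding g_def by (rule Q_closed[OF f])
  have "\<exists>h\<in>analytic_tensor M. \<forall>y\<in>K. h0 y = h y" if K: "K \<in> components (regular_set \<Delta>)" for K
  proof (cases "\<exists>z\<in>K. z \<in> fundamental_chamber \<Delta>")
    case True
    then have "K \<subseteq> fundamental_chamber \<Delta>"
      using component_conjugate[OF K _ _ id_affine_weyl_group] by auto
    then show ?thesis
      using g by (intro bexI[of _ g]) (auto simp: h0_def)
  next
    case False
    then show ?thesis
      using zero_mem_analytic by (intro bexI[of _ 0]) (auto simp: h0_def)
  qed
  then have h0: "h0 \<in> chamberwise_analytic \<Delta> M"
    unfolding chamberwise_analytic_def using fundamental_chamber_subset by (auto simp: h0_def)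
  \<comment> \<open>Closure under the dot action is obtained from \<open>D\<close>, which acts on
    \<open>chamberwise_analytic\<close> and restricts to the dot action on group elements.\<close>
  have "dot_act M (inv w) h0 \<in> chamberwise_analytic \<Delta> M"
    unfolding D_grp[OF h0 inv_affine_weyl_group[OF w(1)], symmetric] by (rule D_closed[OF h0])
  then obtain h where h: "h \<in> analytic_tensor M" "\<And>y. y \<in> C \<Longrightarrow> dot_act M (inv w) h0 y = h y"
    using C unfolding chamberwise_analytic_def by auto
  have "propagate f y = h y" if "y \<in> C" for y
  proof -
    have wy: "w y \<in> fundamental_chamber \<Delta>"
      by (rule component_conjugate[OF C x(1) that w])
    have "inv (inv w) y = w y"
      using affine_weyl_group_bij[OF w(1)] by (simp add: inv_inv_eq)
    then have "dot_act M (inv w) h0 y = propagate f y"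
      by (simp add: dot_act_def h0_def wy g_def propagate_eq[OF f w(1) wy])
    then show ?thesis
      using h(2)[OF that] by simp
  qed
  then show "\<exists>h\<in>analytic_tensor M. \<forall>y\<in>C. propagate f y = h y"
    using h(1) by blast
qed (rule propagate_outside)

lemma propagate_linear:
  "linear_between (fscale M) (analytic_tensor M) (fscale M) (chamberwise_analytic \<Delta> M) propagate"
  unfolding linear_between_def
proof (intro conjI ballI allI)
  fix f assume f: "f \<in> analytic_tensor M"
  show "propagate f \<in> chamberwise_analytic \<Delta> M"
    by (rule propagate_mem[OF f])
  fix c
  show "propagate (fscale M c f) = fscale M c (propagate f)"
  proof
    fix x
    interpret vector_space "mscale M" by (rule vector_space_mscale)
    show "propagate (fscale M c f) x = fscale M c (propagate f) x"
    proof (cases "x \<in> regular_set \<Delta>")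
      case True
      then obtain w where w: "w \<in> affine_weyl_group \<Delta>" "w x \<in> fundamental_chamber \<Delta>"
        using regular_set_conjugate by blast
      then show ?thesis
        by (simp add: propagate_eq[OF f w] propagate_eq[OF fscale_mem_analytic[OF f] w] Q_fscale[OF f]
            fscale_def mact_scale inv_affine_weyl_group)
    qed (simp add: propagate_outside fscale_def)
  qed
  fix g assume g: "g \<in> analytic_tensor M"
  show "propagate (f + g) = propagate f + propagate g"
  proof
    fix x
    note fg = propagate_eq[OF add_mem_analytic[OF f g]]
    show "propagate (f + g) x = (propagate f + propagate g) x"
    proof (cases "x \<in> regular_set \<Delta>")
      case True
      then obtain w where w: "w \<in> affine_weyl_group \<Delta>" "w x \<in> fundamental_chamber \<Delta>"
        using regular_set_conjugate by blast
      then show ?thesis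
        by (simp add: propagate_eq[OF f w] propagate_eq[OF g w] fg[OF w] Q_add[OF f g]
            mact_add inv_affine_weyl_group)
    qed (simp add: propagate_outside)
  qed
qed

text \<open>If \<open>u\<close> carries \<open>x\<close> into the chamber, then
  \<open>u \<circ> w\<close> carries the preimage of \<open>x\<close> under \<open>w\<close> to the
  same point \<open>u x\<close>; both sides become the value of
  \<open>Q (grp (u \<circ> w)) f\<close> there, moved back by the inverse of
  \<open>u\<close>.\<close>

lemma propagate_equivariant:
  assumes f: "f \<in> analytic_tensor M" and w: "w \<in> affine_weyl_group \<Delta>"
  shows "propagate (Q (grp w) f) = dot_act M w (propagate f)"
proof
  fix x
  have Qf: "Q (grp w) f \<in> analytic_tensor M"
    by (rule Q_closed[OF f])
  show "propagate (Q (grp w) f) x = dot_act M w (propagate f) x"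
  proof (cases "x \<in> regular_set \<Delta>")
    case True
    then obtain u where u: "u \<in> affine_weyl_group \<Delta>" "u x \<in> fundamental_chamber \<Delta>"
      using regular_set_conjugate by blast
    have uw: "u \<circ> w \<in> affine_weyl_group \<Delta>"
      by (rule affine_weyl_group_comp[OF u(1) w])
    have eq: "(u \<circ> w) (inv w x) = u x"
      by (simp add: apply_inv[OF w])
    have "w \<circ> inv (u \<circ> w) = inv u"
      using affine_weyl_group_bij[OF u(1)] affine_weyl_group_bij[OF w]
      by (simp add: o_inv_distrib fun_eq_iff apply_inv[OF w])
    then have "dot_act M w (propagate f) x = mact M (inv u) (Q (grp (u \<circ> w)) f (u x))"
      using propagate_eq[OF f uw, of "inv w x"] u(2)
      by (simp only: eq dot_act_def mact_mact[OF w inv_affine_weyl_group[OF uw]])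
    then show ?thesis
      by (simp add: propagate_eq[OF Qf u] Q_comp[OF u(1) w f])
  next
    case False
    have "inv w x \<notin> regular_set \<Delta>"
      using regular_set_image[OF w, of "inv w x"] False by (auto simp: apply_inv[OF w])
    with False show ?thesis
      by (simp add: propagate_outside dot_act_def mact_zero[OF w])
  qed
qed

lemma is_propagation_propagate: "is_propagation \<Delta> A M Q propagate"
  unfolding is_propagation_def
  using propagate_linear propagate_equivariant propagate_not_analytic
    chamber_ext_eqI[OF vector_space_mscale _ open_fundamental_chamber fundamental_chamber_nonempty]
    propagate_chamber
  by blast

lemma is_propagation_unique:
  assumes T: "is_propagation \<Delta> A M Q T"
  shows "T = propagate"
proof (intro ext)
  fix f x
  \<comment> \<open>The condition on the fundamental chamber speaks of a definite description; it
    yields values only after an analytic extension \<open>h\<close> has been exhibited on the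
    component containing the chamber.\<close>
  have chamber: "T g y = g y" if g: "g \<in> analytic_tensor M" and y: "y \<in> fundamental_chamber \<Delta>" for g y
  proof -
    have "T g \<in> chamberwise_analytic \<Delta> M"
      using T g by (simp add: is_propagation_def linear_between_def)
    moreover obtain C where C: "C \<in> components (regular_set \<Delta>)" "fundamental_chamber \<Delta> \<subseteq> C"
      by (rule fundamental_chamber_component)
    ultimately obtain h where h: "h \<in> analytic_tensor M" "\<forall>y\<in>C. T g y = h y"
      unfolding chamberwise_analytic_def by blast
    have "chamber_ext M (fundamental_chamber \<Delta>) (T g) = h"
      using h C(2) by (intro chamber_ext_eqI[OF vector_space_mscale h(1) open_fundamental_chamber
          fundamental_chamber_nonempty]) auto
    then have "h = g"
      using T g by (simp add: is_propagation_def)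
    with h C(2) y show ?thesis by blast
  qed
  show "T f x = propagate f x"
  proof (cases "f \<in> analytic_tensor M \<and> x \<in> regular_set \<Delta>")
    case True
    then have f: "f \<in> analytic_tensor M" by simp
    obtain w where w: "w \<in> affine_weyl_group \<Delta>" "w x \<in> fundamental_chamber \<Delta>"
      using True regular_set_conjugate by blast
    have "T (Q (grp w) f) = dot_act M w (T f)"
      using T f w by (simp add: is_propagation_def)
    moreover have "T (Q (grp w) f) (w x) = Q (grp w) f (w x)"
      by (rule chamber[OF Q_closed[OF f] w(2)])
    ultimately have "Q (grp w) f (w x) = mact M w (T f x)"
      by (simp add: dot_act_def inv_apply[OF w(1)])
    then show ?thesis
      by (simp add: propagate_eq[OF f w] mact_inv[OF w(1)])
  next
    case False
    moreover have "T f x = 0" if "x \<notin> regular_set \<Delta>" "f \<in> analytic_tensor M"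
    proof -
      have "T f \<in> chamberwise_analytic \<Delta> M"
        using T that by (simp add: is_propagation_def linear_between_def)
      with that show ?thesis
        by (simp add: chamberwise_analytic_def)
    qed
    moreover have "T f x = 0" if "f \<notin> analytic_tensor M"
      using T that by (simp add: is_propagation_def)
    ultimately show ?thesis
      by (auto simp: propagate_def)
  qed
qed

lemma propagation_eq: "propagation \<Delta> A M Q = propagate"
  unfolding propagation_def
  by (rule the_equality) (rule is_propagation_propagate, rule is_propagation_unique)

section \<open>The propagation map intertwines the vectors\<close>

lemma connected_component_mem:
  "x \<in> regular_set \<Delta> \<Longrightarrow> connected_component_set (regular_set \<Delta>) x \<in> components (regular_set \<Delta>)"
  and connected_component_self: "x \<in> regular_set \<Delta> \<Longrightarrow> x \<in> connected_component_set (regular_set \<Delta>) x"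
  by (auto intro: componentsI)

text \<open>All \<open>v\<close> and \<open>f\<close> are quantified inside the induction: the step
  at \<open>x\<close> uses the identity at the reflected point for the reflected vector and for
  \<open>Q (grp s) f\<close>.\<close>

lemma propagate_vec:
  assumes x: "x \<in> regular_set \<Delta>"
  shows "\<forall>v. \<forall>f\<in>analytic_tensor M. propagate (Q (svec v) f) x = D (svec v) (propagate f) x"
  using x
proof (induction rule: regular_set_induct)
  case (chamber x)
  have x: "x \<in> regular_set \<Delta>"
    using chamber fundamental_chamber_subset by blast
  define C where "C = connected_component_set (regular_set \<Delta>) x"
  have C: "C \<in> components (regular_set \<Delta>)" "x \<in> C"
    using connected_component_mem[OF x] connected_component_self[OF x] by (auto simp: C_def)
  have C_sub: "y \<in> fundamental_chamber \<Delta>" if "y \<in> C" for y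
    using component_conjugate[OF C that id_affine_weyl_group] chamber by simp
  have none: "{a \<in> pos_affine_roots \<Delta>. neg_indicator a x \<noteq> 0} = {}"
    using pos_affine_root_pos[OF chamber] by (force simp: neg_indicator_def)
  show ?case
  proof (intro allI ballI)
    fix v f assume f: "f \<in> analytic_tensor M"
    have "chamber_ext M C (propagate f) = f"
      using C C_sub by (intro chamber_ext_eqI[OF vector_space_mscale f open_component[OF C(1)]])
        (auto intro: propagate_chamber[OF f])
    then have "dunkl_op \<Delta> k M v (propagate f) x = tensor_map M M (dir_deriv v) id f x"
      using x by (simp add: dunkl_op_def none C_def)
    then show "propagate (Q (svec v) f) x = D (svec v) (propagate f) x"
      unfolding D_vec[OF propagate_mem[OF f]] propagate_chamber[OF Q_closed[OF f] chamber]
      by (simp only: Q_vec[OF f])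
  qed
next
  case (refl x a)
  define s where "s = affine_refl a"
  have s: "s \<in> affine_weyl_group \<Delta>"
    unfolding s_def by (rule affine_refl_mem[OF simple_affine_root_mem[OF refl(2)]])
  show ?case
  proof (intro allI ballI)
    fix v f assume f: "f \<in> analytic_tensor M"
    obtain c where c: "mult A (grp s) (svec v) =
        mult A (svec (Defs.refl (grad a) v)) (grp s) + scale A c (one A)"
      unfolding s_def by (rule simple_refl_vec[OF refl(2)])
    have Tf: "propagate f \<in> chamberwise_analytic \<Delta> M"
      by (rule propagate_mem[OF f])
    have Qs: "Q (grp s) f \<in> analytic_tensor M" and Qv: "Q (svec v) f \<in> analytic_tensor M"
      by (intro Q_closed f)+
    let ?v = "Defs.refl (grad a) v"
    have "Q (grp s) (Q (svec v) f) = Q (svec ?v) (Q (grp s) f) + fscale M c f"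
      by (simp only: Q_mult[OF f, symmetric] c Q_plus[OF f] Q_scale[OF f] Q_one[OF f])
    then have "propagate (Q (grp s) (Q (svec v) f)) =
        propagate (Q (svec ?v) (Q (grp s) f)) + fscale M c (propagate f)"
      using propagate_linear f Q_closed[OF Qs] fscale_mem_analytic[OF f]
      by (simp add: linear_between_def)
    then have 1: "dot_act M s (propagate (Q (svec v) f)) =
        propagate (Q (svec ?v) (Q (grp s) f)) + fscale M c (propagate f)"
      by (simp only: propagate_equivariant[OF Qv s])
    have "D (grp s) (D (svec v) (propagate f)) =
        D (svec ?v) (D (grp s) (propagate f)) + fscale M c (propagate f)"
      by (simp only: D_mult[OF Tf, symmetric] c D_plus[OF Tf] D_scale[OF Tf] D_one[OF Tf])
    then have 2: "dot_act M s (D (svec v) (propagate f)) =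
        D (svec ?v) (propagate (Q (grp s) f)) + fscale M c (propagate f)"
      by (simp only: D_grp[OF D_closed[OF Tf] s] D_grp[OF Tf s] propagate_equivariant[OF f s])
    have "propagate (Q (svec ?v) (Q (grp s) f)) (s x) = D (svec ?v) (propagate (Q (grp s) f)) (s x)"
      using refl(3) Qs unfolding s_def by blast
    then have "dot_act M s (propagate (Q (svec v) f)) (s x) = dot_act M s (D (svec v) (propagate f)) (s x)"
      by (simp add: 1 2)
    then have "mact M s (propagate (Q (svec v) f) x) = mact M s (D (svec v) (propagate f) x)"
      by (simp add: dot_act_def inv_apply[OF s])
    \<comment> \<open>The action of \<open>s\<close> on the module is invertible, so the equality
      survives removing it.\<close>
    then have "mact M (inv s) (mact M s (propagate (Q (svec v) f) x)) =
        mact M (inv s) (mact M s (D (svec v) (propagate f) x))"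
      by simp
    then show "propagate (Q (svec v) f) x = D (svec v) (propagate f) x"
      by (simp only: mact_inv[OF s])
  qed
qed

lemma propagate_hom:
  "alg_module_hom (fscale M) (analytic_tensor M) Q (fscale M) (chamberwise_analytic \<Delta> M) D propagate"
proof (rule alg_module_homI[OF hecke Q_alg_module D_alg_module propagate_linear])
  fix w f assume w: "w \<in> affine_weyl_group \<Delta>" and f: "f \<in> analytic_tensor M"
  show "propagate (Q (grp w) f) = D (grp w) (propagate f)"
    by (simp add: propagate_equivariant[OF f w] D_grp[OF propagate_mem[OF f] w])
next
  fix b f assume f: "f \<in> analytic_tensor M"
  show "propagate (Q (svec b) f) = D (svec b) (propagate f)"
  proof
    fix x
    have "D (svec b) (propagate f) \<in> chamberwise_analytic \<Delta> M"
      by (rule D_closed[OF propagate_mem[OF f]])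
    then have "D (svec b) (propagate f) x = 0" if "x \<notin> regular_set \<Delta>"
      using that by (simp add: chamberwise_analytic_def)
    then show "propagate (Q (svec b) f) x = D (svec b) (propagate f) x"
      using propagate_vec f by (cases "x \<in> regular_set \<Delta>") (auto simp: propagate_outside)
  qed
qed

end


section \<open>Functoriality and naturality\<close>

text \<open>Tensors are identified with functions, so acting on the vectors alone is
  composition.\<close>

lemma ir_map_eq_comp:
  assumes "Vector_Spaces.linear (mscale M) (mscale M') \<phi>" "f \<in> analytic_tensor M"
  shows "ir_map M M' \<phi> f = \<phi> \<circ> f"
proof -
  interpret phi: Vector_Spaces.linear "mscale M" "mscale M'" \<phi>
    by (rule assms)
  show ?thesis
    unfolding ir_map_def by (rule tensor_map_id_eq_comp[OF phi.vs1.vector_space_axioms assms])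
qed

section \<open>Composition with a homomorphism of group modules\<close>

locale hecke_modules_hom =
  M: hecke_modules \<Delta> M k A Q D + M': hecke_modules \<Delta> M' k A Q' D'
  for \<Delta> :: "'v::euclidean_space root_data"
    and M :: "('v, 'm::ab_group_add) weyl_rep" and M' :: "('v, 'n::ab_group_add) weyl_rep"
    and k :: "('v \<Rightarrow> real) \<Rightarrow> complex" and A :: "('v, 'a::ab_group_add) alg_data"
    and Q D :: "'a \<Rightarrow> ('v \<Rightarrow> 'm) \<Rightarrow> 'v \<Rightarrow> 'm" and Q' D' :: "'a \<Rightarrow> ('v \<Rightarrow> 'n) \<Rightarrow> 'v \<Rightarrow> 'n" +
  fixes \<phi> :: "'m \<Rightarrow> 'n"
  assumes hom: "weyl_module_hom \<Delta> M M' \<phi>"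
begin

lemma linear_hom: "Vector_Spaces.linear (mscale M) (mscale M') \<phi>"
  and hom_mact: "w \<in> affine_weyl_group \<Delta> \<Longrightarrow> \<phi> (mact M w m) = mact M' w (\<phi> m)"
  using hom by (simp_all add: weyl_module_hom_def)

sublocale phi: Vector_Spaces.linear "mscale M" "mscale M'" \<phi>
  by (rule linear_hom)

lemma comp_analytic: "f \<in> analytic_tensor M \<Longrightarrow> \<phi> \<circ> f \<in> analytic_tensor M'"
  by (rule comp_mem_analytic_tensor[OF M.vector_space_mscale linear_hom])

lemma comp_add: "\<phi> \<circ> (f + g) = (\<phi> \<circ> f) + (\<phi> \<circ> g)"
  and comp_fscale: "\<phi> \<circ> fscale M c f = fscale M' c (\<phi> \<circ> f)"
  by (simp_all add: fun_eq_iff fscale_def phi.add phi.scale)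

text \<open>\<open>ir_module\<close> gives formulas for \<open>Q\<close> only on simple reflections
  and length-zero elements; induction over words extends the compatibility to all of the
  group.\<close>

lemma comp_Q_grp:
  assumes "w \<in> affine_weyl_group \<Delta>"
  shows "\<forall>f\<in>analytic_tensor M. \<phi> \<circ> Q (M.grp w) f = Q' (M.grp w) (\<phi> \<circ> f)"
  using assms
proof (induction rule: M.affine_weyl_group_induct)
  case (length_zero w)
  show ?case
  proof
    fix f assume f: "f \<in> analytic_tensor M"
    show "\<phi> \<circ> Q (M.grp w) f = Q' (M.grp w) (\<phi> \<circ> f)"
      unfolding M.Q_length_zero[OF f length_zero] M'.Q_length_zero[OF comp_analytic[OF f] length_zero]
      by (simp add: fun_eq_iff hom_mact M.length_zero_mem length_zero)
  qed
next
  case (refl a w)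
  have s: "affine_refl a \<in> affine_weyl_group \<Delta>"
    by (rule M.affine_refl_mem[OF M.simple_affine_root_mem[OF refl(1)]])
  \<comment> \<open>Proved for every \<open>g\<close>, because it is applied to
    \<open>Q (M.grp w) f\<close> below.\<close>
  have simple: "\<phi> \<circ> Q (M.grp (affine_refl a)) g = Q' (M.grp (affine_refl a)) (\<phi> \<circ> g)"
    if g: "g \<in> analytic_tensor M" for g
  proof -
    have "\<phi> \<circ> (u - fscale M c h) = (\<phi> \<circ> u) - fscale M' c (\<phi> \<circ> h)" for u h c
      by (simp add: fun_eq_iff fscale_def phi.diff phi.scale)
    moreover have "tensor_map M' M' (fun_act (affine_refl a)) (mact M' (affine_refl a)) (\<phi> \<circ> g) =
        \<phi> \<circ> tensor_map M M (fun_act (affine_refl a)) (mact M (affine_refl a)) g"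
      by (simp add: fun_eq_iff hom_mact[OF s]
          tensor_map_fun_act_eq[OF M.vector_space_mscale M.mact_linear[OF s] g]
          tensor_map_fun_act_eq[OF M'.vector_space_mscale M'.mact_linear[OF s] comp_analytic[OF g]])
    ultimately show ?thesis
      by (simp add: M.Q_simple[OF g refl(1)] M'.Q_simple[OF comp_analytic[OF g] refl(1)]
          tensor_map_hom_comp[OF analytic_linear_integral_op linear_hom g])
  qed
  show ?case
  proof
    fix f assume f: "f \<in> analytic_tensor M"
    have "\<phi> \<circ> Q (M.grp w) f = Q' (M.grp w) (\<phi> \<circ> f)"
      using refl(3) f by blast
    then show "\<phi> \<circ> Q (M.grp (affine_refl a \<circ> w)) f = Q' (M.grp (affine_refl a \<circ> w)) (\<phi> \<circ> f)"
      by (simp only: M.Q_comp[OF s refl(2) f] M'.Q_comp[OF s refl(2) comp_analytic[OF f]]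
          simple[OF M.Q_closed[OF f]])
  qed
qed

lemma ir_map_hom:
  "alg_module_hom (fscale M) (analytic_tensor M) Q (fscale M') (analytic_tensor M') Q' (ir_map M M' \<phi>)"
proof (rule alg_module_homI[OF M.hecke M.Q_alg_module M'.Q_alg_module])
  show "linear_between (fscale M) (analytic_tensor M) (fscale M') (analytic_tensor M') (ir_map M M' \<phi>)"
    unfolding linear_between_def
    by (simp add: ir_map_eq_comp[OF linear_hom] comp_analytic comp_add comp_fscale
        M.add_mem_analytic M.fscale_mem_analytic)
next
  fix b f assume f: "f \<in> analytic_tensor M"
  show "ir_map M M' \<phi> (Q (M.svec b) f) = Q' (M.svec b) (ir_map M M' \<phi> f)"
    using M.Q_closed[OF f, of "M.svec b"]
    by (simp only: ir_map_eq_comp[OF linear_hom] f M.Q_vec[OF f] M'.Q_vec[OF comp_analytic[OF f]]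
        tensor_map_hom_comp[OF analytic_linear_dir_deriv linear_hom f])
next
  fix w f assume w: "w \<in> affine_weyl_group \<Delta>" and f: "f \<in> analytic_tensor M"
  show "ir_map M M' \<phi> (Q (M.grp w) f) = Q' (M.grp w) (ir_map M M' \<phi> f)"
    using comp_Q_grp[OF w] f by (simp add: ir_map_eq_comp[OF linear_hom] M.Q_closed)
qed

lemma comp_chamberwise:
  assumes "f \<in> chamberwise_analytic \<Delta> M"
  shows "\<phi> \<circ> f \<in> chamberwise_analytic \<Delta> M'"
  unfolding chamberwise_analytic_def mem_Collect_eq
proof (intro conjI ballI allI impI)
  fix x assume "x \<notin> regular_set \<Delta>"
  then show "(\<phi> \<circ> f) x = 0"
    using assms by (simp add: chamberwise_analytic_def phi.zero)
next
  fix C assume "C \<in> components (regular_set \<Delta>)"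
  then obtain h where "h \<in> analytic_tensor M" "\<forall>x\<in>C. f x = h x"
    using assms unfolding chamberwise_analytic_def by blast
  then show "\<exists>h\<in>analytic_tensor M'. \<forall>x\<in>C. (\<phi> \<circ> f) x = h x"
    by (intro bexI[of _ "\<phi> \<circ> h"]) (auto simp: comp_analytic)
qed

text \<open>The two parts of the operator are treated separately: the derivative by
  \<open>tensor_map_hom_comp\<close>, the reflection terms by equivariance of
  \<open>\<phi>\<close>.\<close>

lemma comp_dunkl_op:
  assumes f: "f \<in> chamberwise_analytic \<Delta> M"
  shows "\<phi> \<circ> dunkl_op \<Delta> k M v f = dunkl_op \<Delta> k M' v (\<phi> \<circ> f)"
proof
  fix x
  show "(\<phi> \<circ> dunkl_op \<Delta> k M v f) x = dunkl_op \<Delta> k M' v (\<phi> \<circ> f) x"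
  proof (cases "x \<in> regular_set \<Delta>")
    case x: True
    define C where "C = connected_component_set (regular_set \<Delta>) x"
    have C: "C \<in> components (regular_set \<Delta>)"
      unfolding C_def by (rule M.connected_component_mem[OF x])
    note nonempty = in_components_nonempty[OF C]
    obtain h where h: "h \<in> analytic_tensor M" "\<And>y. y \<in> C \<Longrightarrow> f y = h y"
      using f C unfolding chamberwise_analytic_def by auto
    \<comment> \<open>If \<open>h\<close> extends \<open>f\<close> from the chamber,
      \<open>\<phi> \<circ> h\<close> extends \<open>\<phi> \<circ> f\<close>; uniqueness of
      extensions then evaluates both descriptions.\<close>
    have ext: "chamber_ext M C f = h" "chamber_ext M' C (\<phi> \<circ> f) = \<phi> \<circ> h"
      by (intro chamber_ext_eqI M.vector_space_mscale M'.vector_space_mscale comp_analytic h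
          M.open_component C nonempty; simp add: h)+
    have "\<phi> (dot_act M (affine_refl a) f x) = dot_act M' (affine_refl a) (\<phi> \<circ> f) x"
      if "a \<in> pos_affine_roots \<Delta>" for a
      using that M.pos_affine_roots_subset by (auto simp: dot_act_def hom_mact M.affine_refl_mem)
    then show ?thesis
      using x by (simp add: dunkl_op_def C_def[symmetric] ext phi.diff phi.sum phi.scale
          tensor_map_hom_comp[OF analytic_linear_dir_deriv linear_hom h(1)])
  qed (simp add: dunkl_op_def phi.zero)
qed

lemma dr_map_hom:
  "alg_module_hom (fscale M) (chamberwise_analytic \<Delta> M) D
     (fscale M') (chamberwise_analytic \<Delta> M') D' (dr_map \<phi>)"
proof (rule alg_module_homI[OF M.hecke M.D_alg_module M'.D_alg_module])
  show "linear_between (fscale M) (chamberwise_analytic \<Delta> M) (fscale M') (chamberwise_analytic \<Delta> M') (dr_map \<phi>)"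
    unfolding linear_between_def dr_map_def by (simp add: comp_chamberwise comp_add comp_fscale)
next
  fix b f assume f: "f \<in> chamberwise_analytic \<Delta> M"
  show "dr_map \<phi> (D (M.svec b) f) = D' (M.svec b) (dr_map \<phi> f)"
    by (simp only: dr_map_def M.D_vec[OF f] M'.D_vec[OF comp_chamberwise[OF f]] comp_dunkl_op[OF f])
next
  fix w f assume w: "w \<in> affine_weyl_group \<Delta>" and f: "f \<in> chamberwise_analytic \<Delta> M"
  show "dr_map \<phi> (D (M.grp w) f) = D' (M.grp w) (dr_map \<phi> f)"
    by (simp add: dr_map_def M.D_grp[OF f w] M'.D_grp[OF comp_chamberwise[OF f] w])
      (simp add: fun_eq_iff dot_act_def hom_mact[OF w])
qed

text \<open>\<open>propagate_eq\<close> permits the same \<open>w\<close> on both sides, and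
  \<open>\<phi>\<close> commutes with \<open>Q\<close> on \<open>w\<close> and with the inverse of
  \<open>w\<close> on the modules.\<close>

lemma propagate_natural:
  assumes f: "f \<in> analytic_tensor M"
  shows "dr_map \<phi> (M.propagate f) = M'.propagate (ir_map M M' \<phi> f)"
proof
  fix x
  show "dr_map \<phi> (M.propagate f) x = M'.propagate (ir_map M M' \<phi> f) x"
  proof (cases "x \<in> regular_set \<Delta>")
    case True
    then obtain w where w: "w \<in> affine_weyl_group \<Delta>" "w x \<in> fundamental_chamber \<Delta>"
      using M.regular_set_conjugate by blast
    have "\<phi> \<circ> Q (M.grp w) f = Q' (M.grp w) (\<phi> \<circ> f)"
      using comp_Q_grp[OF w(1)] f by blast
    then have "Q' (M.grp w) (\<phi> \<circ> f) y = \<phi> (Q (M.grp w) f y)" for y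
      by (metis comp_apply)
    then show ?thesis
      by (simp add: dr_map_def ir_map_eq_comp[OF linear_hom f] M.propagate_eq[OF f w]
          M'.propagate_eq[OF comp_analytic[OF f] w] hom_mact[OF M.inv_affine_weyl_group[OF w(1)]])
  qed (simp add: dr_map_def M.propagate_outside M'.propagate_outside phi.zero)
qed

end

theorem proposition4p15:
  fixes \<Delta> :: "'v::euclidean_space root_data"
    and k :: "('v \<Rightarrow> real) \<Rightarrow> complex"
    and A :: "('v, 'a::ab_group_add) alg_data"
    and M :: "('v, 'm::ab_group_add) weyl_rep"
    and M' :: "('v, 'n::ab_group_add) weyl_rep"
    and M'' :: "('v, 'p::ab_group_add) weyl_rep"
    and Q D :: "'a \<Rightarrow> ('v \<Rightarrow> 'm) \<Rightarrow> 'v \<Rightarrow> 'm"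
    and Q' D' :: "'a \<Rightarrow> ('v \<Rightarrow> 'n) \<Rightarrow> 'v \<Rightarrow> 'n"
  assumes "root_datum \<Delta>"
    and "multiplicity_function \<Delta> k"
    and "hecke_algebra \<Delta> k A"
    and "weyl_module \<Delta> M" and "weyl_module \<Delta> M'" and "weyl_module \<Delta> M''"
    and "ir_module \<Delta> k A M Q" and "dr_module \<Delta> k A M D"
    and "ir_module \<Delta> k A M' Q'" and "dr_module \<Delta> k A M' D'"
  shows
    "(\<forall>\<phi>. weyl_module_hom \<Delta> M M' \<phi> \<longrightarrow>
        alg_module_hom (fscale M) (analytic_tensor M) Q
          (fscale M') (analytic_tensor M') Q' (ir_map M M' \<phi>) \<and>
        alg_module_hom (fscale M) (chamberwise_analytic \<Delta> M) D
          (fscale M') (chamberwise_analytic \<Delta> M') D' (dr_map \<phi>)) \<and>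
     (\<forall>f\<in>analytic_tensor M. ir_map M M id f = f) \<and>
     (\<forall>f\<in>chamberwise_analytic \<Delta> M. dr_map id f = f) \<and>
     (\<forall>\<phi> \<psi>. weyl_module_hom \<Delta> M M' \<phi> \<longrightarrow> weyl_module_hom \<Delta> M' M'' \<psi> \<longrightarrow>
        (\<forall>f\<in>analytic_tensor M. ir_map M M'' (\<psi> \<circ> \<phi>) f = ir_map M' M'' \<psi> (ir_map M M' \<phi> f)) \<and>
        (\<forall>f\<in>chamberwise_analytic \<Delta> M. dr_map (\<psi> \<circ> \<phi>) f = dr_map \<psi> (dr_map \<phi> f))) \<and>
     is_propagation \<Delta> A M Q (propagation \<Delta> A M Q) \<and>
     alg_module_hom (fscale M) (analytic_tensor M) Q
       (fscale M) (chamberwise_analytic \<Delta> M) D (propagation \<Delta> A M Q) \<and>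
     (\<forall>\<phi>. weyl_module_hom \<Delta> M M' \<phi> \<longrightarrow>
        (\<forall>f\<in>analytic_tensor M.
           dr_map \<phi> (propagation \<Delta> A M Q f) = propagation \<Delta> A M' Q' (ir_map M M' \<phi> f)))"
proof -
  interpret M: hecke_modules \<Delta> M k A Q D
    by unfold_locales (use assms in auto)
  interpret M': hecke_modules \<Delta> M' k A Q' D'
    by unfold_locales (use assms in auto)
  have homs: "hecke_modules_hom \<Delta> M M' k A Q D Q' D' \<phi>" if "weyl_module_hom \<Delta> M M' \<phi>" for \<phi>
    by unfold_locales (rule that)
  have lin_id: "Vector_Spaces.linear (mscale M) (mscale M) id"
    by (rule vector_space.linear_id[OF M.vector_space_mscale])
  \<comment> \<open>With \<open>ir_map\<close> turned into composition this is associativity;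
    membership of \<open>\<phi> \<circ> f\<close> in the tensor space allows the outer
    \<open>ir_map\<close> to be rewritten.\<close>
  have functorial: "ir_map M M'' (\<psi> \<circ> \<phi>) f = ir_map M' M'' \<psi> (ir_map M M' \<phi> f)"
    if "weyl_module_hom \<Delta> M M' \<phi>" "weyl_module_hom \<Delta> M' M'' \<psi>" "f \<in> analytic_tensor M" for \<phi> \<psi> f
  proof -
    interpret hecke_modules_hom \<Delta> M M' k A Q D Q' D' \<phi>
      by (rule homs[OF that(1)])
    have psi: "Vector_Spaces.linear (mscale M') (mscale M'') \<psi>"
      using that(2) by (simp add: weyl_module_hom_def)
    then have "Vector_Spaces.linear (mscale M) (mscale M'') (\<psi> \<circ> \<phi>)"
      by (rule Vector_Spaces.linear_compose[OF linear_hom])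
    then show ?thesis
      by (simp add: ir_map_eq_comp that linear_hom psi comp_analytic comp_assoc)
  qed
  show ?thesis
    unfolding M.propagation_eq M'.propagation_eq
    using hecke_modules_hom.ir_map_hom[OF homs] hecke_modules_hom.dr_map_hom[OF homs]
      hecke_modules_hom.propagate_natural[OF homs] functorial
      M.is_propagation_propagate M.propagate_hom
    by (auto simp: ir_map_eq_comp[OF lin_id] dr_map_def comp_assoc)
qed

end
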